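(* Let $1\le m\leq n$, let $G'$ be a connected reductive group, let $\rho$ be a rational representation of $\operatorname{GL}(n)\times G'$ on a finite-dimensional complex vector space $F$, and let $G=\operatorname{GL}(m)\times\operatorname{GL}(n)\times G'$ act on $V=M_{m,n}\oplus F$ by $(g,h,g')\cdot(X,y)=((g^{t})^{-1}Xh^{-1},\rho(h,g')y)$. Let $H=\operatorname{GL}(m)\times\operatorname{GL}(n-m)\times G'\subset\operatorname{GL}(n)\times G'$, with $\operatorname{GL}(m)\times\operatorname{GL}(n-m)\subset\operatorname{GL}(n)$ the block-diagonal matrices, acting on $F$ via $\rho$. Let $v=\left(\begin{bmatrix}I_m&0\end{bmatrix},0\right)\in V$, and for $h\in\mathbb{C}[V]$ put $h_v(y)=h(v+y)$, $y\in F$. Let $\underline{f}=(f_1,\dots,f_l)$ be non-zero $G$-semi-invariants in $\mathbb{C}[V]$ of weights $\sigma_1,\dots,\sigma_l$, respectively, where $\sigma_i=\det^{d_i}\otimes\det^{e_i}\otimes\sigma_i'$ for $i=1,\dots,l$, with $d_i,e_i\in\mathbb{N}$ and $\sigma_i'$ a character of $G'$. Assume the product $\prod_{i=1}^l\left(\det^{e_i-d_i}\otimes\det^{e_i}\otimes\sigma_i'\right)$ is a multiplicity-free character of $H$ in $\mathbb{C}[F]$. Then the product $\sigma_1\cdots\sigma_l$ is a multiplicity-free character of $G$ in $\mathbb{C}[V]$. Moreover, for any tuple $\underline{m}=(m_1,\dots,m_l)\in\mathbb{N}^l$, the $b$-function of several variables decomposes (up to a non-zero constant factor) as $$b_{\underline{f},\underline{m}}(\underline{s})=[s]_{n-m,n}^{d_1,\dots,d_l}\cdot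 b_{\underline{f}_v,\underline{m}}(\underline{s}),$$ where $b_{\underline{f}_v,\underline{m}}(\underline{s})$ is the $b$-function of several variables of the tuple $\underline{f}_v=(f_{1,v},\dots,f_{l,v})$ of induced semi-invariants of $(H,F)$.
   Context: Everything is over $\mathbb{C}$; $\mathbb{N}$ includes $0$. A group $G$ acting on $V$ acts on $\mathbb{C}[V]$ by $(g\cdot f)(x)=f(g^{-1}x)$; $f$ is a semi-invariant of weight $\sigma$ (a character of $G$) if $g\cdot f=\sigma(g)f$. The multiplicity of $\sigma$ is the dimension of the space of semi-invariants of weight $\sigma$. A character $\sigma$ is multiplicity-free if the multiplicity of $\sigma^k$ is $1$ for every $k\in\mathbb{N}$. For a tuple $\underline{m}=(m_1,\dots,m_l)$ fixed, and integers $0\le a\leq b$, $$[s]^{d_1,\dots,d_l}_{a,b}=\prod_{i=a+1}^{b}\prod_{j=0}^{d-1}(d_1s_1+\dots+d_ls_l+i+j),\qquad d=m_1d_1+\dots+m_ld_l.$$ $b$-functions of several variables: for a reductive group acting on a vector space $V$ and semi-invariants $f_1,\dots,f_l\in\mathbb{C}[V]$ of weights $\sigma_1,\dots,\sigma_l$ whose product $\sigma_1\cdots\sigma_l$ is multiplicity-free, each $f_i$ is homogeneous and has a dual semi-invariant $f_i^*\in\mathbb{C}[V^*]$ of weight $\sigma_i^{-1}$ and the same degree, unique up to a constant. Writing $\underline{f}^{\underline{s}}=\prod_i f_i^{s_i}$ and $\underline{f}^{*\underline{m}}=\prod_i (f_i^* )^{m_i}$, the $b$-function $b_{\underline{f},\underline{m}}(\underline{s})\in\mathbb{C}[s_1,\dots,s_l]$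 is the polynomial with $$\underline{f}^{*\underline{m}}(\partial x)\cdot\underline{f}^{\underline{s}+\underline{m}}(x)=b_{\underline{f},\underline{m}}(\underline{s})\,\underline{f}^{\underline{s}}(x),$$ where $f^*(\partial x)$ is the constant coefficient differential operator obtained by viewing coordinates on $V^*$ as partial derivatives on $V$. It is well defined up to a non-zero constant. *)

theory Defs
  imports
    "HOL-Analysis.Derivative"
    "HOL-Analysis.Function_Topology"
    "HOL-Library.Poly_Mapping"
    "HOL-Algebra.Coset"
    "Jordan_Normal_Form.VS_Connect"
begin

section \<open>Polynomials with complex coefficients\<close>

text \<open>Polynomials in variables indexed by \<open>'i\<close>; a monomial is a finitely supported exponent vector.\<close>

type_synonym 'i mpoly = "('i \<Rightarrow>\<^sub>0 nat) \<Rightarrow>\<^sub>0 complex"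

definition polys :: "'i set \<Rightarrow> 'i mpoly set" where
  "polys I = {P. \<forall>\<alpha> \<in> Poly_Mapping.keys P. Poly_Mapping.keys \<alpha> \<subseteq> I}"

definition Const :: "complex \<Rightarrow> 'i mpoly" where
  "Const c = Poly_Mapping.single 0 c"

definition Var :: "'i \<Rightarrow> 'i mpoly" where
  "Var i = Poly_Mapping.single (Poly_Mapping.single i 1) 1"

text \<open>The value at \<open>x\<close> of a polynomial whose coefficients are transported along \<open>\<phi>\<close>.\<close>

definition insertion :: "(complex \<Rightarrow> 'a::comm_ring_1) \<Rightarrow> ('i \<Rightarrow> 'a) \<Rightarrow> 'i mpoly \<Rightarrow> 'a" where
  "insertion \<phi> x P = (\<Sum>\<alpha> \<in> Poly_Mapping.keys P.
     \<phi> (Poly_Mapping.lookup P \<alpha>) * (\<Prod>i \<in> Poly_Mapping.keys \<alpha>. x i ^ Poly_Mapping.lookup \<alpha> i))"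

abbreviation eval :: "'i mpoly \<Rightarrow> ('i \<Rightarrow> complex) \<Rightarrow> complex" where
  "eval P x \<equiv> insertion (\<lambda>c. c) x P"

abbreviation subst :: "('i \<Rightarrow> 'j mpoly) \<Rightarrow> 'i mpoly \<Rightarrow> 'j mpoly" where
  "subst \<equiv> insertion Const"

definition total_degree :: "'i mpoly \<Rightarrow> nat" where
  "total_degree P = Max (insert 0
     ((\<lambda>\<alpha>. \<Sum>i \<in> Poly_Mapping.keys \<alpha>. Poly_Mapping.lookup \<alpha> i) ` Poly_Mapping.keys P))"

definition mpoly_scale :: "complex \<Rightarrow> 'i mpoly \<Rightarrow> 'i mpoly" where
  "mpoly_scale c P = Const c * P"

lemma vector_space_mpoly_scale: "Vector_Spaces.vector_space (mpoly_scale :: complex \<Rightarrow> 'i mpoly \<Rightarrow> 'i mpoly)"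
proof
  fix a b :: complex and x y :: "'i mpoly"
  show "mpoly_scale a (x + y) = mpoly_scale a x + mpoly_scale a y"
    by (simp add: mpoly_scale_def distrib_left)
  show "mpoly_scale (a + b) x = mpoly_scale a x + mpoly_scale b x"
    by (simp add: mpoly_scale_def Const_def single_add distrib_right)
  show "mpoly_scale a (mpoly_scale b x) = mpoly_scale (a * b) x"
    by (simp add: mpoly_scale_def Const_def mult.assoc[symmetric] mult_single)
  show "mpoly_scale 1 x = x"
    by (simp add: mpoly_scale_def Const_def)
qed


section \<open>Linear algebraic groups and rational representations\<close>

definition GL :: "nat \<Rightarrow> complex mat monoid" where
  "GL n = units_of (ring_mat TYPE(complex) n ())"

text \<open>The algebra of functions generated by a set of functions.\<close>

inductive_set gen_algebra :: "('g \<Rightarrow> complex) set \<Rightarrow> ('g \<Rightarrow> complex) set"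
  for C :: "('g \<Rightarrow> complex) set" where
  const: "(\<lambda>_. c) \<in> gen_algebra C"
| gen: "\<phi> \<in> C \<Longrightarrow> \<phi> \<in> gen_algebra C"
| add: "\<phi> \<in> gen_algebra C \<Longrightarrow> \<psi> \<in> gen_algebra C \<Longrightarrow> (\<lambda>g. \<phi> g + \<psi> g) \<in> gen_algebra C"
| mult: "\<phi> \<in> gen_algebra C \<Longrightarrow> \<psi> \<in> gen_algebra C \<Longrightarrow> (\<lambda>g. \<phi> g * \<psi> g) \<in> gen_algebra C"

text \<open>Generators of the coordinate rings of \<open>GL N\<close> and of \<open>GL n \<times> GL N\<close>.\<close>

definition GL_coords :: "nat \<Rightarrow> (complex mat \<Rightarrow> complex) set" where
  "GL_coords N = {\<lambda>A. A $$ (i, j) | i j. i < N \<and> j < N} \<union> {\<lambda>A. inverse (Determinant.det A)}"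

definition GL_prod_coords :: "nat \<Rightarrow> nat \<Rightarrow> (complex mat \<times> complex mat \<Rightarrow> complex) set" where
  "GL_prod_coords n N = (\<lambda>\<phi>. \<phi> \<circ> fst) ` GL_coords n \<union> (\<lambda>\<phi>. \<phi> \<circ> snd) ` GL_coords N"

definition zariski_closed :: "nat \<Rightarrow> complex mat set \<Rightarrow> bool" where
  "zariski_closed N Z \<longleftrightarrow>
     (\<exists>\<Phi> \<subseteq> gen_algebra (GL_coords N). Z = {A \<in> carrier (GL N). \<forall>\<phi> \<in> \<Phi>. \<phi> A = 0})"

definition linear_algebraic_group :: "nat \<Rightarrow> complex mat set \<Rightarrow> bool" where
  "linear_algebraic_group N K \<longleftrightarrow> subgroup K (GL N) \<and> zariski_closed N K"

abbreviation group_on :: "nat \<Rightarrow> complex mat set \<Rightarrow> complex mat monoid" where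
  "group_on N K \<equiv> (GL N)\<lparr>carrier := K\<rparr>"

definition zariski_connected :: "nat \<Rightarrow> complex mat set \<Rightarrow> bool" where
  "zariski_connected N K \<longleftrightarrow>
     \<not> (\<exists>Y Z. zariski_closed N Y \<and> zariski_closed N Z \<and> Y \<noteq> {} \<and> Z \<noteq> {} \<and> Y \<inter> Z = {} \<and> Y \<union> Z = K)"

text \<open>\<open>C\<close> is a set of generators of the coordinate ring of (an algebraic group containing) \<open>\<G>\<close>.\<close>

definition rational_rep ::
  "('g, 'z) monoid_scheme \<Rightarrow> ('g \<Rightarrow> complex) set \<Rightarrow> nat \<Rightarrow> ('g \<Rightarrow> complex mat) \<Rightarrow> bool" where
  "rational_rep \<G> C q \<tau> \<longleftrightarrow> \<tau> \<in> hom \<G> (GL q) \<and>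
     (\<forall>i<q. \<forall>j<q. \<exists>\<phi> \<in> gen_algebra C. \<forall>g \<in> carrier \<G>. \<tau> g $$ (i, j) = \<phi> g)"

definition rational_character :: "nat \<Rightarrow> complex mat set \<Rightarrow> (complex mat \<Rightarrow> complex) \<Rightarrow> bool" where
  "rational_character N K \<omega> \<longleftrightarrow>
     (\<forall>g \<in> K. \<omega> g \<noteq> 0) \<and>
     (\<forall>g \<in> K. \<forall>h \<in> K. \<omega> (g * h) = \<omega> g * \<omega> h) \<and>
     (\<exists>\<phi> \<in> gen_algebra (GL_coords N). \<forall>g \<in> K. \<omega> g = \<phi> g)"

definition invariant_subspace ::
  "('g, 'z) monoid_scheme \<Rightarrow> nat \<Rightarrow> ('g \<Rightarrow> complex mat) \<Rightarrow> complex vec set \<Rightarrow> bool" where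
  "invariant_subspace \<G> q \<tau> W \<longleftrightarrow>
     VectorSpace.subspace class_ring W (module_vec TYPE(complex) q) \<and>
     (\<forall>g \<in> carrier \<G>. \<forall>w \<in> W. \<tau> g *\<^sub>v w \<in> W)"

definition completely_reducible ::
  "('g, 'z) monoid_scheme \<Rightarrow> nat \<Rightarrow> ('g \<Rightarrow> complex mat) \<Rightarrow> bool" where
  "completely_reducible \<G> q \<tau> \<longleftrightarrow>
     (\<forall>W. invariant_subspace \<G> q \<tau> W \<longrightarrow>
        (\<exists>W'. invariant_subspace \<G> q \<tau> W' \<and> W \<inter> W' = {0\<^sub>v q} \<and>
              (\<forall>x \<in> carrier_vec q. \<exists>w \<in> W. \<exists>w' \<in> W'. x = w + w')))"

text \<open>Reductivity in the sense of invariant theory over the complex numbers: every rational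
  representation is completely reducible (over \<open>\<complex>\<close> this is the same as having trivial unipotent radical).\<close>

definition reductive :: "nat \<Rightarrow> complex mat set \<Rightarrow> bool" where
  "reductive N K \<longleftrightarrow>
     (\<forall>q \<tau>. rational_rep (group_on N K) (GL_coords N) q \<tau> \<longrightarrow>
        completely_reducible (group_on N K) q \<tau>)"


section \<open>Semi-invariants\<close>

text \<open>Coordinate space with finite index set \<open>I\<close>; coordinates outside \<open>I\<close> vanish.\<close>

definition cspace :: "'i set \<Rightarrow> ('i \<Rightarrow> complex) set" where
  "cspace I = {x. \<forall>i. i \<notin> I \<longrightarrow> x i = 0}"

definition semi_invariant ::
  "('g, 'z) monoid_scheme \<Rightarrow> ('g \<Rightarrow> ('i \<Rightarrow> complex) \<Rightarrow> 'i \<Rightarrow> complex) \<Rightarrow> 'i set \<Rightarrow>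
     ('g \<Rightarrow> complex) \<Rightarrow> 'i mpoly \<Rightarrow> bool" where
  "semi_invariant \<G> act I \<sigma> f \<longleftrightarrow> f \<in> polys I \<and>
     (\<forall>g \<in> carrier \<G>. \<forall>x \<in> cspace I. eval f (act (inv\<^bsub>\<G>\<^esub> g) x) = \<sigma> g * eval f x)"

text \<open>Here \<open>dim\<close> is \<open>0\<close> for infinite-dimensional spaces, so multiplicity \<open>1\<close> does mean that the
  space of semi-invariants is a line.\<close>

definition multiplicity ::
  "('g, 'z) monoid_scheme \<Rightarrow> ('g \<Rightarrow> ('i \<Rightarrow> complex) \<Rightarrow> 'i \<Rightarrow> complex) \<Rightarrow> 'i set \<Rightarrow>
     ('g \<Rightarrow> complex) \<Rightarrow> nat" where
  "multiplicity \<G> act I \<sigma> =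
     Vector_Spaces.vector_space.dim mpoly_scale {f. semi_invariant \<G> act I \<sigma> f}"

definition multiplicity_free ::
  "('g, 'z) monoid_scheme \<Rightarrow> ('g \<Rightarrow> ('i \<Rightarrow> complex) \<Rightarrow> 'i \<Rightarrow> complex) \<Rightarrow> 'i set \<Rightarrow>
     ('g \<Rightarrow> complex) \<Rightarrow> bool" where
  "multiplicity_free \<G> act I \<sigma> \<longleftrightarrow> (\<forall>k::nat. multiplicity \<G> act I (\<lambda>g. \<sigma> g ^ k) = 1)"

text \<open>The contragredient action on the dual space, in the dual coordinates:
  \<open>\<langle>g \<xi>, x\<rangle> = \<langle>\<xi>, g\<^sup>-\<^sup>1 x\<rangle>\<close> with \<open>\<langle>\<xi>, x\<rangle> = (\<Sum>i\<in>I. \<xi> i * x i)\<close>, evaluated at the basis vectors.\<close>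

definition dual_act ::
  "('g, 'z) monoid_scheme \<Rightarrow> ('g \<Rightarrow> ('i \<Rightarrow> complex) \<Rightarrow> 'i \<Rightarrow> complex) \<Rightarrow> 'i set \<Rightarrow>
     'g \<Rightarrow> ('i \<Rightarrow> complex) \<Rightarrow> 'i \<Rightarrow> complex" where
  "dual_act \<G> act I g \<xi> = (\<lambda>i. if i \<in> I
     then \<Sum>k\<in>I. \<xi> k * act (inv\<^bsub>\<G>\<^esub> g) (\<lambda>j. if j = i then 1 else 0) k else 0)"

definition dual_semi_invariant ::
  "('g, 'z) monoid_scheme \<Rightarrow> ('g \<Rightarrow> ('i \<Rightarrow> complex) \<Rightarrow> 'i \<Rightarrow> complex) \<Rightarrow> 'i set \<Rightarrow>
     ('g \<Rightarrow> complex) \<Rightarrow> 'i mpoly \<Rightarrow> 'i mpoly \<Rightarrow> bool" where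
  "dual_semi_invariant \<G> act I \<sigma> f fs \<longleftrightarrow> fs \<noteq> 0 \<and>
     semi_invariant \<G> (dual_act \<G> act I) I (\<lambda>g. inverse (\<sigma> g)) fs \<and>
     total_degree fs = total_degree f"


section \<open>\<open>b\<close>-functions of several variables\<close>

definition partial :: "'i \<Rightarrow> (('i \<Rightarrow> complex) \<Rightarrow> complex) \<Rightarrow> ('i \<Rightarrow> complex) \<Rightarrow> complex" where
  "partial i F x = deriv (\<lambda>z. F (x(i := z))) (x i)"

text \<open>Partial derivatives of holomorphic functions commute, so the chosen enumeration of the
  variables of the monomial is immaterial.\<close>

definition monom_diff :: "('i \<Rightarrow>\<^sub>0 nat) \<Rightarrow> (('i \<Rightarrow> complex) \<Rightarrow> complex) \<Rightarrow> ('i \<Rightarrow> complex) \<Rightarrow> complex" where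
  "monom_diff \<alpha> F = fold (\<lambda>i. partial i ^^ Poly_Mapping.lookup \<alpha> i)
     (SOME is. distinct is \<and> set is = Poly_Mapping.keys \<alpha>) F"

definition diff_op :: "'i mpoly \<Rightarrow> (('i \<Rightarrow> complex) \<Rightarrow> complex) \<Rightarrow> ('i \<Rightarrow> complex) \<Rightarrow> complex" where
  "diff_op P F x = (\<Sum>\<alpha> \<in> Poly_Mapping.keys P. Poly_Mapping.lookup P \<alpha> * monom_diff \<alpha> F x)"

text \<open>Branches of the logarithms of \<open>f\<^sub>0, \<dots>, f\<^sub>l\<^sub>-\<^sub>1\<close> on an open set \<open>U\<close>
  (continuous, hence holomorphic).\<close>

definition log_branches ::
  "'i set \<Rightarrow> nat \<Rightarrow> (nat \<Rightarrow> 'i mpoly) \<Rightarrow> ('i \<Rightarrow> complex) set \<Rightarrow>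
     (nat \<Rightarrow> ('i \<Rightarrow> complex) \<Rightarrow> complex) \<Rightarrow> bool" where
  "log_branches I l f U L \<longleftrightarrow> openin (top_of_set (cspace I)) U \<and>
     (\<forall>j<l. continuous_on U (L j) \<and> (\<forall>x\<in>U. exp (L j x) = eval (f j) x))"

text \<open>The multivalued function \<open>f\<^sup>s\<close> for complex exponents, determined by branches of the logarithms.\<close>

definition multi_power ::
  "nat \<Rightarrow> (nat \<Rightarrow> ('i \<Rightarrow> complex) \<Rightarrow> complex) \<Rightarrow> (nat \<Rightarrow> complex) \<Rightarrow> ('i \<Rightarrow> complex) \<Rightarrow> complex" where
  "multi_power l L s x = exp (\<Sum>j<l. s j * L j x)"

text \<open>\<open>b\<close> is a \<open>b\<close>-function of the tuple \<open>f\<^sub>0, \<dots>, f\<^sub>l\<^sub>-\<^sub>1\<close> of non-zero semi-invariants of weights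
  \<open>\<sigma>\<^sub>0, \<dots>, \<sigma>\<^sub>l\<^sub>-\<^sub>1\<close> and of \<open>\<mu> = (\<mu>\<^sub>0, \<dots>, \<mu>\<^sub>l\<^sub>-\<^sub>1)\<close>. The duals are only determined up to non-zero constants,
  and so is \<open>b\<close>.\<close>

definition is_b_function ::
  "('g, 'z) monoid_scheme \<Rightarrow> ('g \<Rightarrow> ('i \<Rightarrow> complex) \<Rightarrow> 'i \<Rightarrow> complex) \<Rightarrow> 'i set \<Rightarrow> nat \<Rightarrow>
     (nat \<Rightarrow> 'g \<Rightarrow> complex) \<Rightarrow> (nat \<Rightarrow> 'i mpoly) \<Rightarrow> (nat \<Rightarrow> nat) \<Rightarrow> nat mpoly \<Rightarrow> bool" where
  "is_b_function \<G> act I l \<sigma> f \<mu> b \<longleftrightarrow>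
     (\<forall>j<l. f j \<noteq> 0 \<and> semi_invariant \<G> act I (\<sigma> j) (f j)) \<and>
     b \<in> polys {..<l} \<and>
     (\<exists>fs. (\<forall>j<l. dual_semi_invariant \<G> act I (\<sigma> j) (f j) (fs j)) \<and>
        (\<forall>s U L. log_branches I l f U L \<longrightarrow>
           (\<forall>x\<in>U. diff_op (\<Prod>j<l. fs j ^ \<mu> j) (multi_power l L (\<lambda>j. s j + of_nat (\<mu> j))) x
                    = eval b s * multi_power l L s x)))"

definition bracket :: "nat \<Rightarrow> (nat \<Rightarrow> nat) \<Rightarrow> (nat \<Rightarrow> nat) \<Rightarrow> nat \<Rightarrow> nat \<Rightarrow> nat mpoly" where
  "bracket l \<mu> d a b = (\<Prod>i\<in>{a+1..b}. \<Prod>j<(\<Sum>k<l. \<mu> k * d k).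
     (\<Sum>k<l. of_nat (d k) * Var k) + of_nat (i + j))"


section \<open>The groups \<open>G\<close> and \<open>H\<close>, their actions, and the slice\<close>

text \<open>Coordinates of \<open>V = M\<^sub>m\<^sub>,\<^sub>n \<oplus> F\<close> with \<open>F = \<complex>\<^sup>p\<close>: \<open>Inl (i, j)\<close> is the matrix entry in row \<open>i\<close> and
  column \<open>j\<close>, and \<open>Inr k\<close> is the \<open>k\<close>-th coordinate on \<open>F\<close> (all counted from \<open>0\<close>). Coordinates of \<open>F\<close> by
  itself are indexed by \<open>{..<p}\<close>.\<close>

type_synonym vcoord = "(nat \<times> nat) + nat"

definition V_index :: "nat \<Rightarrow> nat \<Rightarrow> nat \<Rightarrow> vcoord set" where
  "V_index m n p = Inl ` ({..<m} \<times> {..<n}) \<union> Inr ` {..<p}"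

definition V_point :: "nat \<Rightarrow> nat \<Rightarrow> nat \<Rightarrow> complex mat \<Rightarrow> complex vec \<Rightarrow> vcoord \<Rightarrow> complex" where
  "V_point m n p X y = (\<lambda>c. case c of
       Inl (i, j) \<Rightarrow> if i < m \<and> j < n then X $$ (i, j) else 0
     | Inr k \<Rightarrow> if k < p then vec_index y k else 0)"

definition group_G :: "nat \<Rightarrow> nat \<Rightarrow> nat \<Rightarrow> complex mat set \<Rightarrow> (complex mat \<times> complex mat \<times> complex mat) monoid" where
  "group_G m n N K = GL m \<times>\<times> (GL n \<times>\<times> group_on N K)"

definition act_V ::
  "nat \<Rightarrow> nat \<Rightarrow> nat \<Rightarrow> (complex mat \<times> complex mat \<Rightarrow> complex mat) \<Rightarrow>
     complex mat \<times> complex mat \<times> complex mat \<Rightarrow> (vcoord \<Rightarrow> complex) \<Rightarrow> vcoord \<Rightarrow> complex" where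
  "act_V m n p \<rho> = (\<lambda>(g, h, g') x. V_point m n p
     (inv\<^bsub>GL m\<^esub> (transpose_mat g) * mat m n (\<lambda>(i, j). x (Inl (i, j))) * inv\<^bsub>GL n\<^esub> h)
     (\<rho> (h, g') *\<^sub>v vec p (\<lambda>k. x (Inr k))))"

text \<open>\<open>H\<close> is given by the diagonal blocks of its elements; the representation \<open>\<rho>\<close> is applied to the
  block-diagonal matrix.\<close>

definition group_H :: "nat \<Rightarrow> nat \<Rightarrow> nat \<Rightarrow> complex mat set \<Rightarrow> (complex mat \<times> complex mat \<times> complex mat) monoid" where
  "group_H m n N K = GL m \<times>\<times> (GL (n - m) \<times>\<times> group_on N K)"

definition act_F ::
  "nat \<Rightarrow> nat \<Rightarrow> nat \<Rightarrow> (complex mat \<times> complex mat \<Rightarrow> complex mat) \<Rightarrow>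
     complex mat \<times> complex mat \<times> complex mat \<Rightarrow> (nat \<Rightarrow> complex) \<Rightarrow> nat \<Rightarrow> complex" where
  "act_F m n p \<rho> = (\<lambda>(h1, h2, g') y k. if k < p
     then vec_index (\<rho> (four_block_mat h1 (0\<^sub>m m (n - m)) (0\<^sub>m (n - m) m) h2, g') *\<^sub>v vec p y) k
     else 0)"

definition weight_G ::
  "nat \<Rightarrow> nat \<Rightarrow> (complex mat \<Rightarrow> complex) \<Rightarrow> complex mat \<times> complex mat \<times> complex mat \<Rightarrow> complex" where
  "weight_G d e \<omega> = (\<lambda>(g, h, g'). Determinant.det g ^ d * Determinant.det h ^ e * \<omega> g')"

definition weight_H ::
  "nat \<Rightarrow> nat \<Rightarrow> (complex mat \<Rightarrow> complex) \<Rightarrow> complex mat \<times> complex mat \<times> complex mat \<Rightarrow> complex" where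
  "weight_H d e \<omega> = (\<lambda>(h1, h2, g').
     Determinant.det h1 powi (int e - int d) * Determinant.det h2 ^ e * \<omega> g')"

text \<open>The polynomial \<open>h\<^sub>v(y) = h(v + y)\<close> on \<open>F\<close>, where \<open>v = ([I\<^sub>m 0], 0)\<close>.\<close>

definition slice :: "vcoord mpoly \<Rightarrow> nat mpoly" where
  "slice = subst (\<lambda>c. case c of Inl (i, j) \<Rightarrow> if i = j then 1 else 0 | Inr k \<Rightarrow> Var k)"

end

theory Submission
  imports Defs "HOL-Analysis.Complex_Transcendental" "HOL-Computational_Algebra.Polynomial"
begin

text \<open>Let \<open>\<langle>P, Q\<rangle>\<close> be the value of \<open>P(\<partial>) Q\<close> at the origin. Multiplication by \<open>P\<close> is adjoint to \<open>P(\<partial>)\<close>,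
  so the equation defining the \<open>b\<close>-function at a tuple \<open>r\<close> of natural numbers says that
  \<open>b(r) = \<langle>f*\<^bsup>r+\<mu>\<^esup>, f\<^bsup>r+\<mu>\<^esup>\<rangle> / \<langle>f*\<^sup>r, f\<^sup>r\<rangle>\<close>, and these values determine \<open>b\<close>. To compute such a pairing on
  \<open>V = M\<^sub>m\<^sub>,\<^sub>n \<oplus> F\<close>, contract the variables of \<open>F\<close> first. For semi-invariants \<open>P\<close> and \<open>Q\<close> of opposite weights,
  a generic pair \<open>(\<Xi>, X)\<close> of matrices can be moved to the base point \<open>v\<close> of the slice, so the
  contraction at \<open>(\<Xi>, X)\<close> is \<open>\<langle>P\<^sub>v, Q\<^sub>v\<rangle> det(\<Xi> X\<^sup>t)\<^sup>D\<close> with \<open>D = \<Sum> r\<^sub>k d\<^sub>k\<close>. By the Capelli identity, contracting the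
  matrix variables of \<open>det(\<Xi> X\<^sup>t)\<^sup>D\<close> gives the product of the \<open>i + j\<close> with \<open>n - m < i \<le> n\<close> and \<open>j < D\<close>.
  The quotient of these products for \<open>r + \<mu>\<close> and \<open>r\<close> is the bracket.

  Reductivity enters only through the non-degeneracy of the pairing between semi-invariants of opposite
  weights. It follows by averaging: Cayley's \<open>\<Omega>\<close>-process for the factors \<open>GL\<close>, complete reducibility for
  \<open>G'\<close>. A semi-invariant of \<open>G\<close> is determined by its restriction to the slice, because the translates of
  the slice are dense; hence multiplicity-freeness passes from \<open>F\<close> to \<open>V\<close>.\<close>

section \<open>Polynomials\<close>

text \<open>The \<open>b\<close>-function is defined through branches of complex powers, whereas the
  pairing only sees polynomials. The bridge is that a constant coefficient operator applied to
  f^(s+\<mu>) gives f^s Q(s, x) divided by a power of the product of all \<open>f j\<close>, with Q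
  a polynomial in s and x jointly; hence an identity in s need only be checked at natural exponents,
  where no branch is left. The determinant of \<Xi> X^t is forced: an element of G takes X to g^t X
  h and the dual variable \<Xi> to g^(-1) \<Xi> (h^(-1))^t, so \<Xi> X^t is merely conjugated. A
  generic pair is moved by letting Q and P be transformed by the same element of GL(n) but by
  different elements of GL(m). The common element makes the weights \<open>e j\<close> and the
  action on F cancel; the difference in GL(m) is T = \<Xi> X^t itself and produces the power of det
  T. The exponents \<open>e j - d j\<close> of the weights of H may be negative, so the averaging
  has to work for all integral powers of the determinant.\<close>

abbreviation lookup where "lookup \<equiv> Poly_Mapping.lookup"
abbreviation keys where "keys \<equiv> Poly_Mapping.keys"
abbreviation mterm :: "('i \<Rightarrow>\<^sub>0 nat) \<Rightarrow> complex \<Rightarrow> 'i mpoly" where "mterm \<equiv> Poly_Mapping.single"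
abbreviation unit_exp :: "'i \<Rightarrow> 'i \<Rightarrow>\<^sub>0 nat" where "unit_exp i \<equiv> Poly_Mapping.single i (Suc 0)"

definition mdeg :: "('i \<Rightarrow>\<^sub>0 nat) \<Rightarrow> nat" where
  "mdeg \<alpha> = (\<Sum>i\<in>keys \<alpha>. lookup \<alpha> i)"

lemma mdeg_zero [simp]: "mdeg 0 = 0"
  by (simp add: mdeg_def)

lemma mdeg_add: "mdeg (\<alpha> + \<beta>) = mdeg \<alpha> + mdeg \<beta>"
  unfolding mdeg_def by (rule setsum_keys_plus_distrib) auto

lemma mdeg_unit_exp [simp]: "mdeg (unit_exp i) = 1"
  by (simp add: mdeg_def)

lemma mdeg_eq_0: "mdeg \<alpha> = 0 \<longleftrightarrow> \<alpha> = 0"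
  by (auto simp: mdeg_def in_keys_iff poly_mapping_eq_iff fun_eq_iff)

lemma keys_add_exp: "keys (\<alpha> + \<beta> :: 'i \<Rightarrow>\<^sub>0 nat) = keys \<alpha> \<union> keys \<beta>"
  by (auto simp: in_keys_iff lookup_add)

lemma unit_exp_split:
  assumes "i \<in> keys \<alpha>"
  shows "\<alpha> = unit_exp i + (\<alpha> - unit_exp i)"
proof (rule poly_mapping_eqI)
  fix j show "lookup \<alpha> j = lookup (unit_exp i + (\<alpha> - unit_exp i)) j"
    using assms by (auto simp: in_keys_iff lookup_add lookup_minus lookup_single when_def)
qed

text \<open>Taking off one variable lowers the total degree by one. The support in \<open>I\<close>
  is kept in the step so that the rule also serves polynomials in a restricted set of
  variables.\<close>

lemma exponent_induct [consumes 1, case_names zero unit]: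
  assumes "keys \<alpha> \<subseteq> I" "Q 0"
    and "\<And>i \<alpha>. i \<in> I \<Longrightarrow> keys \<alpha> \<subseteq> I \<Longrightarrow> Q \<alpha> \<Longrightarrow> Q (unit_exp i + \<alpha>)"
  shows "Q \<alpha>"
  using assms(1)
proof (induction "mdeg \<alpha>" arbitrary: \<alpha>)
  case 0
  then have "\<alpha> = 0" using mdeg_eq_0[of \<alpha>] by simp
  then show ?case using assms(2) by simp
next
  case (Suc n)
  then obtain i where i: "i \<in> keys \<alpha>" by (force simp: mdeg_def)
  define \<beta> where "\<beta> = \<alpha> - unit_exp i"
  have e: "\<alpha> = unit_exp i + \<beta>" unfolding \<beta>_def by (rule unit_exp_split[OF i])
  have "mdeg \<beta> = n" using Suc(2) by (simp add: e mdeg_add)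
  moreover have "keys \<beta> \<subseteq> I" using Suc(3) by (simp add: e keys_add_exp)
  ultimately show ?case using Suc(1)[of \<beta>] assms(3)[of i \<beta>] i Suc(3) e by auto
qed

lemma poly_mapping_sum_single: "P = (\<Sum>\<alpha>\<in>keys P. Poly_Mapping.single \<alpha> (lookup P \<alpha>))"
  by (rule poly_mapping_eqI)
    (auto simp: lookup_sum lookup_single when_def sum.delta in_keys_iff)

text \<open>Reduces every additive statement to single terms. The empty sum needs no case of its
  own, since 0 is a single term with coefficient 0.\<close>

lemma poly_mapping_single_induct [case_names single add]:
  fixes P :: "'a \<Rightarrow>\<^sub>0 'b::comm_monoid_add"
  assumes "\<And>\<alpha> c. Q (Poly_Mapping.single \<alpha> c)" "\<And>A B. Q A \<Longrightarrow> Q B \<Longrightarrow> Q (A + B)"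
  shows "Q P"
proof -
  have "Q (\<Sum>\<alpha>\<in>F. Poly_Mapping.single \<alpha> (lookup P \<alpha>))" if "finite F" for F
    using that
  proof induction
    case empty
    then show ?case using assms(1)[of undefined 0] by simp
  qed (simp add: assms)
  then show ?thesis using poly_mapping_sum_single[of P] by (metis finite_keys)
qed

section \<open>Constants and variables; polynomials in a given set of variables\<close>

lemma Const_mult_monom: "Const c * mterm \<alpha> d = mterm \<alpha> (c * d)"
  by (simp add: Const_def mult_single)

lemma lookup_Const_mult [simp]: "lookup (Const c * P) \<alpha> = c * lookup P \<alpha>"
proof (induction P rule: poly_mapping_single_induct)
  case (single \<beta> d)
  then show ?case by (simp add: Const_mult_monom lookup_single when_def)
qed (simp add: lookup_add distrib_left)

lemma Const_0 [simp]: "Const 0 = 0" and Const_1 [simp]: "Const 1 = 1"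
  by (simp_all add: Const_def)

lemma Const_add: "Const (a + b) = Const a + Const b"
  and Const_mult: "Const (a * b) = Const a * Const b"
  and Const_diff: "Const (a - b) = Const a - Const b"
  by (simp_all add: Const_def single_add mult_single single_diff)

lemma Const_power: "Const (a ^ k) = Const a ^ k"
  by (induction k) (simp_all add: Const_mult)

lemma Const_sum: "Const (sum g A) = (\<Sum>x\<in>A. Const (g x))"
  by (induction A rule: infinite_finite_induct) (simp_all add: Const_add)

lemma Const_prod: "Const (prod g A) = (\<Prod>x\<in>A. Const (g x))"
  by (induction A rule: infinite_finite_induct) (simp_all add: Const_mult)

lemma Const_of_nat: "Const (of_nat k) = of_nat k"
  by (induction k) (simp_all add: Const_add)

lemma Const_eq_iff: "Const a = Const b \<longleftrightarrow> a = b"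
  by (metis Const_def lookup_single_eq)

lemma Const_mult_eq_0: "Const c * P = 0 \<longleftrightarrow> c = 0 \<or> P = 0"
  by (auto simp: poly_mapping_eq_iff fun_eq_iff)

lemma Var_mult_monom: "Var i * mterm \<alpha> c = mterm (unit_exp i + \<alpha>) c"
  by (simp add: Var_def mult_single)

lemma polysI: "(\<And>\<alpha>. lookup P \<alpha> \<noteq> 0 \<Longrightarrow> keys \<alpha> \<subseteq> I) \<Longrightarrow> P \<in> polys I"
  by (simp add: polys_def in_keys_iff)

lemma polysD: "P \<in> polys I \<Longrightarrow> lookup P \<alpha> \<noteq> 0 \<Longrightarrow> keys \<alpha> \<subseteq> I"
  by (simp add: polys_def in_keys_iff)

lemma polys_monom: "keys \<alpha> \<subseteq> I \<Longrightarrow> mterm \<alpha> c \<in> polys I"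
  by (auto simp: polys_def)

lemma polys_Const [simp]: "Const c \<in> polys I"
  by (simp add: Const_def polys_monom)

lemma polys_zero [simp]: "0 \<in> polys I" and polys_one [simp]: "1 \<in> polys I"
  using polys_Const[of 0 I] polys_Const[of 1 I] by simp_all

lemma polys_Var: "i \<in> I \<Longrightarrow> Var i \<in> polys I"
  by (simp add: Var_def polys_monom)

lemma polys_add: "P \<in> polys I \<Longrightarrow> Q \<in> polys I \<Longrightarrow> P + Q \<in> polys I"
  using keys_add[of P Q] by (auto simp: polys_def)

lemma polys_mult: "P \<in> polys I \<Longrightarrow> Q \<in> polys I \<Longrightarrow> P * Q \<in> polys I"
  using keys_mult[of P Q] by (fastforce simp: polys_def keys_add_exp)

lemma polys_diff:
  assumes "P \<in> polys I" "Q \<in> polys I"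
  shows "P - Q \<in> polys I"
proof (rule polysI)
  fix \<alpha> assume "lookup (P - Q) \<alpha> \<noteq> 0"
  then have "lookup P \<alpha> \<noteq> 0 \<or> lookup Q \<alpha> \<noteq> 0" by (auto simp: lookup_minus)
  then show "keys \<alpha> \<subseteq> I" using assms polysD by blast
qed

lemma polys_sum: "(\<And>x. x \<in> A \<Longrightarrow> g x \<in> polys I) \<Longrightarrow> sum g A \<in> polys I"
  by (induction A rule: infinite_finite_induct) (simp_all add: polys_add)

lemma polys_prod: "(\<And>x. x \<in> A \<Longrightarrow> g x \<in> polys I) \<Longrightarrow> prod g A \<in> polys I"
  by (induction A rule: infinite_finite_induct) (simp_all add: polys_mult)

lemma polys_power: "P \<in> polys I \<Longrightarrow> P ^ k \<in> polys I"
  by (induction k) (simp_all add: polys_mult)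

lemma polys_UNIV [simp]: "P \<in> polys UNIV"
  by (simp add: polys_def)

lemmas polys_intros = polys_Const polys_zero polys_one polys_Var polys_add polys_mult polys_diff
  polys_sum polys_prod polys_power

text \<open>The step multiplies by one variable instead of an arbitrary polynomial, which matches
  the product rule, linear substitutions and the adjointness of the pairing. All intermediate
  polynomials stay in \<open>polys I\<close>, so their membership is at hand in every step.\<close>

lemma polys_induct [consumes 1, case_names Const add Var]:
  assumes "P \<in> polys I" and C: "\<And>c. Q (Const c)"
    and A: "\<And>A B. A \<in> polys I \<Longrightarrow> B \<in> polys I \<Longrightarrow> Q A \<Longrightarrow> Q B \<Longrightarrow> Q (A + B)"
    and V: "\<And>i A. i \<in> I \<Longrightarrow> A \<in> polys I \<Longrightarrow> Q A \<Longrightarrow> Q (Var i * A)"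
  shows "Q P"
proof -
  have m: "Q (mterm \<alpha> c)" if "keys \<alpha> \<subseteq> I" for \<alpha> c
    using that
  proof (induction \<alpha> rule: exponent_induct)
    case zero
    then show ?case using C by (simp add: Const_def)
  next
    case (unit i \<alpha>)
    then show ?case using V[of i "mterm \<alpha> c"] by (simp add: Var_mult_monom polys_monom)
  qed
  have "(\<Sum>\<alpha>\<in>F. mterm \<alpha> (lookup P \<alpha>)) \<in> polys I \<and> Q (\<Sum>\<alpha>\<in>F. mterm \<alpha> (lookup P \<alpha>))"
    if "finite F" "F \<subseteq> keys P" for F
    using that
  proof induction
    case empty
    then show ?case using C[of 0] by simp
  next
    case (insert \<alpha> F)
    have "keys \<alpha> \<subseteq> I" using insert.prems assms(1) by (auto simp: polys_def)
    then show ?case using insert A[of "mterm \<alpha> (lookup P \<alpha>)"]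
      by (auto intro!: m polys_monom polys_add)
  qed
  then have "Q (\<Sum>\<alpha>\<in>keys P. mterm \<alpha> (lookup P \<alpha>))" by simp
  then show ?thesis using poly_mapping_sum_single[of P] by simp
qed

lemmas mpoly_induct = polys_induct[OF polys_UNIV, case_names Const add Var]

section \<open>Evaluation and substitution as ring homomorphisms\<close>

lemma monom_value_add:
  fixes x :: "'i \<Rightarrow> 'a::comm_ring_1"
  shows "(\<Prod>i\<in>keys (\<alpha> + \<beta>). x i ^ lookup (\<alpha> + \<beta>) i) =
    (\<Prod>i\<in>keys \<alpha>. x i ^ lookup \<alpha> i) * (\<Prod>i\<in>keys \<beta>. x i ^ lookup \<beta> i)"
proof -
  have *: "(\<Prod>i\<in>keys \<gamma>. x i ^ lookup \<gamma> i) = (\<Prod>i\<in>keys \<alpha> \<union> keys \<beta>. x i ^ lookup \<gamma> i)"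
    if "keys \<gamma> \<subseteq> keys \<alpha> \<union> keys \<beta>" for \<gamma>
    using that by (intro prod.mono_neutral_left) (auto simp: in_keys_iff)
  show ?thesis
    using *[of \<alpha>] *[of \<beta>] *[of "\<alpha> + \<beta>"]
    by (simp add: keys_add_exp lookup_add power_add prod.distrib)
qed

text \<open>Evaluation at a point and substitution of polynomials are both \<open>insertion\<close>
  along a homomorphism of coefficients, so their rules are proved once and instantiated as
  \<open>eval\<close> and \<open>subst\<close>.\<close>

locale coeff_hom =
  fixes \<phi> :: "complex \<Rightarrow> 'a::comm_ring_1"
  assumes hom_0: "\<phi> 0 = 0" and hom_1: "\<phi> 1 = 1"
    and hom_add: "\<phi> (a + b) = \<phi> a + \<phi> b" and hom_mult: "\<phi> (a * b) = \<phi> a * \<phi> b"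
begin

lemma ins_add: "insertion \<phi> x (P + Q) = insertion \<phi> x P + insertion \<phi> x Q"
  unfolding insertion_def
  by (rule setsum_keys_plus_distrib) (auto simp: hom_0 hom_add distrib_right)

lemma ins_monom: "insertion \<phi> x (mterm \<alpha> c) = \<phi> c * (\<Prod>i\<in>keys \<alpha>. x i ^ lookup \<alpha> i)"
  by (simp add: insertion_def hom_0)

lemma ins_Const [simp]: "insertion \<phi> x (Const c) = \<phi> c"
  by (simp add: Const_def ins_monom)

lemma ins_zero [simp]: "insertion \<phi> x 0 = 0" and ins_one [simp]: "insertion \<phi> x 1 = 1"
  using ins_Const[of x 0] ins_Const[of x 1] by (simp_all add: hom_0 hom_1)

lemma ins_Var [simp]: "insertion \<phi> x (Var i) = x i"
  by (simp add: Var_def ins_monom hom_1)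

lemma ins_mult: "insertion \<phi> x (P * Q) = insertion \<phi> x P * insertion \<phi> x Q"
proof (induction P rule: poly_mapping_single_induct)
  case (single \<alpha> c)
  show ?case
  proof (induction Q rule: poly_mapping_single_induct)
    case (single \<beta> d)
    then show ?case by (simp add: mult_single ins_monom monom_value_add hom_mult mult_ac)
  qed (simp add: distrib_left ins_add)
qed (simp add: distrib_right ins_add)

lemma ins_sum: "insertion \<phi> x (sum g A) = (\<Sum>a\<in>A. insertion \<phi> x (g a))"
  by (induction A rule: infinite_finite_induct) (simp_all add: ins_add)

lemma ins_prod: "insertion \<phi> x (prod g A) = (\<Prod>a\<in>A. insertion \<phi> x (g a))"
  by (induction A rule: infinite_finite_induct) (simp_all add: ins_mult)

lemma ins_power: "insertion \<phi> x (P ^ k) = insertion \<phi> x P ^ k"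
  by (induction k) (simp_all add: ins_mult)

lemma ins_of_nat: "insertion \<phi> x (of_nat k) = of_nat k"
  by (induction k) (simp_all add: ins_add)

lemma ins_uminus: "insertion \<phi> x (- P) = - insertion \<phi> x P"
  using ins_add[of x P "- P"] by (simp add: eq_neg_iff_add_eq_0 add.commute)

lemma ins_diff: "insertion \<phi> x (P - Q) = insertion \<phi> x P - insertion \<phi> x Q"
  using ins_add[of x P "- Q"] by (simp add: ins_uminus)

lemmas ins_simps = ins_add ins_mult ins_sum ins_prod ins_power ins_of_nat ins_uminus ins_diff

end

interpretation eval: coeff_hom "\<lambda>c. c" by unfold_locales auto
interpretation subst: coeff_hom "Const :: complex \<Rightarrow> 'i mpoly"
  by unfold_locales (auto simp: Const_add Const_mult)

lemma eval_cong: "P \<in> polys I \<Longrightarrow> (\<And>i. i \<in> I \<Longrightarrow> x i = y i) \<Longrightarrow> eval P x = eval P y"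
  by (induction P rule: polys_induct) (auto simp: eval.ins_simps)

lemma subst_cong: "P \<in> polys I \<Longrightarrow> (\<And>i. i \<in> I \<Longrightarrow> x i = y i) \<Longrightarrow> subst x P = subst y P"
  by (induction P rule: polys_induct) (auto simp: subst.ins_simps)

lemma eval_subst: "eval (subst \<theta> P) x = eval P (\<lambda>i. eval (\<theta> i) x)"
  by (induction P rule: mpoly_induct) (auto simp: eval.ins_simps subst.ins_simps)

lemma subst_subst: "subst \<eta> (subst \<theta> P) = subst (\<lambda>i. subst \<eta> (\<theta> i)) P"
  by (induction P rule: mpoly_induct) (auto simp: subst.ins_simps)

lemma polys_subst: "P \<in> polys I \<Longrightarrow> (\<And>i. i \<in> I \<Longrightarrow> \<theta> i \<in> polys J) \<Longrightarrow> subst \<theta> P \<in> polys J"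
  by (induction P rule: polys_induct) (auto simp: subst.ins_simps intro!: polys_intros)

lemma subst_Var [simp]: "subst Var P = P"
  by (induction P rule: mpoly_induct) (auto simp: subst.ins_simps)

lemma eval_zero_point: "eval P (\<lambda>_. 0) = lookup P 0"
proof (induction P rule: poly_mapping_single_induct)
  case (single \<alpha> c)
  show ?case
    by (cases "\<alpha> = 0") (auto simp: eval.ins_monom lookup_single power_0_left in_keys_iff poly_mapping_eq_iff fun_eq_iff)
qed (simp add: eval.ins_add lookup_add)


section \<open>Formal partial derivatives\<close>

text \<open>Subtraction of exponents is truncated; where this would go wrong, the factor
  \<open>lookup \<alpha> i\<close> is 0.\<close>

definition pd :: "'i \<Rightarrow> 'i mpoly \<Rightarrow> 'i mpoly" where
  "pd i P = (\<Sum>\<alpha>\<in>keys P. mterm (\<alpha> - unit_exp i) (of_nat (lookup \<alpha> i) * lookup P \<alpha>))"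

lemma pd_add: "pd i (P + Q) = pd i P + pd i Q"
  unfolding pd_def by (rule setsum_keys_plus_distrib) (auto simp: distrib_left single_add)

lemma pd_monom: "pd i (mterm \<alpha> c) = mterm (\<alpha> - unit_exp i) (of_nat (lookup \<alpha> i) * c)"
  by (simp add: pd_def)

lemma pd_Const [simp]: "pd i (Const c) = 0"
  by (simp add: Const_def pd_monom)

lemma pd_zero [simp]: "pd i 0 = 0" and pd_one [simp]: "pd i 1 = 0"
  using pd_Const[of i 0] pd_Const[of i 1] by simp_all

lemma pd_Var: "pd i (Var j) = (if i = j then 1 else 0)"
  by (auto simp: Var_def pd_monom lookup_single)

lemma pd_monom_mult: "pd i (mterm \<alpha> c * mterm \<beta> d) = pd i (mterm \<alpha> c) * mterm \<beta> d + mterm \<alpha> c * pd i (mterm \<beta> d)"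
proof -
  have 1: "\<alpha> - unit_exp i + \<beta> = \<alpha> + \<beta> - unit_exp i" if "lookup \<alpha> i \<noteq> 0" for \<alpha> \<beta> :: "'a \<Rightarrow>\<^sub>0 nat"
    using that by (intro poly_mapping_eqI) (auto simp: lookup_add lookup_minus lookup_single when_def)
  have 2: "mterm (\<alpha> - unit_exp i + \<beta>) (of_nat (lookup \<alpha> i) * c) = mterm (\<alpha> + \<beta> - unit_exp i) (of_nat (lookup \<alpha> i) * c)" for \<alpha> \<beta> c
    by (cases "lookup \<alpha> i = 0") (simp_all add: 1)
  show ?thesis
    using 2[of \<alpha> \<beta> "c * d"] 2[of \<beta> \<alpha> "c * d"]
    by (simp add: mult_single pd_monom lookup_add single_add algebra_simps)
qed

lemma pd_mult: "pd i (P * Q) = pd i P * Q + P * pd i Q"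
proof (induction P rule: poly_mapping_single_induct)
  case (single \<alpha> c)
  show ?case
    by (induction Q rule: poly_mapping_single_induct)
      (simp_all add: pd_monom_mult distrib_left pd_add algebra_simps)
qed (simp add: distrib_right pd_add algebra_simps)

lemma pd_sum: "pd i (sum g A) = (\<Sum>a\<in>A. pd i (g a))"
  by (induction A rule: infinite_finite_induct) (simp_all add: pd_add)

lemma pd_Const_mult: "pd i (Const c * P) = Const c * pd i P"
  by (simp add: pd_mult)

lemma polys_pd: "P \<in> polys I \<Longrightarrow> pd i P \<in> polys I"
  by (induction P rule: polys_induct) (auto simp: pd_add pd_mult pd_Var intro!: polys_intros)

text \<open>The chain rule. It lets a linear substitution be moved across the apolar pairing one
  variable at a time.\<close>

lemma pd_subst:
  assumes "finite I" "P \<in> polys I"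
  shows "pd i (subst \<theta> P) = (\<Sum>j\<in>I. pd i (\<theta> j) * subst \<theta> (pd j P))"
  using assms(2)
proof (induction P rule: polys_induct)
  case (Var k P)
  have "(\<Sum>j\<in>I. pd i (\<theta> j) * subst \<theta> (pd j (Var k * P))) =
     (\<Sum>j\<in>I. pd i (\<theta> j) * (if j = k then subst \<theta> P else 0)) + \<theta> k * (\<Sum>j\<in>I. pd i (\<theta> j) * subst \<theta> (pd j P))"
    unfolding sum_distrib_left sum.distrib[symmetric]
    by (rule sum.cong) (auto simp: pd_mult pd_Var subst.ins_simps algebra_simps)
  then show ?case using Var assms(1) by (simp add: subst.ins_simps pd_mult if_distrib cong: if_cong)
qed (auto simp: subst.ins_simps pd_add algebra_simps sum.distrib)

lemma eval_has_partial:
  "((\<lambda>z. eval P (x(i := z))) has_field_derivative eval (pd i P) (x(i := z))) (at z)"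
proof (induction P rule: mpoly_induct)
  case (Var j P)
  have "((\<lambda>z. (x(i := z)) j) has_field_derivative (if i = j then 1 else 0)) (at z)"
    by (cases "i = j") (auto intro!: derivative_eq_intros)
  from DERIV_mult[OF this Var.IH]
  show ?case by (auto simp: eval.ins_simps pd_mult pd_Var algebra_simps)
qed (auto simp: eval.ins_simps pd_add intro!: derivative_intros)

lemma partial_eval: "partial i (eval P) = eval (pd i P)"
proof
  fix x
  show "partial i (eval P) x = eval (pd i P) x"
    unfolding partial_def using DERIV_imp_deriv[OF eval_has_partial[where z = "x i" and x = x]] by simp
qed

lemma lookup_pd: "lookup (pd i Q) \<alpha> = of_nat (Suc (lookup \<alpha> i)) * lookup Q (unit_exp i + \<alpha>)"
proof (induction Q rule: poly_mapping_single_induct)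
  case (single \<beta> c)
  show ?case
  proof (cases "\<beta> = unit_exp i + \<alpha>")
    case True
    then have "\<beta> - unit_exp i = \<alpha>" by simp
    then show ?thesis using True by (simp add: pd_monom lookup_add)
  next
    case False
    then have "lookup \<beta> i = 0 \<or> \<beta> - unit_exp i \<noteq> \<alpha>"
      using unit_exp_split[of i \<beta>] by (auto simp: in_keys_iff)
    then show ?thesis using False by (auto simp: pd_monom lookup_single when_def)
  qed
qed (simp add: pd_add lookup_add distrib_left)

text \<open>The coefficient at \<alpha> is, up to a positive factor, an iterated derivative at the
  origin. Vanishing on \<open>cspace I\<close> passes to \<open>pd i Q\<close> for i in
  \<open>I\<close> because the line in direction i stays inside \<open>cspace I\<close>; hence the
  induction on \<alpha> with Q arbitrary.\<close>

lemma eval_vanishing: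
  assumes "P \<in> polys I" "\<And>x. x \<in> cspace I \<Longrightarrow> eval P x = 0"
  shows "P = 0"
proof (rule poly_mapping_eqI)
  fix \<alpha>
  have *: "lookup Q \<alpha> = 0" if "keys \<alpha> \<subseteq> I" "\<And>x. x \<in> cspace I \<Longrightarrow> eval Q x = 0" for Q
    using that
  proof (induction \<alpha> arbitrary: Q rule: exponent_induct)
    case zero
    then show ?case by (simp add: eval_zero_point[symmetric] cspace_def)
  next
    case (unit i \<alpha>)
    have "eval (pd i Q) x = 0" if x: "x \<in> cspace I" for x
    proof -
      have "(\<lambda>z. eval Q (x(i := z))) = (\<lambda>z. 0)"
        using unit x by (auto simp: cspace_def)
      then have "partial i (eval Q) x = 0"
        unfolding partial_def by simp
      then show ?thesis by (simp add: partial_eval)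
    qed
    from unit.IH[OF this] have "lookup (pd i Q) \<alpha> = 0" .
    then show ?case unfolding lookup_pd
      by (metis of_nat_eq_0_iff mult_eq_0_iff nat.distinct(1))
  qed
  show "lookup P \<alpha> = lookup 0 \<alpha>"
  proof (cases "keys \<alpha> \<subseteq> I")
    case True
    then show ?thesis using * assms(2) by simp
  next
    case False
    then show ?thesis using polysD[OF assms(1), of \<alpha>] by auto
  qed
qed

lemma eval_eqI:
  assumes "P \<in> polys I" "Q \<in> polys I" "\<And>x. x \<in> cspace I \<Longrightarrow> eval P x = eval Q x"
  shows "P = Q"
  using eval_vanishing[of "P - Q" I] assms by (auto simp: polys_diff eval.ins_diff)

lemma eval_on_line: "\<exists>p. \<forall>t. poly p t = eval P (\<lambda>i. a i + t * (b i - a i))"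
proof (induction P rule: mpoly_induct)
  case (Const c)
  show ?case by (rule exI[of _ "[:c:]"]) simp
next
  case (add A B)
  then obtain p q where "\<forall>t. poly p t = eval A (\<lambda>i. a i + t * (b i - a i))"
    "\<forall>t. poly q t = eval B (\<lambda>i. a i + t * (b i - a i))" by blast
  then show ?case by (intro exI[of _ "p + q"]) (simp add: eval.ins_add)
next
  case (Var i A)
  then obtain p where "\<forall>t. poly p t = eval A (\<lambda>i. a i + t * (b i - a i))" by blast
  then show ?case by (intro exI[of _ "[:a i, b i - a i:] * p"]) (simp add: eval.ins_mult distrib_right mult.assoc)
qed

text \<open>On the line joining a point where P does not vanish to one where Q does not, P and Q
  become non-zero polynomials in one variable, and these have no zero divisors.\<close>

lemma mpoly_mult_eq_0:
  fixes P Q :: "'i mpoly"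
  assumes "P * Q = 0"
  shows "P = 0 \<or> Q = 0"
proof (rule ccontr)
  assume "\<not> ?thesis"
  then obtain a b where ab: "eval P a \<noteq> 0" "eval Q b \<noteq> 0"
    using eval_vanishing[of P UNIV] eval_vanishing[of Q UNIV] by auto
  obtain p q where p: "\<And>t. poly p t = eval P (\<lambda>i. a i + t * (b i - a i))"
    and q: "\<And>t. poly q t = eval Q (\<lambda>i. a i + t * (b i - a i))"
    using eval_on_line[of a b] by metis
  have "poly p 0 \<noteq> 0" "poly q 1 \<noteq> 0" using ab by (simp_all add: p q)
  then have "p * q \<noteq> 0" by auto
  then obtain t where "poly (p * q) t \<noteq> 0" using poly_all_0_iff_0 by blast
  then have "eval (P * Q) (\<lambda>i. a i + t * (b i - a i)) \<noteq> 0" by (simp add: p q eval.ins_mult)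
  then show False using assms by simp
qed

lemma mpoly_mult_cancel: "R \<noteq> 0 \<Longrightarrow> P * R = Q * R \<Longrightarrow> P = (Q :: 'i mpoly)"
  using mpoly_mult_eq_0[of "P - Q" R] by (simp add: left_diff_distrib)

lemma mpoly_power_neq_0: "P \<noteq> 0 \<Longrightarrow> P ^ k \<noteq> (0 :: 'i mpoly)"
  by (induction k) (use mpoly_mult_eq_0 in auto)

lemma mpoly_prod_neq_0: "(\<And>a. a \<in> A \<Longrightarrow> g a \<noteq> 0) \<Longrightarrow> prod g A \<noteq> (0 :: 'i mpoly)"
  by (induction A rule: infinite_finite_induct) (use mpoly_mult_eq_0 in auto)

text \<open>After multiplication by R the identity holds everywhere, and R can be cancelled. The
  arguments that move a generic point to the base point of the slice enter through this
  lemma.\<close>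

lemma eval_eqI_generic:
  assumes "P \<in> polys I" "Q \<in> polys I" "R \<in> polys I" "R \<noteq> 0"
    and "\<And>x. x \<in> cspace I \<Longrightarrow> eval R x \<noteq> 0 \<Longrightarrow> eval P x = eval Q x"
  shows "P = Q"
proof -
  have "P * R = Q * R"
    using assms by (intro eval_eqI[of _ I]) (auto simp: polys_mult eval.ins_mult)
  then show ?thesis using mpoly_mult_cancel assms(4) by blast
qed

lemma eval_nonzero_point:
  assumes "P \<in> polys I" "P \<noteq> 0"
  obtains x where "x \<in> cspace I" "eval P x \<noteq> 0"
  using eval_vanishing[OF assms(1)] assms(2) by blast


section \<open>The apolar pairing\<close>

definition mfact :: "('i \<Rightarrow>\<^sub>0 nat) \<Rightarrow> complex" where
  "mfact \<alpha> = (\<Prod>i\<in>keys \<alpha>. fact (lookup \<alpha> i))"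

lemma mfact_superset: "finite A \<Longrightarrow> keys \<alpha> \<subseteq> A \<Longrightarrow> mfact \<alpha> = (\<Prod>i\<in>A. fact (lookup \<alpha> i))"
  unfolding mfact_def by (rule prod.mono_neutral_left) (auto simp: in_keys_iff)

lemma mfact_zero [simp]: "mfact 0 = 1"
  by (simp add: mfact_def)

lemma mfact_neq_0 [simp]: "mfact \<alpha> \<noteq> 0"
  by (simp add: mfact_def)

lemma mfact_unit_exp_add: "mfact (unit_exp i + \<alpha>) = of_nat (Suc (lookup \<alpha> i)) * mfact \<alpha>"
proof -
  let ?A = "keys \<alpha> - {i}"
  have "mfact (unit_exp i + \<alpha>) = (\<Prod>j\<in>insert i ?A. fact (lookup (unit_exp i + \<alpha>) j))"
    by (rule mfact_superset) (auto simp: keys_add_exp)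
  also have "\<dots> = fact (Suc (lookup \<alpha> i)) * (\<Prod>j\<in>?A. fact (lookup \<alpha> j))"
  proof -
    have "(\<Prod>j\<in>?A. fact (lookup (unit_exp i + \<alpha>) j)) = (\<Prod>j\<in>?A. fact (lookup \<alpha> j) :: complex)"
      by (rule prod.cong) (auto simp: lookup_add lookup_single)
    then show ?thesis by (subst prod.insert) (simp_all add: lookup_add)
  qed
  also have "\<dots> = of_nat (Suc (lookup \<alpha> i)) * (\<Prod>j\<in>insert i ?A. fact (lookup \<alpha> j))"
    by (subst prod.insert) simp_all
  also have "(\<Prod>j\<in>insert i ?A. fact (lookup \<alpha> j)) = mfact \<alpha>"
    by (rule mfact_superset[symmetric]) auto
  finally show ?thesis .
qed

text \<open>\<open>apolar P Q = P(\<partial>) Q\<close> evaluated at the origin.\<close>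

definition apolar :: "'i mpoly \<Rightarrow> 'i mpoly \<Rightarrow> complex" where
  "apolar P Q = (\<Sum>\<alpha>\<in>keys P. mfact \<alpha> * lookup P \<alpha> * lookup Q \<alpha>)"

lemma apolar_superset:
  "finite A \<Longrightarrow> keys P \<subseteq> A \<Longrightarrow> apolar P Q = (\<Sum>\<alpha>\<in>A. mfact \<alpha> * lookup P \<alpha> * lookup Q \<alpha>)"
  unfolding apolar_def by (rule sum.mono_neutral_left) (auto simp: in_keys_iff)

lemma apolar_commute: "apolar P Q = apolar Q P"
  using apolar_superset[of "keys P \<union> keys Q" P Q] apolar_superset[of "keys P \<union> keys Q" Q P]
  by (simp add: mult_ac)

lemma apolar_add_left: "apolar (P + P') Q = apolar P Q + apolar P' Q"
  unfolding apolar_def by (rule setsum_keys_plus_distrib) (auto simp: algebra_simps)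

lemma apolar_add_right: "apolar Q (P + P') = apolar Q P + apolar Q P'"
  by (simp add: apolar_commute[of Q] apolar_add_left)

lemma apolar_monom: "apolar (mterm \<alpha> c) Q = mfact \<alpha> * c * lookup Q \<alpha>"
  by (simp add: apolar_def)

lemma apolar_zero [simp]: "apolar 0 Q = 0" "apolar Q 0 = 0"
  by (simp_all add: apolar_def)

lemma apolar_Const_left: "apolar (Const c) Q = c * lookup Q 0"
  by (simp add: Const_def apolar_monom)

lemma apolar_Const_mult_right: "apolar P (Const c * Q) = c * apolar P Q"
  unfolding apolar_def sum_distrib_left by (intro sum.cong refl) (simp add: mult.left_commute)

lemma apolar_Const_mult_left: "apolar (Const c * P) Q = c * apolar P Q"
  by (simp add: apolar_commute[of _ Q] apolar_Const_mult_right)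

lemma apolar_sum_right: "apolar P (sum g A) = (\<Sum>a\<in>A. apolar P (g a))"
  by (induction A rule: infinite_finite_induct) (simp_all add: apolar_add_right)

lemma apolar_sum_left: "apolar (sum g A) P = (\<Sum>a\<in>A. apolar (g a) P)"
  by (simp add: apolar_commute[of _ P] apolar_sum_right)

lemma apolar_diff_left: "apolar (P - P') Q = apolar P Q - apolar P' Q"
  using apolar_add_left[of "P - P'" P' Q] by simp

text \<open>Adjointness for one variable, from which the general case follows: the factorial of
  \<open>unit_exp i + \<alpha>\<close> supplies exactly the factor that differentiation
  produces.\<close>

lemma apolar_Var_mult: "apolar (Var i * P) Q = apolar P (pd i Q)"
proof (induction P rule: poly_mapping_single_induct)
  case (single \<alpha> c)
  show ?case by (simp add: Var_mult_monom apolar_monom mfact_unit_exp_add lookup_pd)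
qed (simp add: distrib_left apolar_add_left)

text \<open>The monomials are orthogonal with non-zero self-pairings, so testing against them
  recovers each coefficient.\<close>

lemma apolar_nondegenerate:
  assumes "Q \<in> polys I" "Q' \<in> polys I" "\<And>P. P \<in> polys I \<Longrightarrow> apolar P Q = apolar P Q'"
  shows "Q = Q'"
proof (rule poly_mapping_eqI)
  fix \<alpha>
  show "lookup Q \<alpha> = lookup Q' \<alpha>"
  proof (cases "keys \<alpha> \<subseteq> I")
    case True
    then show ?thesis using assms(3)[OF polys_monom[of \<alpha> I 1]] by (simp add: apolar_monom)
  next
    case False
    then have "lookup Q \<alpha> = 0" "lookup Q' \<alpha> = 0" using polysD assms(1,2) by blast+
    then show ?thesis by simp
  qed
qed

text \<open>Repeats the formula of \<open>monom_diff\<close>, including its choice of an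
  enumeration, so that \<open>diff_op\<close> on polynomial functions and \<open>pdiff\<close>
  correspond term by term, without any appeal to commuting derivatives.\<close>

definition pdm :: "('i \<Rightarrow>\<^sub>0 nat) \<Rightarrow> 'i mpoly \<Rightarrow> 'i mpoly" where
  "pdm \<alpha> Q = fold (\<lambda>i. pd i ^^ lookup \<alpha> i) (SOME is. distinct is \<and> set is = keys \<alpha>) Q"

definition pdiff :: "'i mpoly \<Rightarrow> 'i mpoly \<Rightarrow> 'i mpoly" where
  "pdiff P Q = (\<Sum>\<alpha>\<in>keys P. Const (lookup P \<alpha>) * pdm \<alpha> Q)"

lemma some_enumeration:
  "finite A \<Longrightarrow> distinct (SOME is. distinct is \<and> set is = A) \<and> set (SOME is. distinct is \<and> set is = A) = A"
  by (rule someI_ex) (use finite_distinct_list in blast)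

lemma apolar_Var_power_mult: "apolar (P * Var i ^ k) Q = apolar P ((pd i ^^ k) Q)"
proof (induction k arbitrary: Q)
  case (Suc k)
  have "apolar (P * Var i ^ Suc k) Q = apolar (Var i * (P * Var i ^ k)) Q" by (simp add: mult_ac)
  then show ?case using Suc by (simp add: apolar_Var_mult funpow_Suc_right del: funpow.simps)
qed simp

lemma monom_eq_prod_Var: "mterm \<alpha> 1 = (\<Prod>i\<in>keys \<alpha>. Var i ^ lookup \<alpha> i)"
  using subst_Var[of "mterm \<alpha> 1"] by (simp add: subst.ins_monom)

lemma apolar_pdm: "apolar (P * mterm \<alpha> 1) Q = apolar P (pdm \<alpha> Q)"
proof -
  \<comment> \<open>Proved for every list: multiplications commute, and each of them moves across as
    a derivative, so it does not matter which enumeration was chosen.\<close>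
  have *: "apolar (P * prod_list (map (\<lambda>i. Var i ^ k i) is)) Q = apolar P (fold (\<lambda>i. pd i ^^ k i) is Q)"
    for k "is"
  proof (induction "is" arbitrary: Q)
    case (Cons i "is")
    have "apolar (P * prod_list (map (\<lambda>i. Var i ^ k i) (i # is))) Q =
      apolar (P * prod_list (map (\<lambda>i. Var i ^ k i) is) * Var i ^ k i) Q"
      by (simp add: mult_ac)
    then show ?case by (simp add: apolar_Var_power_mult Cons)
  qed simp
  define js where "js = (SOME is. distinct is \<and> set is = keys \<alpha>)"
  have js: "distinct js" "set js = keys \<alpha>"
    using some_enumeration[of "keys \<alpha>"] by (simp_all add: js_def)
  show ?thesis
    using *[of "lookup \<alpha>" js] prod.distinct_set_conv_list[OF js(1), of "\<lambda>i. Var i ^ lookup \<alpha> i"]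
    by (simp add: js(2) pdm_def js_def[symmetric] monom_eq_prod_Var)
qed

lemma apolar_pdiff: "apolar (P1 * P2) Q = apolar P1 (pdiff P2 Q)"
proof -
  have "P1 * P2 = P1 * (\<Sum>\<alpha>\<in>keys P2. mterm \<alpha> (lookup P2 \<alpha>))"
    using poly_mapping_sum_single[of P2] by simp
  also have "\<dots> = (\<Sum>\<alpha>\<in>keys P2. Const (lookup P2 \<alpha>) * (P1 * mterm \<alpha> 1))"
    unfolding sum_distrib_left
    by (rule sum.cong[OF refl]) (metis Const_mult_monom mult.left_commute mult.right_neutral)
  finally show ?thesis
    by (simp add: pdiff_def apolar_sum_left apolar_sum_right apolar_Const_mult_left
        apolar_Const_mult_right apolar_pdm)
qed

lemma polys_fold_pd: "Q \<in> polys I \<Longrightarrow> fold (\<lambda>i. pd i ^^ k i) is Q \<in> polys I"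
proof (induction "is" arbitrary: Q)
  case (Cons i "is")
  have "(pd i ^^ n) Q \<in> polys I" for n using Cons.prems by (induction n) (auto simp: polys_pd)
  then show ?case using Cons by simp
qed simp

lemma polys_pdiff: "Q \<in> polys I \<Longrightarrow> pdiff P Q \<in> polys I"
  unfolding pdiff_def pdm_def by (intro polys_sum polys_mult polys_fold_pd polys_Const)

lemma diff_op_eval: "diff_op P (eval Q) = eval (pdiff P Q)"
proof -
  have 1: "(partial i ^^ k) (eval Q) = eval ((pd i ^^ k) Q)" for i k and Q :: "'a mpoly"
    by (induction k) (simp_all add: partial_eval)
  have "fold (\<lambda>i. partial i ^^ k i) is (eval Q) = eval (fold (\<lambda>i. pd i ^^ k i) is Q)" for k "is"
    by (induction "is" arbitrary: Q) (simp_all add: 1)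
  then show ?thesis
    by (auto simp: diff_op_def monom_diff_def pdiff_def pdm_def eval.ins_simps)
qed


section \<open>Homogeneous components and linear substitutions\<close>

definition homogeneous :: "nat \<Rightarrow> 'i mpoly \<Rightarrow> bool" where
  "homogeneous D P \<longleftrightarrow> (\<forall>\<alpha>. lookup P \<alpha> \<noteq> 0 \<longrightarrow> mdeg \<alpha> = D)"

definition hcomp :: "nat \<Rightarrow> 'i mpoly \<Rightarrow> 'i mpoly" where
  "hcomp D P = (\<Sum>\<alpha>\<in>keys P. mterm \<alpha> (lookup P \<alpha> when mdeg \<alpha> = D))"

lemma lookup_hcomp: "lookup (hcomp D P) \<alpha> = (lookup P \<alpha> when mdeg \<alpha> = D)"
  by (auto simp: hcomp_def lookup_sum lookup_single when_def in_keys_iff)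

lemma homogeneous_hcomp: "homogeneous D (hcomp D P)"
  by (auto simp: homogeneous_def lookup_hcomp)

lemma hcomp_homogeneous: "homogeneous E P \<Longrightarrow> hcomp D P = (if D = E then P else 0)"
  by (rule poly_mapping_eqI) (auto simp: homogeneous_def lookup_hcomp when_def)

lemma hcomp_add: "hcomp D (P + Q) = hcomp D P + hcomp D Q"
  by (rule poly_mapping_eqI) (auto simp: lookup_hcomp lookup_add when_def)

lemma hcomp_Const_mult: "hcomp D (Const c * P) = Const c * hcomp D P"
  by (rule poly_mapping_eqI) (auto simp: lookup_hcomp when_def)

lemma polys_hcomp: "P \<in> polys I \<Longrightarrow> hcomp D P \<in> polys I"
  by (rule polysI) (auto simp: lookup_hcomp dest: polysD)

lemma ex_hcomp_neq_0:
  assumes "P \<noteq> 0" obtains D where "hcomp D P \<noteq> 0"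
proof -
  obtain \<alpha> where "lookup P \<alpha> \<noteq> 0" using assms by (auto simp: poly_mapping_eq_iff fun_eq_iff)
  then have "lookup (hcomp (mdeg \<alpha>) P) \<alpha> \<noteq> 0" by (simp add: lookup_hcomp)
  then show thesis using that by (metis lookup_zero)
qed

lemma homogeneous_zero [simp]: "homogeneous D 0"
  by (simp add: homogeneous_def)

lemma homogeneous_add: "homogeneous D P \<Longrightarrow> homogeneous D Q \<Longrightarrow> homogeneous D (P + Q)"
  unfolding homogeneous_def lookup_add by (metis add_0)

lemma homogeneous_Const_mult: "homogeneous D P \<Longrightarrow> homogeneous D (Const c * P)"
  by (auto simp: homogeneous_def)

lemma homogeneous_sum: "(\<And>a. a \<in> A \<Longrightarrow> homogeneous D (g a)) \<Longrightarrow> homogeneous D (sum g A)"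
  by (induction A rule: infinite_finite_induct) (simp_all add: homogeneous_add)

lemma homogeneous_mult:
  assumes "homogeneous D P" "homogeneous E Q" shows "homogeneous (D + E) (P * Q)"
  unfolding homogeneous_def
proof (intro allI impI)
  fix \<gamma> assume "lookup (P * Q) \<gamma> \<noteq> 0"
  then have "\<gamma> \<in> keys (P * Q)" by (simp add: in_keys_iff)
  then obtain \<alpha> \<beta> where "\<gamma> = \<alpha> + \<beta>" "\<alpha> \<in> keys P" "\<beta> \<in> keys Q" using keys_mult[of P Q] by blast
  then show "mdeg \<gamma> = D + E" using assms by (simp add: homogeneous_def in_keys_iff mdeg_add)
qed

lemma homogeneous_monom: "mdeg \<alpha> = D \<Longrightarrow> homogeneous D (mterm \<alpha> c)"
  by (auto simp: homogeneous_def lookup_single when_def)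

lemma homogeneous_Var: "homogeneous 1 (Var i)"
  by (simp add: Var_def homogeneous_monom)

lemma total_degree_homogeneous:
  assumes "homogeneous D P" "P \<noteq> 0" shows "total_degree P = D"
proof -
  have "keys P \<noteq> {}" using assms(2) by (simp add: poly_mapping_eq_iff fun_eq_iff in_keys_iff set_eq_iff)
  moreover have "mdeg ` keys P = (\<lambda>_. D) ` keys P"
    using assms(1) by (intro image_cong) (auto simp: homogeneous_def in_keys_iff)
  ultimately have "mdeg ` keys P = {D}" by (simp add: image_constant_conv)
  then show ?thesis by (simp add: total_degree_def mdeg_def[abs_def])
qed

text \<open>Monomials of different degrees are orthogonal. This reduces the search for a partner of
  a polynomial to one of its components.\<close>

lemma apolar_hcomp: "apolar (hcomp D P) Q = apolar P (hcomp D Q)"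
proof -
  have "keys (hcomp D P) \<subseteq> keys P" by (auto simp: in_keys_iff lookup_hcomp)
  then show ?thesis
    by (simp add: apolar_superset[of "keys P"]) (auto simp: lookup_hcomp when_def intro: sum.cong)
qed

section \<open>Linear substitutions and their adjoints\<close>

definition lin :: "'i set \<Rightarrow> ('i \<Rightarrow> 'i \<Rightarrow> complex) \<Rightarrow> 'i mpoly \<Rightarrow> 'i mpoly" where
  "lin I A = subst (\<lambda>i. \<Sum>k\<in>I. Const (A i k) * Var k)"

lemma lin_simps:
  "lin I A (P + Q) = lin I A P + lin I A Q" "lin I A (P * Q) = lin I A P * lin I A Q"
  "lin I A (P ^ k) = lin I A P ^ k" "lin I A (sum g B) = (\<Sum>b\<in>B. lin I A (g b))"
  "lin I A (prod g' B') = (\<Prod>b\<in>B'. lin I A (g' b))" "lin I A (Const c) = Const c"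
  "lin I A (P - Q) = lin I A P - lin I A Q" "lin I A 0 = 0" "lin I A 1 = 1"
  "lin I A (Var i) = (\<Sum>k\<in>I. Const (A i k) * Var k)"
  by (simp_all add: lin_def subst.ins_simps)

lemma polys_lin: "P \<in> polys I \<Longrightarrow> lin I A P \<in> polys I"
  unfolding lin_def by (erule polys_subst) (intro polys_intros)

lemma eval_lin: "eval (lin I A P) x = eval P (\<lambda>i. \<Sum>k\<in>I. A i k * x k)"
  by (simp add: lin_def eval_subst eval.ins_simps)

lemma lin_cong:
  assumes "P \<in> polys I" "\<And>i k. i \<in> I \<Longrightarrow> k \<in> I \<Longrightarrow> A i k = B i k"
  shows "lin I A P = lin I B P"
  unfolding lin_def by (rule subst_cong[OF assms(1)]) (simp add: assms(2))

text \<open>Precomposition reverses the order: substituting B and then A amounts to the matrix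
  product B A.\<close>

lemma lin_lin:
  assumes "P \<in> polys I"
  shows "lin I A (lin I B P) = lin I (\<lambda>i j. \<Sum>k\<in>I. B i k * A k j) P"
proof -
  have "lin I A (\<Sum>k\<in>I. Const (B i k) * Var k) = (\<Sum>j\<in>I. Const (\<Sum>k\<in>I. B i k * A k j) * Var j)" for i
  proof -
    have "lin I A (\<Sum>k\<in>I. Const (B i k) * Var k) = (\<Sum>k\<in>I. \<Sum>j\<in>I. Const (B i k * A k j) * Var j)"
      by (simp add: lin_simps sum_distrib_left Const_mult mult_ac)
    also have "\<dots> = (\<Sum>j\<in>I. Const (\<Sum>k\<in>I. B i k * A k j) * Var j)"
      by (subst sum.swap) (simp add: Const_sum sum_distrib_right)
    finally show ?thesis .
  qed
  then show ?thesis
    by (simp add: lin_def subst_subst)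
qed

lemma lin_id:
  assumes "finite I" "P \<in> polys I" "\<And>i k. i \<in> I \<Longrightarrow> k \<in> I \<Longrightarrow> A i k = (if k = i then 1 else 0)"
  shows "lin I A P = P"
proof -
  have "lin I A P = subst Var P"
    unfolding lin_def
  proof (rule subst_cong[OF assms(2)])
    fix i assume i: "i \<in> I"
    have "(\<Sum>k\<in>I. Const (A i k) * Var k) = (\<Sum>k\<in>I. if k = i then Var k else 0)"
      using i assms(3) by (intro sum.cong) auto
    then show "(\<Sum>k\<in>I. Const (A i k) * Var k) = Var i" using i assms(1) by simp
  qed
  then show ?thesis by simp
qed

text \<open>The adjoint of a linear substitution is the substitution by the transpose. Only single
  variables have to be moved across: differentiating Q(Ax) in direction i brings out column i of A,
  which gives the linear form that replaces \<open>Var i\<close> under the transpose.\<close>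

lemma apolar_lin:
  assumes "finite I" "P \<in> polys I" "Q \<in> polys I"
  shows "apolar (lin I (\<lambda>i k. A k i) P) Q = apolar P (lin I A Q)"
  using assms(2,3)
proof (induction P arbitrary: Q rule: polys_induct)
  case (Const c)
  have "lookup (lin I A Q) 0 = lookup Q 0"
    by (simp add: eval_zero_point[symmetric] eval_lin)
  then show ?case by (simp add: lin_simps apolar_Const_left)
next
  case (add P P')
  then show ?case by (simp add: lin_simps apolar_add_left)
next
  case (Var i P)
  let ?At = "\<lambda>i k. A k i"
  have p: "pd i (\<Sum>k\<in>I. Const (A j k) * Var k) = Const (A j i)" if "j \<in> I" for j
    using Var(1) assms(1) by (simp add: pd_sum pd_Const_mult pd_Var if_distrib cong: if_cong)
  have "pd i (lin I A Q) = (\<Sum>j\<in>I. Const (A j i) * lin I A (pd j Q))"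
    unfolding lin_def pd_subst[OF assms(1) Var(4)] using p by simp
  then have "apolar (Var i * P) (lin I A Q) = (\<Sum>j\<in>I. A j i * apolar P (lin I A (pd j Q)))"
    by (simp add: apolar_Var_mult apolar_sum_right apolar_Const_mult_right)
  also have "\<dots> = (\<Sum>j\<in>I. A j i * apolar (lin I ?At P) (pd j Q))"
    using Var by (simp add: polys_pd)
  also have "\<dots> = apolar (lin I ?At (Var i * P)) Q"
    by (simp add: lin_simps sum_distrib_right apolar_sum_left mult.assoc apolar_Const_mult_left apolar_Var_mult)
  finally show ?case by simp
qed

lemma homogeneous_lin:
  assumes "homogeneous D P" shows "homogeneous D (lin I A P)"
proof -
  have m: "homogeneous (mdeg \<alpha>) (lin I A (mterm \<alpha> 1))" for \<alpha>
  proof (induction \<alpha> rule: exponent_induct[of _ UNIV, simplified, case_names zero unit])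
    case zero
    then show ?case by (simp add: lin_simps homogeneous_monom[of 0 0 1, simplified])
  next
    case (unit i \<alpha>)
    have "homogeneous 1 (\<Sum>k\<in>I. Const (A i k) * Var k)"
      by (intro homogeneous_sum homogeneous_Const_mult homogeneous_Var)
    from homogeneous_mult[OF this unit] show ?case
      by (simp add: Var_mult_monom[symmetric] lin_simps mdeg_add mdeg_unit_exp[simplified])
  qed
  have "lin I A P = (\<Sum>\<alpha>\<in>keys P. Const (lookup P \<alpha>) * lin I A (mterm \<alpha> 1))"
  proof -
    have "lin I A P = lin I A (\<Sum>\<alpha>\<in>keys P. Const (lookup P \<alpha>) * mterm \<alpha> 1)"
      using poly_mapping_sum_single[of P] by (simp add: Const_mult_monom)
    then show ?thesis by (simp add: lin_simps)
  qed
  also have "homogeneous D \<dots>"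
    using assms m by (intro homogeneous_sum homogeneous_Const_mult) (auto simp: homogeneous_def in_keys_iff)
  finally show ?thesis .
qed

lemma hcomp_lin: "hcomp D (lin I A P) = lin I A (hcomp D P)"
proof (induction P rule: poly_mapping_single_induct)
  case (single \<alpha> c)
  have h: "homogeneous (mdeg \<alpha>) (mterm \<alpha> c)" by (simp add: homogeneous_monom)
  show ?case
    by (simp add: hcomp_homogeneous[OF h] hcomp_homogeneous[OF homogeneous_lin[OF h]] lin_simps)
qed (simp add: lin_simps hcomp_add)

section \<open>Differential operators on complex powers\<close>

lemma continuous_on_eval: "continuous_on A (eval P)"
proof -
  have "continuous_on UNIV (eval P)"
  proof (induction P rule: mpoly_induct)
    case (Var i A)
    have "continuous_on UNIV (\<lambda>x :: 'a \<Rightarrow> complex. x i)"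
      by (rule continuous_on_product_coordinates)
    from continuous_on_mult[OF this Var.IH] show ?case by (simp add: eval.ins_mult)
  qed (auto simp: eval.ins_add intro: continuous_intros)
  then show ?thesis by (rule continuous_on_subset) simp
qed

lemma continuous_on_fun_upd: "continuous_on A (\<lambda>z. (x :: 'i \<Rightarrow> complex)(i := z))"
proof (rule continuous_on_coordinatewise_then_product)
  fix j show "continuous_on A (\<lambda>z. (x(i := z)) j)"
    by (cases "j = i") (auto intro: continuous_intros)
qed

lemma openin_cspace_line:
  assumes "openin (top_of_set (cspace I)) U" "x \<in> U" "i \<in> I"
  shows "open {z. x(i := z) \<in> U}" "x i \<in> {z. x(i := z) \<in> U}"
proof -
  obtain T where T: "open T" "U = cspace I \<inter> T" using assms(1) by (auto simp: openin_open)
  have "{z. x(i := z) \<in> U} = (\<lambda>z. x(i := z)) -` T"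
    using T(2) assms(2,3) by (auto simp: cspace_def)
  moreover have "open ((\<lambda>z. x(i := z)) -` T)"
    using T(1) continuous_on_fun_upd[of UNIV x i] by (simp add: continuous_on_open_vimage)
  ultimately show "open {z. x(i := z) \<in> U}" by simp
  show "x i \<in> {z. x(i := z) \<in> U}" using assms(2) by simp
qed

lemma eventually_cspace_line:
  assumes "openin (top_of_set (cspace I)) U" "x \<in> U" "i \<in> I"
  shows "\<forall>\<^sub>F z in nhds (x i). x(i := z) \<in> U"
  using openin_cspace_line[OF assms] eventually_nhds by blast

text \<open>Near z0 the value g z stays within pi of g z0, where the principal logarithm inverts the
  exponential. So g is there \<open>Ln (h z / h z0) + g z0\<close>, and continuity of the branch is
  enough for differentiability.\<close>

lemma has_field_derivative_log:
  fixes g h :: "complex \<Rightarrow> complex"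
  assumes g: "isCont g z0" and e: "\<forall>\<^sub>F z in nhds z0. exp (g z) = h z"
    and h: "(h has_field_derivative h') (at z0)"
  shows "(g has_field_derivative h' / h z0) (at z0)"
proof -
  have h0: "exp (g z0) = h z0" using e eventually_nhds_x_imp_x by fast
  then have nz: "h z0 \<noteq> 0" by (metis exp_not_eq_zero)
  have "(g \<longlongrightarrow> g z0) (nhds z0)" using g tendsto_at_iff_tendsto_nhds isCont_def by blast
  then have "\<forall>\<^sub>F z in nhds z0. dist (g z) (g z0) < pi"
    by (rule tendstoD) simp
  then have ev: "\<forall>\<^sub>F z in nhds z0. g z = Ln (h z / h z0) + g z0"
    using e
  proof eventually_elim
    case (elim z)
    have "\<bar>Im (g z - g z0)\<bar> < pi" using abs_Im_le_cmod[of "g z - g z0"] elim(1) by (simp add: dist_norm)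
    then have "Ln (exp (g z - g z0)) = g z - g z0" by (intro Ln_exp) auto
    then show ?case using elim(2) h0 by (simp add: exp_diff)
  qed
  have "((\<lambda>z. Ln (h z / h z0) + g z0) has_field_derivative h' / h z0) (at z0)"
    using nz by (auto intro!: derivative_eq_intros h)
  then show ?thesis using DERIV_cong_ev[OF refl ev refl] by blast
qed

lemma log_branch_nonzero:
  assumes "log_branches I l f U L" "x \<in> U"
  shows "j < l \<Longrightarrow> eval (f j) x \<noteq> 0" "eval (\<Prod>j<l. f j) x \<noteq> 0"
proof -
  show "eval (f j) x \<noteq> 0" if "j < l" for j
    using assms that unfolding log_branches_def by (metis exp_not_eq_zero)
  then show "eval (\<Prod>j<l. f j) x \<noteq> 0" by (simp add: eval.ins_prod)
qed

lemma log_branch_partial: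
  assumes lb: "log_branches I l f U L" and x: "x \<in> U" and i: "i \<in> I" and j: "j < l"
  shows "((\<lambda>z. L j (x(i := z))) has_field_derivative eval (pd i (f j)) x / eval (f j) x) (at (x i))"
proof -
  let ?Z = "{z. x(i := z) \<in> U}"
  have U: "openin (top_of_set (cspace I)) U" and c: "continuous_on U (L j)"
    and e: "\<And>y. y \<in> U \<Longrightarrow> exp (L j y) = eval (f j) y"
    using lb j by (auto simp: log_branches_def)
  note Z = openin_cspace_line[OF U x i]
  have "continuous_on ?Z (\<lambda>z. L j (x(i := z)))"
    by (rule continuous_on_compose2[OF c continuous_on_fun_upd]) auto
  then have "isCont (\<lambda>z. L j (x(i := z))) (x i)"
    using Z continuous_on_eq_continuous_at by blast
  moreover have "\<forall>\<^sub>F z in nhds (x i). exp (L j (x(i := z))) = eval (f j) (x(i := z))"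
    using eventually_cspace_line[OF U x i] by eventually_elim (rule e)
  moreover have "((\<lambda>z. eval (f j) (x(i := z))) has_field_derivative eval (pd i (f j)) x) (at (x i))"
    using eval_has_partial[where P = "f j" and x = x and i = i and z = "x i"] by simp
  ultimately show ?thesis using has_field_derivative_log by fastforce
qed

lemma multi_power_partial:
  assumes "log_branches I l f U L" "x \<in> U" "i \<in> I"
  shows "((\<lambda>z. multi_power l L s (x(i := z))) has_field_derivative
    multi_power l L s x * (\<Sum>j<l. s j * (eval (pd i (f j)) x / eval (f j) x))) (at (x i))"
proof -
  have "((\<lambda>z. \<Sum>j<l. s j * L j (x(i := z))) has_field_derivative
      (\<Sum>j<l. s j * (eval (pd i (f j)) x / eval (f j) x))) (at (x i))"
    by (intro DERIV_sum DERIV_cmult log_branch_partial[OF assms]) simp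
  from DERIV_chain2[OF DERIV_exp this] show ?thesis
    by (simp add: multi_power_def)
qed

lemma multi_power_of_nat:
  assumes "log_branches I l f U L" "x \<in> U"
  shows "multi_power l L (\<lambda>j. of_nat (N j)) x = eval (\<Prod>j<l. f j ^ N j) x"
  using assms by (simp add: multi_power_def exp_sum exp_of_nat_mult log_branches_def eval.ins_simps)

lemma multi_power_shift:
  assumes "log_branches I l f U L" "x \<in> U"
  shows "multi_power l L (\<lambda>j. s j + of_nat (\<mu> j)) x = multi_power l L s x * eval (\<Prod>j<l. f j ^ \<mu> j) x"
  unfolding multi_power_of_nat[OF assms, symmetric] multi_power_def
  by (simp add: distrib_right sum.distrib exp_add)

text \<open>The families of functions \<open>f\<^sup>s Q(s, x) / (f\<^sub>0 \<cdots> f\<^sub>l\<^sub>-\<^sub>1)\<^sup>k\<close> with \<open>Q\<close> a polynomial are closed under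
  partial derivatives.\<close>

definition pow_form ::
  "'i set \<Rightarrow> nat \<Rightarrow> (nat \<Rightarrow> 'i mpoly) \<Rightarrow>
   ((nat \<Rightarrow> complex) \<Rightarrow> (nat \<Rightarrow> ('i \<Rightarrow> complex) \<Rightarrow> complex) \<Rightarrow> ('i \<Rightarrow> complex) \<Rightarrow> complex) \<Rightarrow> bool" where
  "pow_form I l f \<Phi> \<longleftrightarrow> (\<exists>Q k. \<forall>s U L. log_branches I l f U L \<longrightarrow> (\<forall>x\<in>U.
     \<Phi> s L x * eval (\<Prod>j<l. f j) x ^ k = multi_power l L s x * eval Q (case_sum s x)))"

lemma eval_subst_Inr: "eval (subst (\<lambda>i. Var (Inr i)) P) (case_sum s x) = eval P x"
  by (simp add: eval_subst)

lemma pow_form_shift: "pow_form I l f (\<lambda>s L. multi_power l L (\<lambda>j. s j + of_nat (\<mu> j)))"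
  unfolding pow_form_def
  by (intro exI[of _ "subst (\<lambda>i. Var (Inr i)) (\<Prod>j<l. f j ^ \<mu> j)"] exI[of _ 0])
    (auto simp only: eval_subst_Inr multi_power_shift power_0 mult_1_right)

lemma pow_form_partial:
  assumes "pow_form I l f \<Phi>" and i: "i \<in> I"
  shows "pow_form I l f (\<lambda>s L. partial i (\<Phi> s L))"
proof -
  define F where "F = (\<Prod>j<l. f j)"
  obtain Q k where Q: "\<And>s U L x. log_branches I l f U L \<Longrightarrow> x \<in> U \<Longrightarrow>
      \<Phi> s L x * eval F x ^ k = multi_power l L s x * eval Q (case_sum s x)"
    using assms(1) unfolding pow_form_def F_def by blast
  \<comment> \<open>Clearing denominators: S is the product of all \<open>f a\<close> times the
    logarithmic derivative of f^s, and \<open>Q'\<close> is the numerator that the quotient rule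
    gives over the (k + 1)-st power of that product.\<close>
  define S where "S = (\<Sum>j<l. Var (Inl j) * subst (\<lambda>i. Var (Inr i)) (pd i (f j) * (\<Prod>a\<in>{..<l} - {j}. f a)))"
  define Q' where "Q' = S * Q + subst (\<lambda>i. Var (Inr i)) F * pd (Inr i) Q
    - of_nat k * subst (\<lambda>i. Var (Inr i)) (pd i F) * Q"
  have "partial i (\<Phi> s L) x * eval F x ^ Suc k = multi_power l L s x * eval Q' (case_sum s x)"
    if lb: "log_branches I l f U L" and x: "x \<in> U" for s U L x
  proof -
    have U: "openin (top_of_set (cspace I)) U" using lb by (simp add: log_branches_def)
    have F0: "eval F x \<noteq> 0" unfolding F_def by (rule log_branch_nonzero[OF lb x])
    let ?y = "\<lambda>z. x(i := z)"
    have cs: "case_sum s (?y z) = (case_sum s x)(Inr i := z)" for z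
      by (rule ext) (auto split: sum.split)
    define t where "t = (\<Sum>j<l. s j * (eval (pd i (f j)) x / eval (f j) x))"
    define q where "q = eval Q (case_sum s x)"
    define q' where "q' = eval (pd (Inr i) Q) (case_sum s x)"
    define M where "M = multi_power l L s x"
    have dM: "((\<lambda>z. multi_power l L s (?y z)) has_field_derivative M * t) (at (x i))"
      unfolding M_def t_def by (rule multi_power_partial[OF lb x i])
    have dQ: "((\<lambda>z. eval Q (case_sum s (?y z))) has_field_derivative q') (at (x i))"
      unfolding cs q'_def using eval_has_partial[where P = Q and x = "case_sum s x" and i = "Inr i" and z = "x i"]
      by (simp add: cs[of "x i", symmetric])
    have dF: "((\<lambda>z. eval F (?y z)) has_field_derivative eval (pd i F) x) (at (x i))"
      using eval_has_partial[where P = F and x = x and i = i and z = "x i"] by simp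
    have dR: "((\<lambda>z. multi_power l L s (?y z) * eval Q (case_sum s (?y z)) / eval F (?y z) ^ k)
      has_field_derivative ((M * t * q + q' * M) * eval F x ^ k
        - M * q * (of_nat k * (eval (pd i F) x * eval F x ^ (k - 1)))) / (eval F x ^ k * eval F x ^ k)) (at (x i))"
      using DERIV_divide[OF DERIV_mult[OF dM dQ] DERIV_power[OF dF, of k]] F0
      by (simp add: q_def M_def)
    have ev: "\<forall>\<^sub>F z in nhds (x i). \<Phi> s L (?y z) = multi_power l L s (?y z) * eval Q (case_sum s (?y z)) / eval F (?y z) ^ k"
      using eventually_cspace_line[OF U x i]
    proof eventually_elim
      case (elim z)
      have "eval F (?y z) \<noteq> 0" unfolding F_def by (rule log_branch_nonzero[OF lb elim])
      then show ?case using Q[OF lb elim, of s] by (simp add: divide_simps)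
    qed
    from dR have "((\<lambda>z. \<Phi> s L (?y z)) has_field_derivative ((M * t * q + q' * M) * eval F x ^ k
        - M * q * (of_nat k * (eval (pd i F) x * eval F x ^ (k - 1)))) / (eval F x ^ k * eval F x ^ k)) (at (x i))"
      using DERIV_cong_ev[OF refl ev refl] by blast
    then have p: "partial i (\<Phi> s L) x = ((M * t * q + q' * M) * eval F x ^ k
        - M * q * (of_nat k * (eval (pd i F) x * eval F x ^ (k - 1)))) / (eval F x ^ k * eval F x ^ k)"
      unfolding partial_def by (rule DERIV_imp_deriv)
    have "partial i (\<Phi> s L) x * eval F x ^ Suc k
      = M * (t * eval F x * q + eval F x * q' - of_nat k * eval (pd i F) x * q)"
    \<comment> \<open>The power rule produces the exponent \<open>k - 1\<close>, which is truncated
      when k is 0.\<close>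
    proof (cases k)
      case 0
      then show ?thesis by (simp add: p algebra_simps)
    next
      case (Suc k')
      then show ?thesis using F0 by (simp add: p field_simps)
    qed
    moreover have "t * eval F x = eval S (case_sum s x)"
    proof -
      have "eval F x = eval (f j) x * eval (\<Prod>a\<in>{..<l} - {j}. f a) x" if "j < l" for j
        unfolding F_def using that by (subst prod.remove[of _ j]) (simp_all add: eval.ins_mult)
      then show ?thesis
        using log_branch_nonzero(1)[OF lb x]
        by (auto simp: t_def S_def eval.ins_sum eval.ins_mult[of _ "Var _"] eval_subst_Inr sum_distrib_right
            eval.ins_mult[of _ "pd _ _"] intro!: sum.cong)
    qed
    ultimately show ?thesis
      by (simp add: Q'_def M_def q_def q'_def eval.ins_simps eval_subst_Inr)
  qed
  then show ?thesis unfolding pow_form_def F_def by blast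
qed

lemma pow_form_fold:
  assumes "pow_form I l f \<Phi>" "set is \<subseteq> I"
  shows "pow_form I l f (\<lambda>s L. fold (\<lambda>i. partial i ^^ k i) is (\<Phi> s L))"
  using assms
proof (induction "is" arbitrary: \<Phi>)
  case (Cons i "is")
  have "pow_form I l f (\<lambda>s L. (partial i ^^ n) (\<Phi> s L))" for n
    using Cons.prems by (induction n) (auto intro: pow_form_partial)
  then show ?case using Cons by simp
qed simp

lemma pow_form_add:
  assumes "pow_form I l f \<Phi>" "pow_form I l f \<Psi>"
  shows "pow_form I l f (\<lambda>s L x. \<Phi> s L x + \<Psi> s L x)"
proof -
  define F where "F = (\<Prod>j<l. f j)"
  let ?F = "subst (\<lambda>i. Var (Inr i)) F"
  obtain Q k where Q: "\<And>s U L x. log_branches I l f U L \<Longrightarrow> x \<in> U \<Longrightarrow>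
      \<Phi> s L x * eval F x ^ k = multi_power l L s x * eval Q (case_sum s x)"
    using assms(1) unfolding pow_form_def F_def by blast
  obtain Q' k' where Q': "\<And>s U L x. log_branches I l f U L \<Longrightarrow> x \<in> U \<Longrightarrow>
      \<Psi> s L x * eval F x ^ k' = multi_power l L s x * eval Q' (case_sum s x)"
    using assms(2) unfolding pow_form_def F_def by blast
  have "(\<Phi> s L x + \<Psi> s L x) * eval F x ^ (k + k') =
      multi_power l L s x * eval (Q * ?F ^ k' + Q' * ?F ^ k) (case_sum s x)"
    if "log_branches I l f U L" "x \<in> U" for s U L x
  proof -
    have "(\<Phi> s L x + \<Psi> s L x) * eval F x ^ (k + k') =
      (\<Phi> s L x * eval F x ^ k) * eval F x ^ k' + (\<Psi> s L x * eval F x ^ k') * eval F x ^ k"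
      by (simp add: power_add algebra_simps)
    then show ?thesis
      by (simp add: Q[OF that] Q'[OF that] eval.ins_simps eval_subst_Inr algebra_simps)
  qed
  then show ?thesis unfolding pow_form_def F_def by blast
qed

lemma pow_form_scale:
  assumes "pow_form I l f \<Phi>" shows "pow_form I l f (\<lambda>s L x. c * \<Phi> s L x)"
proof -
  obtain Q k where Q: "\<And>s U L x. log_branches I l f U L \<Longrightarrow> x \<in> U \<Longrightarrow>
      \<Phi> s L x * eval (\<Prod>j<l. f j) x ^ k = multi_power l L s x * eval Q (case_sum s x)"
    using assms unfolding pow_form_def by blast
  have "c * \<Phi> s L x * eval (\<Prod>j<l. f j) x ^ k = multi_power l L s x * eval (Const c * Q) (case_sum s x)"
    if "log_branches I l f U L" "x \<in> U" for s U L x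
    using Q[OF that] by (simp add: eval.ins_mult mult.assoc mult.left_commute)
  then show ?thesis unfolding pow_form_def by blast
qed

lemma pow_form_zero: "pow_form I l f (\<lambda>s L x. 0)"
  unfolding pow_form_def by (rule exI[of _ 0]) simp

lemma pow_form_diff_op:
  assumes "pow_form I l f \<Phi>" "P \<in> polys I"
  shows "pow_form I l f (\<lambda>s L. diff_op P (\<Phi> s L))"
proof -
  have m: "pow_form I l f (\<lambda>s L. monom_diff \<alpha> (\<Phi> s L))" if "\<alpha> \<in> keys P" for \<alpha>
    unfolding monom_diff_def
    using some_enumeration[of "keys \<alpha>"] that assms(2)
    by (intro pow_form_fold[OF assms(1)]) (auto simp: polys_def)
  have "pow_form I l f (\<lambda>s L x. \<Sum>\<alpha>\<in>A. lookup P \<alpha> * monom_diff \<alpha> (\<Phi> s L) x)"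
    if "finite A" "A \<subseteq> keys P" for A
    using that
  proof induction
    case (insert \<alpha> A)
    then show ?case using pow_form_add[OF pow_form_scale[OF m[of \<alpha>]] insert.IH] by simp
  qed (simp add: pow_form_zero)
  from this[of "keys P"] show ?thesis by (simp add: diff_op_def[abs_def])
qed

lemma partial_local:
  assumes "openin (top_of_set (cspace I)) U" "\<And>x. x \<in> U \<Longrightarrow> G x = G' x" "i \<in> I" "x \<in> U"
  shows "partial i G x = partial i G' x"
proof -
  have "\<forall>\<^sub>F z in nhds (x i). G (x(i := z)) = G' (x(i := z))"
    using eventually_cspace_line[OF assms(1,4,3)] by eventually_elim (rule assms(2))
  then show ?thesis unfolding partial_def by (rule deriv_cong_ev) simp
qed

text \<open>Iterated derivatives see only the germ of a function. This matters because f^s at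
  natural exponents is known to coincide with a polynomial on U only, where the branches
  live.\<close>

lemma diff_op_local:
  assumes "openin (top_of_set (cspace I)) U" "\<And>x. x \<in> U \<Longrightarrow> G x = G' x" "P \<in> polys I" "x \<in> U"
  shows "diff_op P G x = diff_op P G' x"
proof -
  have 1: "(partial i ^^ n) H y = (partial i ^^ n) H' y"
    if "i \<in> I" "\<And>x. x \<in> U \<Longrightarrow> H x = H' x" "y \<in> U" for i n y and H H' :: "('a \<Rightarrow> complex) \<Rightarrow> complex"
    using that(3)
  proof (induction n arbitrary: y)
    case (Suc n)
    show ?case using partial_local[OF assms(1) Suc.IH that(1) Suc.prems] by simp
  qed (simp add: that)
  have 2: "fold (\<lambda>i. partial i ^^ k i) is H y = fold (\<lambda>i. partial i ^^ k i) is H' y"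
    if "set is \<subseteq> I" "\<And>x. x \<in> U \<Longrightarrow> H x = H' x" "y \<in> U" for k "is" y and H H' :: "('a \<Rightarrow> complex) \<Rightarrow> complex"
    using that
  proof (induction "is" arbitrary: H H' y)
    case (Cons i "is")
    have "fold (\<lambda>i. partial i ^^ k i) is ((partial i ^^ k i) H) y = fold (\<lambda>i. partial i ^^ k i) is ((partial i ^^ k i) H') y"
      using Cons.prems by (intro Cons.IH 1) auto
    then show ?case by simp
  qed simp
  have "monom_diff \<alpha> G x = monom_diff \<alpha> G' x" if "\<alpha> \<in> keys P" for \<alpha>
    unfolding monom_diff_def using some_enumeration[of "keys \<alpha>"] that assms(3)
    by (intro 2 assms(2,4)) (auto simp: polys_def)
  then show ?thesis by (simp add: diff_op_def cong: sum.cong)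
qed

text \<open>Divided by its value at x, each \<open>f j\<close> equals 1 at x and has positive real
  part nearby, which keeps it off the cut of the principal logarithm. Adding the logarithm of the
  value undoes the division.\<close>

lemma ex_log_branches:
  assumes "x \<in> cspace I" "\<And>j. j < l \<Longrightarrow> eval (f j) x \<noteq> 0"
  obtains U L where "log_branches I l f U L" "x \<in> U"
proof -
  define T where "T = (\<Inter>j\<in>{..<l}. {y. 0 < Re (eval (f j) y / eval (f j) x)})"
  define L where "L j y = Ln (eval (f j) y / eval (f j) x) + Ln (eval (f j) x)" for j y
  have c: "continuous_on UNIV (\<lambda>y. eval (f j) y / eval (f j) x)" for j
    unfolding divide_inverse by (intro continuous_intros continuous_on_eval)
  have "open T" unfolding T_def
    by (intro open_INT ballI open_Collect_less continuous_intros continuous_on_Re c) simp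
  then have "openin (top_of_set (cspace I)) (cspace I \<inter> T)" by (auto simp: openin_open)
  moreover have "continuous_on (cspace I \<inter> T) (L j)" if "j < l" for j
  proof -
    have "continuous_on (cspace I \<inter> T) (\<lambda>y. Ln (eval (f j) y / eval (f j) x))"
    proof (rule continuous_on_Ln')
      show "continuous_on (cspace I \<inter> T) (\<lambda>y. eval (f j) y / eval (f j) x)"
        by (rule continuous_on_subset[OF c]) simp
    next
      fix y assume "y \<in> cspace I \<inter> T"
      then have "0 < Re (eval (f j) y / eval (f j) x)" using that by (auto simp: T_def)
      then show "eval (f j) y / eval (f j) x \<notin> \<real>\<^sub>\<le>\<^sub>0" by (auto simp: complex_nonpos_Reals_iff)
    qed
    then show ?thesis unfolding L_def by (intro continuous_on_add continuous_on_const)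
  qed
  moreover have "exp (L j y) = eval (f j) y" if "j < l" "y \<in> cspace I \<inter> T" for j y
  proof -
    have "0 < Re (eval (f j) y / eval (f j) x)" using that by (auto simp: T_def)
    then have "eval (f j) y \<noteq> 0" by auto
    then show ?thesis using assms(2)[OF that(1)] by (simp add: L_def exp_add)
  qed
  ultimately have "log_branches I l f (cspace I \<inter> T) L" by (simp add: log_branches_def)
  moreover have "x \<in> cspace I \<inter> T" using assms by (auto simp: T_def)
  ultimately show thesis using that by blast
qed

text \<open>Natural points are Zariski dense: release the coordinates one at a time, using that a
  polynomial in one variable with infinitely many zeros is 0.\<close>

lemma eval_of_nat_vanishing:
  fixes P :: "nat mpoly"
  assumes "\<And>N. eval P (\<lambda>j. of_nat (N j)) = 0"
  shows "eval P s = 0"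
proof -
  have *: "eval P s = 0" if "finite A" "\<And>j. j \<notin> A \<Longrightarrow> s j \<in> \<nat>" for A s
    using that
  proof (induction arbitrary: s)
    case empty
    then have "\<forall>j. \<exists>n. s j = of_nat n" by (auto elim: Nats_cases)
    then obtain N where "\<And>j. s j = of_nat (N j)" using choice[of "\<lambda>j n. s j = of_nat n"] by blast
    then have "s = (\<lambda>j. of_nat (N j))" by auto
    then show ?case using assms by simp
  next
    case (insert a A)
    obtain p where p: "\<And>t. poly p t = eval P (\<lambda>i. (s(a := 0)) i + t * ((s(a := 1)) i - (s(a := 0)) i))"
      using eval_on_line[of "s(a := 0)" "s(a := 1)" P] by blast
    have e: "(\<lambda>i. (s(a := 0)) i + t * ((s(a := 1)) i - (s(a := 0)) i)) = s(a := t)" for t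
      by auto
    have "poly p (of_nat n) = 0" for n
      unfolding p e using insert.prems by (intro insert.IH) auto
    then have "range of_nat \<subseteq> {t. poly p t = 0}" by auto
    moreover have "infinite (range (of_nat :: nat \<Rightarrow> complex))"
      by (simp add: inj_of_nat range_inj_infinite)
    ultimately have "p = 0" using poly_roots_finite finite_subset by blast
    then show ?case using p[of "s a"] unfolding e by simp
  qed
  \<comment> \<open>Only the finitely many variables of P matter. The others are set to 0, a natural
    number, so that the induction over a finite set applies.\<close>
  define V where "V = (\<Union>\<alpha>\<in>keys P. keys \<alpha>)"
  have "P \<in> polys V" by (auto simp: polys_def V_def)
  then have "eval P s = eval P (\<lambda>j. if j \<in> V then s j else 0)" by (rule eval_cong) simp
  also have "\<dots> = 0" by (rule *[of V]) (auto simp: V_def)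
  finally show ?thesis .
qed

text \<open>One pair Q, k serves all exponents at once. The second half is the first at natural
  exponents: around every point where no \<open>f j\<close> vanishes branches exist, and they then
  drop out of the formula.\<close>

lemma diff_op_power_form:
  fixes f :: "nat \<Rightarrow> 'i mpoly"
  assumes f: "\<forall>j<l. f j \<in> polys I" and P: "P \<in> polys I"
  shows "\<exists>Q k. (\<forall>s U L. log_branches I l f U L \<longrightarrow> (\<forall>x\<in>U.
      diff_op P (multi_power l L (\<lambda>j. s j + of_nat (\<mu> j))) x * eval (\<Prod>j<l. f j) x ^ k
        = multi_power l L s x * eval Q (case_sum s x))) \<and>
    (\<forall>N. \<forall>x\<in>cspace I. eval (\<Prod>j<l. f j) x \<noteq> 0 \<longrightarrow>
      eval (pdiff P (\<Prod>j<l. f j ^ (N j + \<mu> j))) x * eval (\<Prod>j<l. f j) x ^ k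
        = eval (\<Prod>j<l. f j ^ N j) x * eval Q (case_sum (\<lambda>j. of_nat (N j)) x))"
proof -
  have "pow_form I l f (\<lambda>s L. diff_op P (multi_power l L (\<lambda>j. s j + of_nat (\<mu> j))))"
    by (rule pow_form_diff_op[OF pow_form_shift P])
  then obtain Q k where Q: "\<And>s U L x. log_branches I l f U L \<Longrightarrow> x \<in> U \<Longrightarrow>
      diff_op P (multi_power l L (\<lambda>j. s j + of_nat (\<mu> j))) x * eval (\<Prod>j<l. f j) x ^ k
        = multi_power l L s x * eval Q (case_sum s x)"
    unfolding pow_form_def by blast
  have "eval (pdiff P (\<Prod>j<l. f j ^ (N j + \<mu> j))) x * eval (\<Prod>j<l. f j) x ^ k
      = eval (\<Prod>j<l. f j ^ N j) x * eval Q (case_sum (\<lambda>j. of_nat (N j)) x)"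
    if x: "x \<in> cspace I" and F: "eval (\<Prod>j<l. f j) x \<noteq> 0" for N x
  proof -
    have "eval (f j) x \<noteq> 0" if "j < l" for j using F that by (auto simp: eval.ins_prod)
    then obtain U L where lb: "log_branches I l f U L" and xU: "x \<in> U"
      using ex_log_branches[OF x, of l f] by blast
    have "diff_op P (multi_power l L (\<lambda>j. of_nat (N j) + of_nat (\<mu> j))) x
      = diff_op P (eval (\<Prod>j<l. f j ^ (N j + \<mu> j))) x"
      using lb xU multi_power_of_nat[OF lb, of _ "\<lambda>j. N j + \<mu> j"]
      by (intro diff_op_local[OF _ _ P]) (auto simp: log_branches_def)
    then show ?thesis
      using Q[OF lb xU, of "\<lambda>j. of_nat (N j)"] multi_power_of_nat[OF lb xU, of N]
      by (simp add: diff_op_eval)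
  qed
  with Q show ?thesis by blast
qed

text \<open>The defining property restricted to natural exponents: an identity of polynomials,
  without branches. By \<open>b_equation_iff\<close> nothing is lost.\<close>

definition b_equation :: "nat \<Rightarrow> 'i mpoly \<Rightarrow> (nat \<Rightarrow> 'i mpoly) \<Rightarrow> (nat \<Rightarrow> nat) \<Rightarrow> nat mpoly \<Rightarrow> bool" where
  "b_equation l P f \<mu> b \<longleftrightarrow> (\<forall>N. pdiff P (\<Prod>j<l. f j ^ (N j + \<mu> j)) =
     Const (eval b (\<lambda>j. of_nat (N j))) * (\<Prod>j<l. f j ^ N j))"

lemma eval_case_sum: "eval (subst (case_sum Var (\<lambda>i. Const (x i))) Q) s = eval Q (case_sum s x)"
proof -
  have "(\<lambda>i. eval (case_sum Var (\<lambda>i. Const (x i)) i) s) = case_sum s x"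
    by (auto simp: fun_eq_iff split: sum.split)
  then show ?thesis by (simp add: eval_subst)
qed

text \<open>For fixed x both sides say that b(s) times the k-th power of the product of all
  \<open>f j\<close> at x equals Q(s, x). This is polynomial in s, so natural s decide; in the other
  direction, the points where the product does not vanish decide an identity of polynomials in
  x.\<close>

lemma b_equation_iff:
  assumes f: "\<And>j. j < l \<Longrightarrow> f j \<in> polys I" "\<And>j. j < l \<Longrightarrow> f j \<noteq> 0" and P: "P \<in> polys I"
  shows "(\<forall>s U L. log_branches I l f U L \<longrightarrow>
      (\<forall>x\<in>U. diff_op P (multi_power l L (\<lambda>j. s j + of_nat (\<mu> j))) x = eval b s * multi_power l L s x))
    \<longleftrightarrow> b_equation l P f \<mu> b" (is "?A \<longleftrightarrow> _")
proof -
  define F where "F = (\<Prod>j<l. f j)"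
  have F: "F \<in> polys I" "F \<noteq> 0" unfolding F_def
    using f by (auto intro!: polys_prod mpoly_prod_neq_0)
  have fN: "(\<Prod>j<l. f j ^ N j) \<in> polys I" for N using f by (auto intro!: polys_intros)
  have f': "\<forall>j<l. f j \<in> polys I" using f(1) by simp
  obtain Q k where Q1: "\<And>s U L x. log_branches I l f U L \<Longrightarrow> x \<in> U \<Longrightarrow>
      diff_op P (multi_power l L (\<lambda>j. s j + of_nat (\<mu> j))) x * eval F x ^ k
        = multi_power l L s x * eval Q (case_sum s x)"
    and Q2: "\<And>N x. x \<in> cspace I \<Longrightarrow> eval F x \<noteq> 0 \<Longrightarrow>
      eval (pdiff P (\<Prod>j<l. f j ^ (N j + \<mu> j))) x * eval F x ^ k
        = eval (\<Prod>j<l. f j ^ N j) x * eval Q (case_sum (\<lambda>j. of_nat (N j)) x)"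
    using diff_op_power_form[where f = f and l = l and \<mu> = \<mu>, OF f' P, folded F_def]
    by (elim exE conjE) (rule that, blast+)
  have M0: "multi_power l L s x \<noteq> 0" for L s x by (simp add: multi_power_def)
  show ?thesis
  proof
    assume A: ?A
    show "b_equation l P f \<mu> b"
      unfolding b_equation_def
    proof (intro allI eval_eqI_generic[OF _ _ F])
      fix N x assume x: "x \<in> cspace I" "eval F x \<noteq> 0"
      then have "eval (f j) x \<noteq> 0" if "j < l" for j using that by (auto simp: F_def eval.ins_prod)
      then obtain U L where lb: "log_branches I l f U L" and xU: "x \<in> U"
        using ex_log_branches[OF x(1), of l f] by blast
      have "eval b (\<lambda>j. of_nat (N j)) * eval F x ^ k = eval Q (case_sum (\<lambda>j. of_nat (N j)) x)"
        using Q1[OF lb xU, of "\<lambda>j. of_nat (N j)"] A lb xU M0[of L "\<lambda>j. of_nat (N j)" x] by auto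
      then have "eval (pdiff P (\<Prod>j<l. f j ^ (N j + \<mu> j))) x * eval F x ^ k =
        (eval (\<Prod>j<l. f j ^ N j) x * eval b (\<lambda>j. of_nat (N j))) * eval F x ^ k"
        using Q2[OF x, of N] by (simp add: mult.assoc)
      then show "eval (pdiff P (\<Prod>j<l. f j ^ (N j + \<mu> j))) x =
        eval (Const (eval b (\<lambda>j. of_nat (N j))) * (\<Prod>j<l. f j ^ N j)) x"
        using x(2) by (simp add: eval.ins_mult mult.commute)
    qed (auto intro!: polys_pdiff polys_mult polys_Const fN)
  next
    assume B: "b_equation l P f \<mu> b"
    show ?A
    proof (intro allI impI ballI)
      fix s U L x assume lb: "log_branches I l f U L" and xU: "x \<in> U"
      have x: "x \<in> cspace I" "eval F x \<noteq> 0"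
        using lb xU log_branch_nonzero(2)[OF lb xU] openin_imp_subset
        by (auto simp: log_branches_def F_def)
      have "eval b s * eval F x ^ k - eval Q (case_sum s x) = 0" for s
      proof -
        have "eval (b * Const (eval F x ^ k) - subst (case_sum Var (\<lambda>i. Const (x i))) Q) s = 0"
        proof (rule eval_of_nat_vanishing)
          fix N
          have "eval (\<Prod>j<l. f j ^ N j) x \<noteq> 0"
            using x(2) by (auto simp: F_def eval.ins_simps)
          then have "eval b (\<lambda>j. of_nat (N j)) * eval F x ^ k = eval Q (case_sum (\<lambda>j. of_nat (N j)) x)"
            using Q2[OF x, of N] B[unfolded b_equation_def, rule_format, of N] by (simp add: eval.ins_mult)
          then show "eval (b * Const (eval F x ^ k) - subst (case_sum Var (\<lambda>i. Const (x i))) Q)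
              (\<lambda>j. of_nat (N j)) = 0"
            by (simp add: eval.ins_diff eval.ins_mult eval_case_sum)
        qed
        then show ?thesis by (simp add: eval.ins_diff eval.ins_mult eval_case_sum)
      qed
      then have "eval b s * eval F x ^ k = eval Q (case_sum s x)" by simp
      then have "diff_op P (multi_power l L (\<lambda>j. s j + of_nat (\<mu> j))) x * eval F x ^ k =
        (eval b s * multi_power l L s x) * eval F x ^ k"
        using Q1[OF lb xU, of s] by (simp add: mult_ac)
      then show "diff_op P (multi_power l L (\<lambda>j. s j + of_nat (\<mu> j))) x = eval b s * multi_power l L s x"
        using x(2) by simp
    qed
  qed
qed

text \<open>The hypothesis gives merely some constant for each N. That these constants are values of
  a polynomial is seen at a single point x off the zero set, where they are Q(N, x) divided by a
  fixed number.\<close>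

lemma ex_b_equation:
  assumes f: "\<And>j. j < l \<Longrightarrow> f j \<in> polys I" "\<And>j. j < l \<Longrightarrow> f j \<noteq> 0" and P: "P \<in> polys I"
    and ex: "\<And>N. \<exists>c. pdiff P (\<Prod>j<l. f j ^ (N j + \<mu> j)) = Const c * (\<Prod>j<l. f j ^ N j)"
  obtains b where "b \<in> polys {..<l}" "b_equation l P f \<mu> b"
proof -
  define F where "F = (\<Prod>j<l. f j)"
  have F: "F \<in> polys I" "F \<noteq> 0" unfolding F_def
    using f by (auto intro!: polys_prod mpoly_prod_neq_0)
  have f': "\<forall>j<l. f j \<in> polys I" using f(1) by simp
  obtain Q k where Q2: "\<And>N x. x \<in> cspace I \<Longrightarrow> eval F x \<noteq> 0 \<Longrightarrow>
      eval (pdiff P (\<Prod>j<l. f j ^ (N j + \<mu> j))) x * eval F x ^ k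
        = eval (\<Prod>j<l. f j ^ N j) x * eval Q (case_sum (\<lambda>j. of_nat (N j)) x)"
    using diff_op_power_form[where f = f and l = l and \<mu> = \<mu>, OF f' P, folded F_def]
    by (elim exE conjE) (rule that, blast+)
  obtain x where x: "x \<in> cspace I" "eval F x \<noteq> 0" using eval_nonzero_point[OF F] .
  \<comment> \<open>Variables with index at least l are replaced by 0, which puts b into
    \<open>polys {..<l}\<close>; accordingly N is compared below with its truncation
    \<open>N'\<close>.\<close>
  define b where "b = subst (\<lambda>j. if j < l then Var j else 0)
    (Const (1 / eval F x ^ k) * subst (case_sum Var (\<lambda>i. Const (x i))) Q)"
  have "b \<in> polys {..<l}"
    unfolding b_def by (rule polys_subst[OF polys_UNIV]) (auto intro: polys_Var)
  moreover have "b_equation l P f \<mu> b"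
    unfolding b_equation_def
  proof
    fix N :: "nat \<Rightarrow> nat"
    define N' where "N' j = (if j < l then N j else 0)" for j
    obtain c where c: "pdiff P (\<Prod>j<l. f j ^ (N j + \<mu> j)) = Const c * (\<Prod>j<l. f j ^ N j)"
      using ex by blast
    have p: "(\<Prod>j<l. f j ^ (N' j + \<mu> j)) = (\<Prod>j<l. f j ^ (N j + \<mu> j))"
      "(\<Prod>j<l. f j ^ N' j) = (\<Prod>j<l. f j ^ N j)"
      by (auto simp: N'_def intro!: prod.cong)
    have nz: "eval (\<Prod>j<l. f j ^ N j) x \<noteq> 0"
      using x(2) by (auto simp: F_def eval.ins_simps)
    have "(\<lambda>j. eval (if j < l then Var j else 0) (\<lambda>j. of_nat (N j))) = (\<lambda>j. of_nat (N' j))"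
      by (auto simp: N'_def)
    then have "eval b (\<lambda>j. of_nat (N j)) = eval Q (case_sum (\<lambda>j. of_nat (N' j)) x) / eval F x ^ k"
      by (simp add: b_def eval_subst[where \<theta> = "\<lambda>j. if j < l then Var j else 0"] eval.ins_mult eval_case_sum)
    also have "\<dots> = c"
      using Q2[OF x, of N'] x(2) nz unfolding p c by (simp add: eval.ins_mult divide_simps mult_ac)
    finally show "pdiff P (\<Prod>j<l. f j ^ (N j + \<mu> j)) =
        Const (eval b (\<lambda>j. of_nat (N j))) * (\<Prod>j<l. f j ^ N j)"
      using c by simp
  qed
  ultimately show thesis using that by blast
qed

section \<open>Linear actions and semi-invariants\<close>

definition act_mat :: "('g \<Rightarrow> ('i \<Rightarrow> complex) \<Rightarrow> 'i \<Rightarrow> complex) \<Rightarrow> 'g \<Rightarrow> 'i \<Rightarrow> 'i \<Rightarrow> complex" where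
  "act_mat act g i k = act g (\<lambda>j. if j = k then 1 else 0) i"

text \<open>\<open>act\<close> is an arbitrary function on all families of numbers, so linearity and
  the group law are demanded through its matrices on \<open>I\<close>, which are all that
  \<open>lin\<close> uses.\<close>

definition linear_action ::
  "('g, 'z) monoid_scheme \<Rightarrow> ('g \<Rightarrow> ('i \<Rightarrow> complex) \<Rightarrow> 'i \<Rightarrow> complex) \<Rightarrow> 'i set \<Rightarrow> bool" where
  "linear_action \<G> act I \<longleftrightarrow> group \<G> \<and>
     (\<forall>g\<in>carrier \<G>. \<forall>x\<in>cspace I. act g x \<in> cspace I \<and> (\<forall>i\<in>I. act g x i = (\<Sum>k\<in>I. act_mat act g i k * x k))) \<and>
     (\<forall>i\<in>I. \<forall>k\<in>I. act_mat act \<one>\<^bsub>\<G>\<^esub> i k = (if k = i then 1 else 0)) \<and>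
     (\<forall>g\<in>carrier \<G>. \<forall>h\<in>carrier \<G>. \<forall>i\<in>I. \<forall>k\<in>I.
        act_mat act (g \<otimes>\<^bsub>\<G>\<^esub> h) i k = (\<Sum>j\<in>I. act_mat act g i j * act_mat act h j k))"

lemma act_mat_mult:
  "linear_action \<G> act I \<Longrightarrow> g \<in> carrier \<G> \<Longrightarrow> h \<in> carrier \<G> \<Longrightarrow> i \<in> I \<Longrightarrow> k \<in> I \<Longrightarrow>
    act_mat act (g \<otimes>\<^bsub>\<G>\<^esub> h) i k = (\<Sum>j\<in>I. act_mat act g i j * act_mat act h j k)"
  and act_mat_one:
  "linear_action \<G> act I \<Longrightarrow> i \<in> I \<Longrightarrow> k \<in> I \<Longrightarrow> act_mat act \<one>\<^bsub>\<G>\<^esub> i k = (if k = i then 1 else 0)"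
  by (simp_all add: linear_action_def)

lemma lin_act_iff:
  assumes "linear_action \<G> act I" "g \<in> carrier \<G>" "f \<in> polys I"
  shows "(\<forall>x\<in>cspace I. eval f (act g x) = c * eval f x) \<longleftrightarrow> lin I (act_mat act g) f = Const c * f"
proof -
  have e: "eval (lin I (act_mat act g) f) x = eval f (act g x)" if "x \<in> cspace I" for x
    unfolding eval_lin using assms that by (intro eval_cong[OF assms(3)]) (auto simp: linear_action_def)
  show ?thesis
  proof
    assume A: "\<forall>x\<in>cspace I. eval f (act g x) = c * eval f x"
    show "lin I (act_mat act g) f = Const c * f"
      by (rule eval_eqI[of _ I]) (use A e assms(3) in \<open>auto simp: eval.ins_mult intro: polys_lin polys_mult\<close>)
  next
    assume A: "lin I (act_mat act g) f = Const c * f"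
    show "\<forall>x\<in>cspace I. eval f (act g x) = c * eval f x"
      using e A by (metis eval.ins_Const eval.ins_mult)
  qed
qed

lemma semi_invariant_iff:
  assumes "linear_action \<G> act I"
  shows "semi_invariant \<G> act I \<sigma> f \<longleftrightarrow> f \<in> polys I \<and>
    (\<forall>g\<in>carrier \<G>. lin I (act_mat act (inv\<^bsub>\<G>\<^esub> g)) f = Const (\<sigma> g) * f)"
proof -
  interpret group \<G> using assms by (simp add: linear_action_def)
  show ?thesis unfolding semi_invariant_def using lin_act_iff[OF assms] by (metis inv_closed)
qed

lemma act_mat_dual:
  assumes "finite I" "i \<in> I" "k \<in> I"
  shows "act_mat (dual_act \<G> act I) g i k = act_mat act (inv\<^bsub>\<G>\<^esub> g) k i"
proof -
  have "(\<Sum>j\<in>I. (if j = k then 1 else 0) * act (inv\<^bsub>\<G>\<^esub> g) (\<lambda>j. if j = i then 1 else 0) j)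
    = (\<Sum>j\<in>I. if j = k then act (inv\<^bsub>\<G>\<^esub> g) (\<lambda>j. if j = i then 1 else 0) j else 0)"
    by (rule sum.cong) auto
  then show ?thesis using assms by (simp add: act_mat_def dual_act_def)
qed

lemma linear_action_dual:
  assumes fin: "finite I" and act: "linear_action \<G> act I"
  shows "linear_action \<G> (dual_act \<G> act I) I"
proof -
  interpret group \<G> using act by (simp add: linear_action_def)
  have "dual_act \<G> act I g x \<in> cspace I" for g x
    by (simp add: dual_act_def cspace_def)
  moreover have "dual_act \<G> act I g x i = (\<Sum>k\<in>I. act_mat (dual_act \<G> act I) g i k * x k)" if "i \<in> I" for g x i
    using that by (simp add: act_mat_dual[OF fin]) (simp add: dual_act_def act_mat_def mult.commute)
  moreover have "act_mat (dual_act \<G> act I) \<one>\<^bsub>\<G>\<^esub> i k = (if k = i then 1 else 0)" if "i \<in> I" "k \<in> I" for i k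
    using that act by (auto simp: act_mat_dual[OF fin] linear_action_def)
  moreover have "act_mat (dual_act \<G> act I) (g \<otimes>\<^bsub>\<G>\<^esub> h) i k =
      (\<Sum>j\<in>I. act_mat (dual_act \<G> act I) g i j * act_mat (dual_act \<G> act I) h j k)"
    if "g \<in> carrier \<G>" "h \<in> carrier \<G>" "i \<in> I" "k \<in> I" for g h i k
  proof -
    have "act_mat act (inv\<^bsub>\<G>\<^esub> h \<otimes>\<^bsub>\<G>\<^esub> inv\<^bsub>\<G>\<^esub> g) k i =
      (\<Sum>j\<in>I. act_mat act (inv\<^bsub>\<G>\<^esub> h) k j * act_mat act (inv\<^bsub>\<G>\<^esub> g) j i)"
      using act that unfolding linear_action_def by (simp add: inv_closed)
    then show ?thesis using that by (simp add: act_mat_dual[OF fin] inv_mult_group mult.commute)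
  qed
  ultimately show ?thesis by (simp add: linear_action_def is_group)
qed

text \<open>The weight condition and the dual action each contain an inverse, and the two cancel:
  what remains is a condition on the transposed matrix of g itself, ready for
  \<open>apolar_lin\<close>.\<close>

lemma semi_invariant_dual_iff:
  assumes "finite I" "linear_action \<G> act I"
  shows "semi_invariant \<G> (dual_act \<G> act I) I \<sigma> f \<longleftrightarrow> f \<in> polys I \<and>
    (\<forall>g\<in>carrier \<G>. lin I (\<lambda>i k. act_mat act g k i) f = Const (\<sigma> g) * f)"
proof -
  interpret group \<G> using assms(2) by (simp add: linear_action_def)
  have "lin I (act_mat (dual_act \<G> act I) (inv\<^bsub>\<G>\<^esub> g)) f = lin I (\<lambda>i k. act_mat act g k i) f"
    if "f \<in> polys I" "g \<in> carrier \<G>" for g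
    using that by (intro lin_cong) (simp_all add: act_mat_dual[OF assms(1)])
  then show ?thesis
    unfolding semi_invariant_iff[OF linear_action_dual[OF assms]] by auto
qed

lemma semi_invariant_polys: "semi_invariant \<G> act I \<sigma> f \<Longrightarrow> f \<in> polys I"
  by (simp add: semi_invariant_def)

lemma semi_invariant_mult:
  "semi_invariant \<G> act I \<sigma> f \<Longrightarrow> semi_invariant \<G> act I \<tau> h \<Longrightarrow>
   semi_invariant \<G> act I (\<lambda>g. \<sigma> g * \<tau> g) (f * h)"
  by (simp add: semi_invariant_def polys_mult eval.ins_mult)

lemma semi_invariant_one: "semi_invariant \<G> act I (\<lambda>g. 1) 1"
  by (simp add: semi_invariant_def)

lemma semi_invariant_power:
  "semi_invariant \<G> act I \<sigma> f \<Longrightarrow> semi_invariant \<G> act I (\<lambda>g. \<sigma> g ^ k) (f ^ k)"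
  by (simp add: semi_invariant_def polys_power eval.ins_power power_mult_distrib)

lemma semi_invariant_prod:
  "(\<And>a. a \<in> A \<Longrightarrow> semi_invariant \<G> act I (\<sigma> a) (f a)) \<Longrightarrow>
   semi_invariant \<G> act I (\<lambda>g. \<Prod>a\<in>A. \<sigma> a g) (\<Prod>a\<in>A. f a)"
  by (induction A rule: infinite_finite_induct) (simp_all add: semi_invariant_one semi_invariant_mult)

lemma semi_invariant_Const_mult:
  "semi_invariant \<G> act I \<sigma> f \<Longrightarrow> semi_invariant \<G> act I \<sigma> (Const c * f)"
  by (simp add: semi_invariant_def polys_mult eval.ins_mult)

lemma semi_invariant_diff:
  "semi_invariant \<G> act I \<sigma> f \<Longrightarrow> semi_invariant \<G> act I \<sigma> h \<Longrightarrow> semi_invariant \<G> act I \<sigma> (f - h)"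
  by (simp add: semi_invariant_def polys_diff eval.ins_diff right_diff_distrib)

lemma semi_invariant_cong:
  "(\<And>g. g \<in> carrier \<G> \<Longrightarrow> \<sigma> g = \<tau> g) \<Longrightarrow> semi_invariant \<G> act I \<sigma> f \<longleftrightarrow> semi_invariant \<G> act I \<tau> f"
  by (simp add: semi_invariant_def)

text \<open>Linear substitutions preserve the degree. This opens the way to representations on the
  finite-dimensional spaces of homogeneous polynomials.\<close>

lemma semi_invariant_hcomp:
  assumes "linear_action \<G> act I" "semi_invariant \<G> act I \<sigma> f"
  shows "semi_invariant \<G> act I \<sigma> (hcomp D f)"
  using assms(2) unfolding semi_invariant_iff[OF assms(1)]
  by (simp add: polys_hcomp hcomp_lin[symmetric] hcomp_Const_mult)

text \<open>The weight is just a function on the group. Acting on a non-zero f by g and by its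
  inverse yields this trace of multiplicativity, which makes the weight invertible.\<close>

lemma semi_invariant_weight:
  assumes act: "linear_action \<G> act I" and fin: "finite I" and f: "semi_invariant \<G> act I \<sigma> f" "f \<noteq> 0"
    and g: "g \<in> carrier \<G>"
  shows "\<sigma> g * \<sigma> (inv\<^bsub>\<G>\<^esub> g) = 1"
proof -
  interpret group \<G> using act by (simp add: linear_action_def)
  let ?M = "act_mat act"
  have fp: "f \<in> polys I" using f(1) by (rule semi_invariant_polys)
  have F: "lin I (?M (inv\<^bsub>\<G>\<^esub> h)) f = Const (\<sigma> h) * f" if "h \<in> carrier \<G>" for h
    using f(1) that unfolding semi_invariant_iff[OF act] by blast
  have "Const (\<sigma> g * \<sigma> (inv\<^bsub>\<G>\<^esub> g)) * f = lin I (?M (inv\<^bsub>\<G>\<^esub> g)) (lin I (?M (inv\<^bsub>\<G>\<^esub> (inv\<^bsub>\<G>\<^esub> g))) f)"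
    using g F[OF g] F[of "inv\<^bsub>\<G>\<^esub> g"] by (simp add: lin_simps Const_mult mult_ac)
  also have "\<dots> = lin I (\<lambda>i k. \<Sum>j\<in>I. ?M g i j * ?M (inv\<^bsub>\<G>\<^esub> g) j k) f"
    using g by (simp add: lin_lin[OF fp])
  also have "\<dots> = f"
  proof (rule lin_id[OF fin fp])
    fix i k assume ik: "i \<in> I" "k \<in> I"
    have "(\<Sum>j\<in>I. ?M g i j * ?M (inv\<^bsub>\<G>\<^esub> g) j k) = ?M (g \<otimes>\<^bsub>\<G>\<^esub> inv\<^bsub>\<G>\<^esub> g) i k"
      using act_mat_mult[OF act g inv_closed[OF g] ik] by (rule sym)
    also have "\<dots> = (if k = i then 1 else 0)" using g act_mat_one[OF act ik] by simp
    finally show "(\<Sum>j\<in>I. ?M g i j * ?M (inv\<^bsub>\<G>\<^esub> g) j k) = (if k = i then 1 else 0)" .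
  qed
  finally have "Const (\<sigma> g * \<sigma> (inv\<^bsub>\<G>\<^esub> g)) * f = Const 1 * f" by simp
  from mpoly_mult_cancel[OF f(2) this] show ?thesis unfolding Const_eq_iff .
qed

text \<open>By non-degeneracy it suffices to pair with an arbitrary P1. The transposed substitution
  is multiplicative on the product of P1 and P, and P contributes only its weight.\<close>

lemma semi_invariant_pdiff:
  assumes act: "linear_action \<G> act I" and fin: "finite I"
    and Q: "semi_invariant \<G> act I \<sigma> Q"
    and P: "semi_invariant \<G> (dual_act \<G> act I) I \<tau> P" "P \<noteq> 0"
  shows "semi_invariant \<G> act I (\<lambda>g. \<sigma> g * \<tau> g) (pdiff P Q)"
  unfolding semi_invariant_iff[OF act]
proof (intro conjI ballI)
  interpret group \<G> using act by (simp add: linear_action_def)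
  have Qp: "Q \<in> polys I" and Pp: "P \<in> polys I" using P Q by (auto intro: semi_invariant_polys)
  then show pd: "pdiff P Q \<in> polys I" by (intro polys_pdiff)
  fix g assume g: "g \<in> carrier \<G>"
  let ?M = "act_mat act (inv\<^bsub>\<G>\<^esub> g)"
  have tt: "\<tau> g * \<tau> (inv\<^bsub>\<G>\<^esub> g) = 1"
    by (rule semi_invariant_weight[OF linear_action_dual[OF fin act] fin P g])
  have QM: "lin I ?M Q = Const (\<sigma> g) * Q" using Q g unfolding semi_invariant_iff[OF act] by blast
  have PM: "lin I (\<lambda>i k. ?M k i) P = Const (\<tau> (inv\<^bsub>\<G>\<^esub> g)) * P"
    using P(1) g unfolding semi_invariant_dual_iff[OF fin act] by simp
  show "lin I ?M (pdiff P Q) = Const (\<sigma> g * \<tau> g) * pdiff P Q"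
  proof (rule apolar_nondegenerate[of _ I])
    fix P1 assume P1: "P1 \<in> polys I"
    have "apolar P1 (lin I ?M (pdiff P Q)) = apolar (lin I (\<lambda>i k. ?M k i) P1 * P) Q"
      by (simp add: apolar_lin[OF fin P1 pd, symmetric] apolar_pdiff)
    then have "\<tau> (inv\<^bsub>\<G>\<^esub> g) * apolar P1 (lin I ?M (pdiff P Q)) =
        apolar (lin I (\<lambda>i k. ?M k i) (P1 * P)) Q"
      by (simp add: lin_simps PM mult.left_commute[of _ "Const _"] apolar_Const_mult_left)
    also have "\<dots> = \<sigma> g * apolar P1 (pdiff P Q)"
      using P1 Pp by (simp add: apolar_lin[OF fin _ Qp] polys_mult QM apolar_Const_mult_right apolar_pdiff)
    \<comment> \<open>P enters with its weight at the inverse of g; multiplying by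
      \<open>\<tau> g\<close> removes it.\<close>
    finally have "\<tau> g * \<tau> (inv\<^bsub>\<G>\<^esub> g) * apolar P1 (lin I ?M (pdiff P Q)) = \<tau> g * (\<sigma> g * apolar P1 (pdiff P Q))"
      by (simp add: mult.assoc)
    then show "apolar P1 (lin I ?M (pdiff P Q)) = apolar P1 (Const (\<sigma> g * \<tau> g) * pdiff P Q)"
      unfolding apolar_Const_mult_right by (simp add: tt mult_ac)
  qed (auto intro!: polys_lin polys_mult pd)
qed


section \<open>Multiplicity one\<close>

interpretation mpoly_vs: Vector_Spaces.vector_space "mpoly_scale :: complex \<Rightarrow> 'i mpoly \<Rightarrow> 'i mpoly"
  by (rule vector_space_mpoly_scale)

lemma multiplicity_1_proportional:
  assumes "multiplicity \<G> act I \<sigma> = 1" "semi_invariant \<G> act I \<sigma> a" "a \<noteq> 0" "semi_invariant \<G> act I \<sigma> b"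
  obtains c where "b = Const c * a"
proof -
  let ?S = "{f. semi_invariant \<G> act I \<sigma> f}"
  have d: "mpoly_vs.dim ?S = 1" using assms(1) by (simp add: multiplicity_def)
  \<comment> \<open>\<open>dim\<close> is 0 whenever its choice of a basis fails, and
    \<open>card\<close> is 0 on infinite sets; the value 1 therefore yields a basis with one
    element.\<close>
  then obtain B where B: "\<not> mpoly_vs.dependent B" "mpoly_vs.span B = mpoly_vs.span ?S"
    unfolding mpoly_vs.dim_def by (metis zero_neq_one)
  have "mpoly_vs.dim ?S = card B"
    using mpoly_vs.dim_eq_card[OF B(2) B(1)] .
  then obtain v where "B = {v}" using d by (metis card_1_singletonE)
  then have S: "?S \<subseteq> range (\<lambda>k. mpoly_scale k v)"
    using B(2) mpoly_vs.span_superset[of ?S] by (simp add: mpoly_vs.span_singleton)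
  then have "\<exists>p. a = Const p * v" "\<exists>q. b = Const q * v"
    using assms(2,4) by (auto simp: mpoly_scale_def image_iff subset_iff)
  then obtain p q where pq: "a = Const p * v" "b = Const q * v" by blast
  have "p \<noteq> 0" using pq(1) assms(3) by auto
  then have "b = Const (q / p) * a"
    unfolding pq by (simp add: mult.assoc[symmetric] Const_mult[symmetric])
  then show thesis by (rule that)
qed

lemma multiplicity_1I:
  assumes "semi_invariant \<G> act I \<sigma> a" "a \<noteq> 0"
    and "\<And>b. semi_invariant \<G> act I \<sigma> b \<Longrightarrow> \<exists>c. b = Const c * a"
  shows "multiplicity \<G> act I \<sigma> = 1"
proof -
  let ?S = "{f. semi_invariant \<G> act I \<sigma> f}"
  have "?S = mpoly_vs.span {a}"
    using assms(1,3) by (auto simp: mpoly_vs.span_singleton mpoly_scale_def intro: semi_invariant_Const_mult)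
  moreover have "mpoly_vs.dim (mpoly_vs.span {a}) = card {a}"
    using assms(2) by (intro mpoly_vs.dim_span_eq_card_independent) simp
  ultimately show ?thesis by (simp add: multiplicity_def)
qed


section \<open>Tuples of semi-invariants with multiplicity-free product\<close>

text \<open>The assumptions \<open>pair\<close> and \<open>pair_dual\<close> are what reductivity of the group provides: the apolar
  pairing of semi-invariants of opposite weights is non-degenerate.\<close>

locale semi_inv_tuple =
  fixes \<G> :: "('g, 'z) monoid_scheme" and act :: "'g \<Rightarrow> ('i \<Rightarrow> complex) \<Rightarrow> 'i \<Rightarrow> complex" and I :: "'i set"
    and l :: nat and \<sigma> :: "nat \<Rightarrow> 'g \<Rightarrow> complex" and f :: "nat \<Rightarrow> 'i mpoly"
  assumes fin: "finite I" and act: "linear_action \<G> act I"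
    and semi: "j < l \<Longrightarrow> semi_invariant \<G> act I (\<sigma> j) (f j)" and nonzero: "j < l \<Longrightarrow> f j \<noteq> 0"
    and mf: "multiplicity_free \<G> act I (\<lambda>g. \<Prod>j<l. \<sigma> j g)"
    and pair: "w \<noteq> 0 \<Longrightarrow> homogeneous D w \<Longrightarrow>
      semi_invariant \<G> (dual_act \<G> act I) I (\<lambda>g. inverse (\<Prod>j<l. \<sigma> j g ^ N j)) w \<Longrightarrow>
      \<exists>u. semi_invariant \<G> act I (\<lambda>g. \<Prod>j<l. \<sigma> j g ^ N j) u \<and> homogeneous D u \<and> apolar w u \<noteq> 0"
    and pair_dual: "u \<noteq> 0 \<Longrightarrow> homogeneous D u \<Longrightarrow>
      semi_invariant \<G> act I (\<lambda>g. \<Prod>j<l. \<sigma> j g ^ N j) u \<Longrightarrow>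
      \<exists>w. semi_invariant \<G> (dual_act \<G> act I) I (\<lambda>g. inverse (\<Prod>j<l. \<sigma> j g ^ N j)) w \<and> homogeneous D w \<and> apolar w u \<noteq> 0"
begin

lemma f_polys: "j < l \<Longrightarrow> f j \<in> polys I"
  using semi semi_invariant_polys by blast

lemma prod_power_neq_0: "(\<Prod>j<l. f j ^ N j) \<noteq> 0"
  using nonzero by (intro mpoly_prod_neq_0 mpoly_power_neq_0) auto

lemma semi_prod_power: "semi_invariant \<G> act I (\<lambda>g. \<Prod>j<l. \<sigma> j g ^ N j) (\<Prod>j<l. f j ^ N j)"
  using semi by (intro semi_invariant_prod semi_invariant_power) auto

text \<open>Multiplicity-freeness speaks only of powers of the product of all weights. The factor
  \<open>?R\<close> raises every exponent to the common value k, which brings Q into that situation,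
  and is cancelled afterwards.\<close>

lemma proportional:
  assumes "semi_invariant \<G> act I (\<lambda>g. \<Prod>j<l. \<sigma> j g ^ N j) Q"
  obtains c where "Q = Const c * (\<Prod>j<l. f j ^ N j)"
proof -
  define k where "k = (\<Sum>j<l. N j)"
  have N: "N j \<le> k" if "j < l" for j unfolding k_def using that by (intro member_le_sum) auto
  let ?R = "\<Prod>j<l. f j ^ (k - N j)"
  have m: "multiplicity \<G> act I (\<lambda>g. (\<Prod>j<l. \<sigma> j g) ^ k) = 1"
    using mf by (simp add: multiplicity_free_def)
  have w: "(\<Prod>j<l. \<sigma> j g ^ N j) * (\<Prod>j<l. \<sigma> j g ^ (k - N j)) = (\<Prod>j<l. \<sigma> j g) ^ k" for g
    using N by (auto simp: prod.distrib[symmetric] prod_power_distrib power_add[symmetric] intro!: prod.cong)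
  have f: "(\<Prod>j<l. f j ^ N j) * ?R = (\<Prod>j<l. f j) ^ k"
    using N by (auto simp: prod.distrib[symmetric] prod_power_distrib power_add[symmetric] intro!: prod.cong)
  have "semi_invariant \<G> act I (\<lambda>g. (\<Prod>j<l. \<sigma> j g) ^ k) (Q * ?R)"
    using semi_invariant_mult[OF assms semi_prod_power[of "\<lambda>j. k - N j"]] by (simp add: w)
  moreover have "semi_invariant \<G> act I (\<lambda>g. (\<Prod>j<l. \<sigma> j g) ^ k) ((\<Prod>j<l. f j) ^ k)"
    using semi by (intro semi_invariant_power semi_invariant_prod) auto
  moreover have "(\<Prod>j<l. f j) ^ k \<noteq> 0"
    using nonzero by (intro mpoly_power_neq_0 mpoly_prod_neq_0) auto
  ultimately obtain c where "Q * ?R = Const c * (\<Prod>j<l. f j) ^ k"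
    using multiplicity_1_proportional[OF m] by blast
  then have "Q * ?R = (Const c * (\<Prod>j<l. f j ^ N j)) * ?R" by (simp add: f[symmetric] mult.assoc)
  then have "Q = Const c * (\<Prod>j<l. f j ^ N j)" by (rule mpoly_mult_cancel[OF prod_power_neq_0])
  then show thesis by (rule that)
qed

lemma prod_power_unit: "j < l \<Longrightarrow> (\<Prod>a<l. g a ^ (if a = j then 1 else 0)) = (g j :: 'x::comm_monoid_mult)"
  by (simp add: if_distrib[of "\<lambda>k. _ ^ k"] prod.delta cong: if_cong)

lemma proportional_single:
  assumes "j < l" "semi_invariant \<G> act I (\<sigma> j) Q"
  obtains c where "Q = Const c * f j"
proof -
  have "semi_invariant \<G> act I (\<lambda>g. \<Prod>a<l. \<sigma> a g ^ (if a = j then 1 else 0)) Q"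
    using assms(2) unfolding prod_power_unit[OF assms(1)] .
  from proportional[OF this] show thesis
    unfolding prod_power_unit[OF assms(1)] using that by blast
qed

text \<open>Every component of \<open>f j\<close> is a semi-invariant of the same weight, hence a
  multiple of \<open>f j\<close>; so a non-zero component is all of \<open>f j\<close> up to a
  constant.\<close>

lemma ex_homogeneous:
  assumes "j < l" obtains D where "homogeneous D (f j)"
proof -
  obtain D where D: "hcomp D (f j) \<noteq> 0" using ex_hcomp_neq_0[OF nonzero[OF assms]] .
  obtain c where c: "hcomp D (f j) = Const c * f j"
    using proportional_single[OF assms semi_invariant_hcomp[OF act semi[OF assms]]] .
  have "c \<noteq> 0" using c D by auto
  then have "f j = Const (1 / c) * hcomp D (f j)"
    unfolding c by (simp add: mult.assoc[symmetric] Const_mult[symmetric])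
  then have "homogeneous D (f j)" by (metis homogeneous_Const_mult homogeneous_hcomp)
  then show thesis by (rule that)
qed

lemma ex_dual:
  assumes "j < l" obtains fs where "dual_semi_invariant \<G> act I (\<sigma> j) (f j) fs"
proof -
  obtain D where D: "homogeneous D (f j)" using ex_homogeneous[OF assms] .
  obtain w where w: "semi_invariant \<G> (dual_act \<G> act I) I (\<lambda>g. inverse (\<sigma> j g)) w" "homogeneous D w"
    "apolar w (f j) \<noteq> 0"
    using pair_dual[of "f j" D "\<lambda>a. if a = j then 1 else 0"] nonzero[OF assms] D semi[OF assms]
    unfolding prod_power_unit[OF assms] by blast
  have "w \<noteq> 0" using w(3) by auto
  then have "dual_semi_invariant \<G> act I (\<sigma> j) (f j) w"
    using w D nonzero[OF assms] by (simp add: dual_semi_invariant_def total_degree_homogeneous)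
  then show thesis by (rule that)
qed

lemma pair_any_degree:
  assumes "w \<noteq> 0" "semi_invariant \<G> (dual_act \<G> act I) I (\<lambda>g. inverse (\<Prod>j<l. \<sigma> j g ^ N j)) w"
  obtains u where "semi_invariant \<G> act I (\<lambda>g. \<Prod>j<l. \<sigma> j g ^ N j) u" "apolar w u \<noteq> 0"
proof -
  obtain D where D: "hcomp D w \<noteq> 0" using ex_hcomp_neq_0[OF assms(1)] .
  obtain u where u: "semi_invariant \<G> act I (\<lambda>g. \<Prod>j<l. \<sigma> j g ^ N j) u" "homogeneous D u" "apolar (hcomp D w) u \<noteq> 0"
    using pair[OF D homogeneous_hcomp semi_invariant_hcomp[OF linear_action_dual[OF fin act] assms(2)]]
    by blast
  have "apolar w u \<noteq> 0" using u(3) by (simp add: apolar_hcomp hcomp_homogeneous[OF u(2)])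
  then show thesis using u(1) that by blast
qed

text \<open>Reductivity provides some partner of w of the right weight, and multiplicity one leaves
  only multiples of the product of powers.\<close>

lemma dual_pairing_neq_0:
  assumes "w \<noteq> 0" "semi_invariant \<G> (dual_act \<G> act I) I (\<lambda>g. inverse (\<Prod>j<l. \<sigma> j g ^ N j)) w"
  shows "apolar w (\<Prod>j<l. f j ^ N j) \<noteq> 0"
proof -
  obtain u where u: "semi_invariant \<G> act I (\<lambda>g. \<Prod>j<l. \<sigma> j g ^ N j) u" "apolar w u \<noteq> 0"
    using pair_any_degree[OF assms] .
  obtain c where "u = Const c * (\<Prod>j<l. f j ^ N j)" using proportional[OF u(1)] .
  then show ?thesis using u(2) by (auto simp: apolar_Const_mult_right)
qed

lemma dual_pairing_single_neq_0:
  assumes "j < l" "w \<noteq> 0" "semi_invariant \<G> (dual_act \<G> act I) I (\<lambda>g. inverse (\<sigma> j g)) w"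
  shows "apolar w (f j) \<noteq> 0"
proof -
  have "semi_invariant \<G> (dual_act \<G> act I) I (\<lambda>g. inverse (\<Prod>a<l. \<sigma> a g ^ (if a = j then 1 else 0))) w"
    using assms(3) unfolding prod_power_unit[OF assms(1)] .
  from dual_pairing_neq_0[OF assms(2) this] show ?thesis unfolding prod_power_unit[OF assms(1)] .
qed

text \<open>Uniqueness of the dual: the combination of w and \<open>w'\<close> that pairs to 0 with
  \<open>f j\<close> has the same weight, and would pair non-trivially with \<open>f j\<close> if it
  were not 0.\<close>

lemma dual_proportional:
  assumes j: "j < l" and w: "w \<noteq> 0" "semi_invariant \<G> (dual_act \<G> act I) I (\<lambda>g. inverse (\<sigma> j g)) w"
    and w': "w' \<noteq> 0" "semi_invariant \<G> (dual_act \<G> act I) I (\<lambda>g. inverse (\<sigma> j g)) w'"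
  obtains c where "c \<noteq> 0" "w' = Const c * w"
proof -
  define c where "c = apolar w' (f j) / apolar w (f j)"
  note n = dual_pairing_single_neq_0[OF j w] dual_pairing_single_neq_0[OF j w']
  have "semi_invariant \<G> (dual_act \<G> act I) I (\<lambda>g. inverse (\<sigma> j g)) (w' - Const c * w)"
    by (intro semi_invariant_diff semi_invariant_Const_mult w w')
  moreover have "apolar (w' - Const c * w) (f j) = 0"
    using n by (simp add: c_def apolar_diff_left apolar_Const_mult_left)
  ultimately have "w' - Const c * w = 0" using dual_pairing_single_neq_0[OF j] by blast
  moreover have "c \<noteq> 0" using n by (simp add: c_def)
  ultimately show thesis using that by simp
qed

lemma dual_prod_power:
  assumes "\<And>j. j < l \<Longrightarrow> semi_invariant \<G> (dual_act \<G> act I) I (\<lambda>g. inverse (\<sigma> j g)) (fs j)"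
  shows "semi_invariant \<G> (dual_act \<G> act I) I (\<lambda>g. inverse (\<Prod>j<l. \<sigma> j g ^ N j)) (\<Prod>j<l. fs j ^ N j)"
proof -
  have "semi_invariant \<G> (dual_act \<G> act I) I (\<lambda>g. \<Prod>j<l. inverse (\<sigma> j g) ^ N j) (\<Prod>j<l. fs j ^ N j)"
    using assms by (intro semi_invariant_prod semi_invariant_power) auto
  then show ?thesis by (simp add: prod_inversef[symmetric] power_inverse o_def)
qed

lemma is_b_function_iff:
  "is_b_function \<G> act I l \<sigma> f \<mu> b \<longleftrightarrow> b \<in> polys {..<l} \<and>
    (\<exists>fs. (\<forall>j<l. dual_semi_invariant \<G> act I (\<sigma> j) (f j) (fs j)) \<and> b_equation l (\<Prod>j<l. fs j ^ \<mu> j) f \<mu> b)"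
proof -
  have "(\<forall>s U L. log_branches I l f U L \<longrightarrow>
      (\<forall>x\<in>U. diff_op (\<Prod>j<l. fs j ^ \<mu> j) (multi_power l L (\<lambda>j. s j + of_nat (\<mu> j))) x
        = eval b s * multi_power l L s x)) \<longleftrightarrow> b_equation l (\<Prod>j<l. fs j ^ \<mu> j) f \<mu> b"
    if "\<forall>j<l. dual_semi_invariant \<G> act I (\<sigma> j) (f j) (fs j)" for fs
  proof (rule b_equation_iff)
    show "(\<Prod>j<l. fs j ^ \<mu> j) \<in> polys I"
      using that by (intro polys_prod polys_power)
        (auto simp: dual_semi_invariant_def intro: semi_invariant_polys)
  qed (use f_polys nonzero in auto)
  then show ?thesis unfolding is_b_function_def using semi nonzero by blast
qed

text \<open>Applying the product of duals takes the weight of f^\<mu> off again, so the result is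
  proportional to f^N for every N; \<open>ex_b_equation\<close> turns the constants into a
  polynomial.\<close>

lemma ex_b_function: "\<exists>b. is_b_function \<G> act I l \<sigma> f \<mu> b"
proof -
  have "\<forall>j. \<exists>fs. j < l \<longrightarrow> dual_semi_invariant \<G> act I (\<sigma> j) (f j) fs"
    using ex_dual by blast
  then obtain fs where fs: "\<And>j. j < l \<Longrightarrow> dual_semi_invariant \<G> act I (\<sigma> j) (f j) (fs j)"
    using choice[of "\<lambda>j fs. j < l \<longrightarrow> dual_semi_invariant \<G> act I (\<sigma> j) (f j) fs"] by blast
  then have fs': "semi_invariant \<G> (dual_act \<G> act I) I (\<lambda>g. inverse (\<sigma> j g)) (fs j)" "fs j \<noteq> 0"
    if "j < l" for j using that by (auto simp: dual_semi_invariant_def)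
  let ?P = "\<Prod>j<l. fs j ^ \<mu> j"
  have P: "semi_invariant \<G> (dual_act \<G> act I) I (\<lambda>g. inverse (\<Prod>j<l. \<sigma> j g ^ \<mu> j)) ?P"
    by (rule dual_prod_power) (rule fs'(1))
  have P0: "?P \<noteq> 0" using fs'(2) by (intro mpoly_prod_neq_0 mpoly_power_neq_0) auto
  have ex: "\<exists>c. pdiff ?P (\<Prod>j<l. f j ^ (N j + \<mu> j)) = Const c * (\<Prod>j<l. f j ^ N j)" for N
  proof -
    have nz: "\<sigma> j g \<noteq> 0" if "j < l" "g \<in> carrier \<G>" for j g
      using semi_invariant_weight[OF act fin semi nonzero] that by fastforce
    have "semi_invariant \<G> act I (\<lambda>g. (\<Prod>j<l. \<sigma> j g ^ (N j + \<mu> j)) * inverse (\<Prod>j<l. \<sigma> j g ^ \<mu> j))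
        (pdiff ?P (\<Prod>j<l. f j ^ (N j + \<mu> j)))"
      by (rule semi_invariant_pdiff[OF act fin semi_prod_power P P0])
    also have "?this \<longleftrightarrow> semi_invariant \<G> act I (\<lambda>g. \<Prod>j<l. \<sigma> j g ^ N j) (pdiff ?P (\<Prod>j<l. f j ^ (N j + \<mu> j)))"
      using nz by (intro semi_invariant_cong) (simp add: power_add prod.distrib)
    finally show ?thesis using proportional by blast
  qed
  obtain b where "b \<in> polys {..<l}" "b_equation l ?P f \<mu> b"
    using ex_b_equation[of l f I ?P \<mu>] f_polys nonzero semi_invariant_polys[OF P] ex by blast
  then show ?thesis unfolding is_b_function_iff using fs by blast
qed

end

lemma b_equation_apolar:
  assumes "b_equation l (\<Prod>j<l. fs j ^ \<mu> j) f \<mu> b"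
  shows "apolar (\<Prod>j<l. fs j ^ (N j + \<mu> j)) (\<Prod>j<l. f j ^ (N j + \<mu> j)) =
    eval b (\<lambda>j. of_nat (N j)) * apolar (\<Prod>j<l. fs j ^ N j) (\<Prod>j<l. f j ^ N j)"
  using assms
  by (simp add: b_equation_def power_add prod.distrib[where g = "\<lambda>j. fs j ^ N j"] apolar_pdiff apolar_Const_mult_right)

section \<open>Contraction of doubled variables and the Capelli identity\<close>

text \<open>The linear functional \<open>\<xi>\<^sup>\<alpha> x\<^sup>\<beta> \<mapsto> \<partial>\<^sup>\<alpha> x\<^sup>\<beta>\<close>, where \<open>\<xi>\<close> and \<open>x\<close> are the variables tagged by \<open>Inl\<close> and \<open>Inr\<close>.\<close>

definition contraction :: "('a + 'a) mpoly \<Rightarrow> complex" where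
  "contraction S = (\<Sum>\<alpha>\<in>keys S. lookup S \<alpha> *
     (if Poly_Mapping.map_key Inl \<alpha> = Poly_Mapping.map_key Inr \<alpha> then mfact (Poly_Mapping.map_key Inl \<alpha>) else 0))"

lemma lookup_map_key: "inj g \<Longrightarrow> lookup (Poly_Mapping.map_key g \<alpha>) i = lookup \<alpha> (g i)"
  by (simp add: Poly_Mapping.map_key.rep_eq)

lemma contraction_add: "contraction (S + T) = contraction S + contraction T"
  unfolding contraction_def by (rule setsum_keys_plus_distrib) (auto simp: distrib_right)

lemma contraction_monom: "contraction (mterm \<alpha> c) =
    c * (if Poly_Mapping.map_key Inl \<alpha> = Poly_Mapping.map_key Inr \<alpha> then mfact (Poly_Mapping.map_key Inl \<alpha>) else 0)"
  by (simp add: contraction_def)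

lemma contraction_zero [simp]: "contraction 0 = 0"
  by (simp add: contraction_def)

lemma contraction_Const_mult: "contraction (Const c * S) = c * contraction S"
proof (induction S rule: poly_mapping_single_induct)
  case (single \<alpha> d)
  show ?case by (simp add: Const_mult_monom contraction_monom)
qed (simp add: distrib_left contraction_add)

lemma contraction_sum: "contraction (sum g A) = (\<Sum>a\<in>A. contraction (g a))"
  by (induction A rule: infinite_finite_induct) (simp_all add: contraction_add)

lemma contraction_one: "contraction 1 = 1"
  using contraction_monom[of 0 1] by (simp add: map_key_zero)

lemma contraction_of_int_mult: "contraction (of_int z * S) = of_int z * contraction S"
proof -
  have "of_int z = (Const (of_int z) :: ('a + 'a) mpoly)"
    by (cases z rule: int_diff_cases) (simp add: Const_diff Const_of_nat)
  then show ?thesis by (simp add: contraction_Const_mult)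
qed

lemma contraction_of_nat_mult: "contraction (of_nat k * S) = of_nat k * contraction S"
  using contraction_of_int_mult[of "int k"] by simp

text \<open>Variables \<xi> are removed one at a time at the price of a derivative in x. The Capelli
  computation rests on this rule.\<close>

lemma contraction_Var_Inl: "contraction (Var (Inl i) * S) = contraction (pd (Inr i) S)"
proof (induction S rule: poly_mapping_single_induct)
  case (single \<alpha> c)
  define p where "p = Poly_Mapping.map_key Inl \<alpha>"
  define q where "q = Poly_Mapping.map_key Inr \<alpha>"
  have l: "Poly_Mapping.map_key Inl (unit_exp (Inl i) + \<alpha>) = unit_exp i + p"
    by (simp add: map_key_plus p_def)
  have r: "Poly_Mapping.map_key Inr (unit_exp (Inl i) + \<alpha>) = q"
    by (rule poly_mapping_eqI) (simp add: lookup_map_key lookup_add lookup_single q_def)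
  have l': "Poly_Mapping.map_key Inl (\<alpha> - unit_exp (Inr i)) = p"
    by (rule poly_mapping_eqI) (simp add: lookup_map_key lookup_minus lookup_single p_def)
  have r': "Poly_Mapping.map_key Inr (\<alpha> - unit_exp (Inr i)) = q - unit_exp i"
    by (rule poly_mapping_eqI) (auto simp: lookup_map_key lookup_minus lookup_single q_def when_def)
  have q: "lookup \<alpha> (Inr i) = lookup q i" by (simp add: q_def lookup_map_key)
  have "contraction (Var (Inl i) * mterm \<alpha> c) = c * (if unit_exp i + p = q then mfact q else 0)"
    by (simp add: Var_mult_monom contraction_monom l r)
  also have "\<dots> = of_nat (lookup q i) * c * (if p = q - unit_exp i then mfact p else 0)"
  proof (cases "i \<in> keys q")
    case True
    have "unit_exp i + p = q \<longleftrightarrow> p = q - unit_exp i" using unit_exp_split[OF True] by (metis add_diff_cancel_left')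
    moreover have "mfact q = of_nat (lookup q i) * mfact p" if "unit_exp i + p = q"
      using mfact_unit_exp_add[of i p] unfolding that[symmetric] by (simp add: lookup_add)
    ultimately show ?thesis by simp
  next
    case False
    then have "unit_exp i + p \<noteq> q" by (auto simp: keys_add_exp)
    then show ?thesis using False by (simp add: in_keys_iff)
  qed
  also have "\<dots> = contraction (pd (Inr i) (mterm \<alpha> c))"
    by (simp add: pd_monom contraction_monom l' r' q)
  finally show ?case .
qed (simp add: distrib_left contraction_add pd_add)

lemma doubled_monom:
  fixes \<alpha> \<beta> :: "'a \<Rightarrow>\<^sub>0 nat"
  obtains \<gamma> where "subst (\<lambda>i. Var (Inl i)) (mterm \<alpha> 1) * subst (\<lambda>i. Var (Inr i)) (mterm \<beta> 1) = mterm \<gamma> 1"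
    "Poly_Mapping.map_key Inl \<gamma> = \<alpha>" "Poly_Mapping.map_key Inr \<gamma> = \<beta>"
proof -
  have 1: "\<exists>\<gamma> :: ('a + 'a) \<Rightarrow>\<^sub>0 nat. subst (\<lambda>i. Var (Inr i)) (mterm \<beta> 1) = mterm \<gamma> 1 \<and>
      Poly_Mapping.map_key Inl \<gamma> = 0 \<and> Poly_Mapping.map_key Inr \<gamma> = \<beta>"
  proof (induction \<beta> rule: exponent_induct[OF subset_UNIV, case_names zero unit])
    case zero
    then show ?case by (intro exI[of _ 0]) (simp add: map_key_zero)
  next
    case (unit i \<beta>)
    then obtain \<gamma> :: "('a + 'a) \<Rightarrow>\<^sub>0 nat" where g: "subst (\<lambda>i. Var (Inr i)) (mterm \<beta> 1) = mterm \<gamma> 1"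
      "Poly_Mapping.map_key Inl \<gamma> = 0" "Poly_Mapping.map_key Inr \<gamma> = \<beta>" by blast
    have "Poly_Mapping.map_key Inl (unit_exp (Inr i) + \<gamma>) = 0"
      by (rule poly_mapping_eqI) (use g(2) in \<open>simp add: map_key_plus lookup_add lookup_map_key lookup_single\<close>)
    moreover have "Poly_Mapping.map_key Inr (unit_exp (Inr i) + \<gamma>) = unit_exp i + \<beta>"
      by (simp add: map_key_plus g(3))
    moreover have "subst (\<lambda>i. Var (Inr i)) (mterm (unit_exp i + \<beta>) 1) = mterm (unit_exp (Inr i) + \<gamma>) 1"
      by (simp only: Var_mult_monom[symmetric] subst.ins_mult subst.ins_Var g(1))
    ultimately show ?case by blast
  qed
  have "\<exists>\<gamma>. subst (\<lambda>i. Var (Inl i)) (mterm \<alpha> 1) * subst (\<lambda>i. Var (Inr i)) (mterm \<beta> 1) = mterm \<gamma> 1 \<and>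
      Poly_Mapping.map_key Inl \<gamma> = \<alpha> \<and> Poly_Mapping.map_key Inr \<gamma> = \<beta>"
  proof (induction \<alpha> rule: exponent_induct[OF subset_UNIV, case_names zero unit])
    case zero
    then show ?case using 1 by simp
  next
    case (unit i \<alpha>)
    then obtain \<gamma> :: "('a + 'a) \<Rightarrow>\<^sub>0 nat" where g: "subst (\<lambda>i. Var (Inl i)) (mterm \<alpha> 1) * subst (\<lambda>i. Var (Inr i)) (mterm \<beta> 1) = mterm \<gamma> 1"
      "Poly_Mapping.map_key Inl \<gamma> = \<alpha>" "Poly_Mapping.map_key Inr \<gamma> = \<beta>" by blast
    have "Poly_Mapping.map_key Inr (unit_exp (Inl i) + \<gamma>) = \<beta>"
      by (rule poly_mapping_eqI) (use g(3) in \<open>auto simp: lookup_add lookup_map_key lookup_single\<close>)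
    moreover have "Poly_Mapping.map_key Inl (unit_exp (Inl i) + \<gamma>) = unit_exp i + \<alpha>"
      by (simp add: map_key_plus g(2))
    moreover have "subst (\<lambda>i. Var (Inl i)) (mterm (unit_exp i + \<alpha>) 1) * subst (\<lambda>i. Var (Inr i)) (mterm \<beta> 1)
        = mterm (unit_exp (Inl i) + \<gamma>) 1"
      by (simp only: Var_mult_monom[symmetric] subst.ins_mult subst.ins_Var g(1)[symmetric] mult.assoc)
    ultimately show ?case by blast
  qed
  then show thesis using that by blast
qed

lemma contraction_doubled_monom:
  "contraction (subst (\<lambda>i. Var (Inl i)) (mterm \<alpha> 1) * subst (\<lambda>i. Var (Inr i)) (mterm \<beta> 1))
    = apolar (mterm \<alpha> 1) (mterm \<beta> 1)"
proof -
  obtain \<gamma> where "subst (\<lambda>i. Var (Inl i)) (mterm \<alpha> 1) * subst (\<lambda>i. Var (Inr i)) (mterm \<beta> 1) = mterm \<gamma> 1"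
    "Poly_Mapping.map_key Inl \<gamma> = \<alpha>" "Poly_Mapping.map_key Inr \<gamma> = \<beta>"
    by (rule doubled_monom)
  then show ?thesis by (simp add: contraction_monom apolar_monom lookup_single when_def)
qed

text \<open>Entries and leading minors of \<open>\<Xi> X\<^sup>t\<close>, where \<open>\<Xi>\<close> and \<open>X\<close> are the generic matrices in the variables
  tagged by \<open>Inl\<close> and \<open>Inr\<close>.\<close>

definition gram :: "nat \<Rightarrow> nat \<Rightarrow> nat \<Rightarrow> ((nat \<times> nat) + (nat \<times> nat)) mpoly" where
  "gram n i j = (\<Sum>k<n. Var (Inl (i, k)) * Var (Inr (j, k)))"

definition gram_minor :: "nat \<Rightarrow> nat \<Rightarrow> ((nat \<times> nat) + (nat \<times> nat)) mpoly" where
  "gram_minor n r = (\<Sum>p | p permutes {..<r}. of_int (sign p) * (\<Prod>i<r. gram n i (p i)))"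

text \<open>The polarization operator of classical invariant theory: the derivation that replaces
  row i of X by row j. These operators span the infinitesimal action of the general linear group on
  the rows.\<close>

definition polarize ::
  "nat \<Rightarrow> nat \<Rightarrow> nat \<Rightarrow> ((nat \<times> nat) + (nat \<times> nat)) mpoly \<Rightarrow> ((nat \<times> nat) + (nat \<times> nat)) mpoly" where
  "polarize n j i S = (\<Sum>k<n. Var (Inr (j, k)) * pd (Inr (i, k)) S)"

lemma polarize_sum: "polarize n j i (sum g A) = (\<Sum>a\<in>A. polarize n j i (g a))"
  unfolding polarize_def pd_sum sum_distrib_left by (rule sum.swap)

lemma polarize_mult: "polarize n j i (S * T) = polarize n j i S * T + S * polarize n j i T"
  unfolding polarize_def pd_mult sum_distrib_left sum_distrib_right sum.distrib[symmetric]
  by (rule sum.cong) (simp_all add: distrib_left mult_ac)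

lemma polarize_of_int: "polarize n j i (of_int z) = 0"
proof -
  have "of_int z = (Const (of_int z) :: ((nat \<times> nat) + (nat \<times> nat)) mpoly)"
    by (cases z rule: int_diff_cases) (simp add: Const_diff Const_of_nat)
  then show ?thesis by (simp add: polarize_def)
qed

lemma polarize_one: "polarize n j i 1 = 0"
  by (simp add: polarize_def)

lemma polarize_gram: "polarize n j i (gram n a b) = (if b = i then gram n a j else 0)"
proof -
  have "pd (Inr (i, k)) (gram n a b) = (if b = i then Var (Inl (a, k)) else 0)" if "k < n" for k
  proof -
    have "pd (Inr (i, k)) (gram n a b) = (\<Sum>k'<n. if k' = k then (if b = i then Var (Inl (a, k)) else 0) else 0)"
      unfolding gram_def pd_sum by (rule sum.cong) (auto simp: pd_mult pd_Var)
    then show ?thesis using that by simp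
  qed
  then show ?thesis by (auto simp: polarize_def gram_def mult.commute intro!: sum.cong)
qed

lemma polarize_prod:
  "finite A \<Longrightarrow> polarize n j i (prod g A) = (\<Sum>a\<in>A. polarize n j i (g a) * prod g (A - {a}))"
proof (induction A rule: finite_induct)
  case empty
  then show ?case by (simp add: polarize_one)
next
  case (insert a A)
  have "prod g (insert a A - {b}) = g a * prod g (A - {b})" if "b \<in> A" for b
  proof -
    have "insert a A - {b} = insert a (A - {b})" using insert that by auto
    then show ?thesis using insert by simp
  qed
  then have "(\<Sum>b\<in>A. polarize n j i (g b) * prod g (insert a A - {b})) =
      g a * (\<Sum>b\<in>A. polarize n j i (g b) * prod g (A - {b}))"
    by (simp add: sum_distrib_left mult_ac cong: sum.cong)
  moreover have "insert a A - {a} = A" using insert by auto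
  ultimately show ?case using insert by (simp add: polarize_mult)
qed

text \<open>A derivation hits one factor at a time, and injectivity of c leaves a single factor in
  which row i of X occurs.\<close>

lemma polarize_prod_gram_inj:
  assumes "finite A" "inj_on c A" "a \<in> A" "c a = i"
  shows "polarize n j i (\<Prod>x\<in>A. gram n x (c x)) = (\<Prod>x\<in>A. gram n x (if c x = i then j else c x))"
proof -
  have "polarize n j i (\<Prod>x\<in>A. gram n x (c x)) =
      (\<Sum>y\<in>A. if y = a then gram n a j * (\<Prod>x\<in>A - {a}. gram n x (c x)) else 0)"
    unfolding polarize_prod[OF assms(1)] polarize_gram
    using assms by (intro sum.cong) (auto simp: inj_on_def)
  also have "\<dots> = gram n a j * (\<Prod>x\<in>A - {a}. gram n x (c x))" using assms by simp
  also have "\<dots> = (\<Prod>x\<in>A. gram n x (if c x = i then j else c x))"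
  proof -
    have "(\<Prod>x\<in>A - {a}. gram n x (c x)) = (\<Prod>x\<in>A - {a}. gram n x (if c x = i then j else c x))"
      using assms by (intro prod.cong) (auto simp: inj_on_def)
    then show ?thesis
      using prod.remove[OF assms(1,3), of "\<lambda>x. gram n x (if c x = i then j else c x)"] assms(4) by simp
  qed
  finally show ?thesis .
qed

lemma polarize_prod_gram_absent:
  assumes "finite A" "i \<notin> c ` A"
  shows "polarize n j i (\<Prod>x\<in>A. gram n x (c x)) = 0"
  unfolding polarize_prod[OF assms(1)] polarize_gram using assms(2) by (intro sum.neutral) auto

text \<open>Replacing row i by row j in a determinant changes nothing if i = j and creates two equal
  rows otherwise.\<close>

lemma polarize_gram_minor:
  assumes "i < r" "j < r"
  shows "polarize n j i (gram_minor n r) = (if j = i then gram_minor n r else 0)"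
proof -
  define F where "F p = of_int (sign p) * (\<Prod>x<r. gram n x (if p x = i then j else p x))" for p
  have E: "polarize n j i (gram_minor n r) = (\<Sum>p | p permutes {..<r}. F p)"
    unfolding gram_minor_def polarize_sum
  proof (rule sum.cong[OF refl])
    fix p assume "p \<in> {p. p permutes {..<r}}"
    then have p: "p permutes {..<r}" by simp
    have "\<exists>a\<in>{..<r}. p a = i" using permutes_image[OF p] assms(1) by (metis imageE lessThan_iff)
    then obtain a where a: "a \<in> {..<r}" "p a = i" by blast
    show "polarize n j i (of_int (sign p) * (\<Prod>i<r. gram n i (p i))) = F p"
      unfolding polarize_mult polarize_of_int F_def
      using polarize_prod_gram_inj[OF _ inj_on_subset[OF permutes_inj[OF p]] a] by simp
  qed
  show ?thesis
  proof (cases "j = i")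
    case True
    have "(\<Sum>p | p permutes {..<r}. F p) = gram_minor n r"
      unfolding F_def gram_minor_def using True by (auto intro!: sum.cong prod.cong)
    then show ?thesis using E True by simp
  next
    case False
    \<comment> \<open>Composing with the transposition of i and j flips the sign but not the indices
      after the replacement, so the sum equals its own negative.\<close>
    let ?t = "Transposition.transpose i j"
    have t: "?t permutes {..<r}" using assms by (intro permutes_swap_id) auto
    have "(\<Sum>p | p permutes {..<r}. F p) = (\<Sum>p | p permutes {..<r}. F (?t \<circ> p))"
      by (rule setum_permutations_compose_left[OF t])
    also have "\<dots> = (\<Sum>p | p permutes {..<r}. - F p)"
    proof (rule sum.cong[OF refl])
      fix p assume "p \<in> {p. p permutes {..<r}}"
      then have p: "p permutes {..<r}" by simp
      have "sign (?t \<circ> p) = - sign p"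
        using False permutation_permutes[of p] p
        by (subst sign_compose) (auto simp: permutation_swap_id sign_swap_id intro: permutes_imp_permutation)
      moreover have "(if (?t \<circ> p) x = i then j else (?t \<circ> p) x) = (if p x = i then j else p x)" for x
        using False by (auto simp: Transposition.transpose_def)
      ultimately show "F (?t \<circ> p) = - F p" by (simp only: F_def of_int_minus mult_minus_left)
    qed
    also have "\<dots> = - (\<Sum>p | p permutes {..<r}. F p)" by (rule sum_negf)
    finally have "Const 2 * (\<Sum>p | p permutes {..<r}. F p) = 0"
      by (simp add: eq_neg_iff_add_eq_0 Const_add[of 1 1, simplified] distrib_right)
    then show ?thesis using False by (simp add: E Const_mult_eq_0)
  qed
qed

lemma polarize_gram_minor_power:
  assumes "i < r" "j < r"
  shows "polarize n j i (gram_minor n r ^ a) = (if j = i then of_nat a * gram_minor n r ^ a else 0)"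
  by (induction a) (simp_all add: polarize_one polarize_mult polarize_gram_minor[OF assms] algebra_simps)

text \<open>The variables \<xi> of row r become derivatives in row r of X. Moving them past the
  factors from row b leaves a polarization and, if b = r, one commutator for each of the n columns;
  this is where n comes from.\<close>

lemma contraction_gram_mult:
  "contraction (gram n r b * S) = (if b = r then of_nat n * contraction S else 0) + contraction (polarize n b r S)"
proof -
  have "contraction (gram n r b * S) = (\<Sum>k<n. contraction (pd (Inr (r, k)) (Var (Inr (b, k)) * S)))"
    by (simp add: gram_def sum_distrib_right contraction_sum mult.assoc contraction_Var_Inl)
  also have "\<dots> = (\<Sum>k<n. (if b = r then contraction S else 0) + contraction (Var (Inr (b, k)) * pd (Inr (r, k)) S))"
    by (auto simp: pd_mult pd_Var contraction_add intro!: sum.cong)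
  finally show ?thesis by (simp add: sum.distrib polarize_def contraction_sum)
qed

text \<open>The Capelli recursion. Expand along row r, writing each permutation of r + 1 points as a
  transposition of r and b after a permutation of the first r. The term b = r contributes n + a and
  each of the r terms with b < r contributes -1, whence the factor a + n - r.\<close>

lemma contraction_gram_minor_Suc:
  assumes T: "\<And>j. j \<le> r \<Longrightarrow> polarize n j r T = (if j = r then of_nat a * T else 0)"
  shows "contraction (gram_minor n (Suc r) * T) =
    (of_nat a + of_nat n - of_nat r) * contraction (gram_minor n r * T)"
proof -
  let ?P = "{p. p permutes {..<r}}"
  let ?t = "\<lambda>b. Transposition.transpose r b"
  define W where "W b q = (\<Prod>i<r. gram n i (?t b (q i)))" for b q
  define V where "V q = (\<Prod>i<r. gram n i (q i))" for q
  have kV: "contraction (gram_minor n r * T) = (\<Sum>q\<in>?P. of_int (sign q) * contraction (V q * T))"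
    by (simp add: gram_minor_def sum_distrib_right contraction_sum mult.assoc contraction_of_int_mult V_def)
  \<comment> \<open>For b < r the polarization turns the index r in \<open>W\<close> back into b,
    which restores \<open>V\<close>, and it kills T. For b = r it does not see \<open>V\<close>;
    then n comes from the commutators and a from T.\<close>
  have kW: "contraction (gram n r b * (W b q * T)) =
      (if b = r then (of_nat n + of_nat a) * contraction (V q * T) else contraction (V q * T))"
    if b: "b \<le> r" and q: "q permutes {..<r}" for b q
  proof -
    have qr: "q i \<noteq> r" if "i < r" for i using permutes_in_image[OF q, of i] that by auto
    show ?thesis
    proof (cases "b = r")
      case True
      have W: "W b q = V q" using True by (simp add: W_def V_def)
      have "polarize n r r (V q) = 0" unfolding V_def
        by (rule polarize_prod_gram_absent) (use qr in auto)
      then have "polarize n r r (V q * T) = of_nat a * (V q * T)"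
        using T[of r] by (simp add: polarize_mult mult.left_commute)
      then show ?thesis
        using True W by (simp add: contraction_gram_mult contraction_of_nat_mult distrib_right)
    next
      case False
      then have br: "b < r" using b by simp
      obtain i0 where i0: "i0 \<in> {..<r}" "q i0 = b"
        using permutes_image[OF q] br by (metis imageE lessThan_iff)
      have "polarize n b r (W b q) = (\<Prod>i<r. gram n i (if ?t b (q i) = r then b else ?t b (q i)))"
        unfolding W_def
      proof (rule polarize_prod_gram_inj)
        show "inj_on (\<lambda>i. ?t b (q i)) {..<r}"
        proof (rule inj_onI)
          fix x y assume "?t b (q x) = ?t b (q y)"
          then have "?t b (?t b (q x)) = ?t b (?t b (q y))" by simp
          then have "q x = q y" by simp
          then show "x = y" by (rule injD[OF permutes_inj[OF q]])
        qed
      qed (use i0 in auto)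
      also have "\<dots> = V q" unfolding V_def
        by (rule prod.cong) (use qr br in \<open>auto simp: Transposition.transpose_def\<close>)
      finally show ?thesis using False T[of b] b by (simp add: contraction_gram_mult polarize_mult)
    qed
  qed
  have "gram_minor n (Suc r) * T =
      (\<Sum>b\<in>insert r {..<r}. \<Sum>q\<in>?P. of_int (sign (?t b \<circ> q)) * (gram n r b * (W b q * T)))"
  proof -
    have "(\<Prod>i<Suc r. gram n i ((?t b \<circ> q) i)) = gram n r b * W b q" if "q permutes {..<r}" for b q
      using permutes_not_in[OF that, of r] by (simp add: W_def mult.commute)
    note pr = this
    define G where "G p = of_int (sign p) * (\<Prod>i<Suc r. gram n i (p i))" for p
    have "gram_minor n (Suc r) = (\<Sum>p | p permutes insert r {..<r}. G p)"
      by (simp only: gram_minor_def G_def lessThan_Suc)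
    also have "\<dots> = (\<Sum>b\<in>insert r {..<r}. \<Sum>q\<in>?P. G (?t b \<circ> q))"
      by (rule sum_over_permutations_insert) auto
    finally have "gram_minor n (Suc r) * T = (\<Sum>b\<in>insert r {..<r}. \<Sum>q\<in>?P. G (?t b \<circ> q) * T)"
      by (simp only: sum_distrib_right)
    also have "\<dots> = (\<Sum>b\<in>insert r {..<r}. \<Sum>q\<in>?P. of_int (sign (?t b \<circ> q)) * (gram n r b * (W b q * T)))"
    proof (intro sum.cong refl)
      fix b q assume "q \<in> ?P"
      then show "G (?t b \<circ> q) * T = of_int (sign (?t b \<circ> q)) * (gram n r b * (W b q * T))"
        by (simp only: G_def pr mem_Collect_eq mult.assoc)
    qed
    finally show ?thesis .
  qed
  then have "contraction (gram_minor n (Suc r) * T) =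
      (\<Sum>b\<in>insert r {..<r}. \<Sum>q\<in>?P. of_int (sign (?t b \<circ> q)) * contraction (gram n r b * (W b q * T)))"
    by (simp only: contraction_sum contraction_of_int_mult)
  also have "\<dots> = (\<Sum>b\<in>insert r {..<r}. \<Sum>q\<in>?P. (if b = r then of_nat n + of_nat a else - 1) * (of_int (sign q) * contraction (V q * T)))"
  proof (intro sum.cong refl)
    fix b q assume b: "b \<in> insert r {..<r}" and "q \<in> ?P"
    then have q: "q permutes {..<r}" by simp
    have "sign (?t b \<circ> q) = (if b = r then 1 else - 1) * sign q"
      using permutes_imp_permutation[OF _ q] by (subst sign_compose) (auto simp: permutation_swap_id sign_swap_id)
    then show "of_int (sign (?t b \<circ> q)) * contraction (gram n r b * (W b q * T)) =
        (if b = r then of_nat n + of_nat a else - 1) * (of_int (sign q) * contraction (V q * T))"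
      using b by (auto simp: kW[OF _ q])
  qed
  also have "\<dots> = (\<Sum>b\<in>insert r {..<r}. (if b = r then of_nat n + of_nat a else - 1)) * contraction (gram_minor n r * T)"
    by (simp only: sum_distrib_left[symmetric] kV[symmetric] sum_distrib_right)
  also have "(\<Sum>b\<in>insert r {..<r}. (if b = r then of_nat n + of_nat a else - 1 :: complex)) = of_nat a + of_nat n - of_nat r"
    by (subst sum.insert) (auto simp: sum.delta' intro!: sum.cong)
  finally show ?thesis .
qed

text \<open>One factor of the power is dismantled row by row while the others serve as T with
  eigenvalue a; then the exponent is lowered. The factors a + n - t with t < m become i + a for i =
  n - t.\<close>

lemma contraction_gram_minor_power:
  assumes "m \<le> n"
  shows "contraction (gram_minor n m ^ c) = (\<Prod>i\<in>{n - m + 1..n}. \<Prod>j<c. of_nat (i + j))"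
proof -
  have step: "contraction (gram_minor n m ^ Suc a) = (\<Prod>i\<in>{n - m + 1..n}. of_nat (i + a)) * contraction (gram_minor n m ^ a)" for a
  proof -
    have "contraction (gram_minor n r * gram_minor n m ^ a) =
        (\<Prod>t<r. of_nat a + of_nat n - of_nat t) * contraction (gram_minor n m ^ a)" if "r \<le> m" for r
      using that
    proof (induction r)
      case 0
      have "gram_minor n 0 = 1" by (simp add: gram_minor_def)
      then show ?case by simp
    next
      case (Suc r)
      then show ?case
        by (subst contraction_gram_minor_Suc[of r n _ a]) (simp_all add: polarize_gram_minor_power)
    qed
    from this[of m] have "contraction (gram_minor n m ^ Suc a) =
        (\<Prod>t<m. of_nat a + of_nat n - of_nat t) * contraction (gram_minor n m ^ a)" by simp
    also have "(\<Prod>t<m. of_nat a + of_nat n - of_nat t :: complex) = (\<Prod>i\<in>{n - m + 1..n}. of_nat (i + a))"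
      by (rule prod.reindex_bij_witness[of _ "\<lambda>i. n - i" "\<lambda>t. n - t"]) (use assms in \<open>auto simp: of_nat_diff\<close>)
    finally show ?thesis .
  qed
  show ?thesis
    by (induction c) (simp_all only: step, simp_all add: contraction_one prod.distrib mult.commute)
qed


section \<open>Fibrewise apolar pairings\<close>

definition fibre :: "('a \<Rightarrow> complex) \<Rightarrow> ('a + 'b) mpoly \<Rightarrow> 'b mpoly" where
  "fibre Z = subst (case_sum (\<lambda>a. Const (Z a)) Var)"

lemma eval_fibre: "eval (fibre Z P) y = eval P (case_sum Z y)"
proof -
  have "(\<lambda>i. eval (case_sum (\<lambda>a. Const (Z a)) Var i) y) = case_sum Z y"
    by (auto simp: fun_eq_iff split: sum.split)
  then show ?thesis by (simp add: fibre_def eval_subst)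
qed

lemma fibre_monom: "fibre Z (mterm \<alpha> 1) =
    Const (eval (mterm (Poly_Mapping.map_key Inl \<alpha>) 1) Z) * mterm (Poly_Mapping.map_key Inr \<alpha>) 1"
proof (induction \<alpha> rule: exponent_induct[OF subset_UNIV, case_names zero unit])
  case zero
  then show ?case by (simp add: map_key_zero fibre_def)
next
  case (unit i \<alpha>)
  have *: "fibre Z (mterm (unit_exp i + \<alpha>) 1) = case_sum (\<lambda>a. Const (Z a)) Var i * fibre Z (mterm \<alpha> 1)"
    by (simp add: Var_mult_monom[symmetric] fibre_def subst.ins_mult)
  show ?case
  proof (cases i)
    case (Inl a)
    have "Poly_Mapping.map_key Inr (unit_exp i + \<alpha>) = Poly_Mapping.map_key Inr \<alpha>"
      by (rule poly_mapping_eqI) (simp add: Inl lookup_map_key lookup_add lookup_single)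
    moreover have "Poly_Mapping.map_key Inl (unit_exp i + \<alpha>) = unit_exp a + Poly_Mapping.map_key Inl \<alpha>"
      by (simp add: Inl map_key_plus)
    moreover have "eval (mterm (unit_exp a + \<gamma>) 1) Z = Z a * eval (mterm \<gamma> 1) Z" for \<gamma>
      by (simp only: Var_mult_monom[symmetric] eval.ins_mult eval.ins_Var)
    ultimately show ?thesis
      unfolding * unit(3) by (simp add: Inl Const_mult mult.assoc)
  next
    case (Inr b)
    have "Poly_Mapping.map_key Inl (unit_exp i + \<alpha>) = Poly_Mapping.map_key Inl \<alpha>"
      by (rule poly_mapping_eqI) (simp add: Inr lookup_map_key lookup_add lookup_single)
    moreover have "Poly_Mapping.map_key Inr (unit_exp i + \<alpha>) = unit_exp b + Poly_Mapping.map_key Inr \<alpha>"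
      by (simp add: Inr map_key_plus)
    moreover have "mterm (unit_exp b + \<gamma>) 1 = Var b * mterm \<gamma> 1" for \<gamma>
      by (simp only: Var_mult_monom)
    ultimately show ?thesis
      unfolding * unit(3) by (simp add: Inr mult.left_commute)
  qed
qed

lemma mfact_split: "mfact \<alpha> = mfact (Poly_Mapping.map_key Inl \<alpha>) * mfact (Poly_Mapping.map_key Inr \<alpha>)"
proof (induction \<alpha> rule: exponent_induct[OF subset_UNIV, case_names zero unit])
  case zero
  then show ?case by (simp add: map_key_zero)
next
  case (unit i \<alpha>)
  show ?case
  proof (cases i)
    case (Inl a)
    have "Poly_Mapping.map_key Inr (unit_exp i + \<alpha>) = Poly_Mapping.map_key Inr \<alpha>"
      by (rule poly_mapping_eqI) (simp add: Inl lookup_map_key lookup_add lookup_single)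
    moreover have "Poly_Mapping.map_key Inl (unit_exp i + \<alpha>) = unit_exp a + Poly_Mapping.map_key Inl \<alpha>"
      by (simp add: Inl map_key_plus)
    ultimately show ?thesis
      using unit by (simp add: mfact_unit_exp_add lookup_map_key Inl)
  next
    case (Inr b)
    have "Poly_Mapping.map_key Inl (unit_exp i + \<alpha>) = Poly_Mapping.map_key Inl \<alpha>"
      by (rule poly_mapping_eqI) (simp add: Inr lookup_map_key lookup_add lookup_single)
    moreover have "Poly_Mapping.map_key Inr (unit_exp i + \<alpha>) = unit_exp b + Poly_Mapping.map_key Inr \<alpha>"
      by (simp add: Inr map_key_plus)
    ultimately show ?thesis
      using unit by (simp add: mfact_unit_exp_add lookup_map_key Inr)
  qed
qed

text \<open>This is what allows the variables of F to be contracted before those of the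
  matrices.\<close>

lemma apolar_monom_split: "apolar (mterm \<alpha> 1) (mterm \<beta> 1) =
    apolar (mterm (Poly_Mapping.map_key Inl \<alpha>) 1) (mterm (Poly_Mapping.map_key Inl \<beta>) 1) *
    apolar (mterm (Poly_Mapping.map_key Inr \<alpha>) 1) (mterm (Poly_Mapping.map_key Inr \<beta>) 1)"
proof -
  have "\<alpha> = \<beta> \<longleftrightarrow> Poly_Mapping.map_key Inl \<alpha> = Poly_Mapping.map_key Inl \<beta> \<and>
      Poly_Mapping.map_key Inr \<alpha> = Poly_Mapping.map_key Inr \<beta>"
  proof (intro iffI poly_mapping_eqI)
    fix k assume *: "Poly_Mapping.map_key Inl \<alpha> = Poly_Mapping.map_key Inl \<beta> \<and>
      Poly_Mapping.map_key Inr \<alpha> = Poly_Mapping.map_key Inr \<beta>"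
    show "lookup \<alpha> k = lookup \<beta> k"
    proof (cases k)
      case (Inl a)
      then show ?thesis using arg_cong[OF conjunct1[OF *], of "\<lambda>p. lookup p a"] by (simp add: lookup_map_key)
    next
      case (Inr a)
      then show ?thesis using arg_cong[OF conjunct2[OF *], of "\<lambda>p. lookup p a"] by (simp add: lookup_map_key)
    qed
  qed simp
  then show ?thesis by (auto simp: apolar_monom lookup_single when_def mfact_split[of \<beta>])
qed

lemma apolar_double_sum:
  "apolar (\<Sum>a\<in>A. Const (p a) * g a) (\<Sum>b\<in>B. Const (q b) * h b) =
    (\<Sum>a\<in>A. \<Sum>b\<in>B. p a * q b * apolar (g a) (h b))"
proof -
  have "apolar (Const (p a) * g a) (\<Sum>b\<in>B. Const (q b) * h b) = (\<Sum>b\<in>B. p a * q b * apolar (g a) (h b))" for a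
    unfolding apolar_sum_right apolar_Const_mult_left apolar_Const_mult_right sum_distrib_left
    by (simp add: mult_ac)
  then show ?thesis by (simp only: apolar_sum_left)
qed

lemma apolar_bilinear:
  "apolar P Q = (\<Sum>\<alpha>\<in>keys P. \<Sum>\<beta>\<in>keys Q. lookup P \<alpha> * lookup Q \<beta> * apolar (mterm \<alpha> 1) (mterm \<beta> 1))"
proof -
  have P: "P = (\<Sum>\<alpha>\<in>keys P. Const (lookup P \<alpha>) * mterm \<alpha> 1)" for P :: "'a mpoly"
    using poly_mapping_sum_single[of P] by (simp add: Const_mult_monom)
  show ?thesis
    by (subst P[of P], subst P[of Q]) (rule apolar_double_sum)
qed

lemma fibre_expand: "fibre Z P = (\<Sum>\<alpha>\<in>keys P. Const (lookup P \<alpha>) * fibre Z (mterm \<alpha> 1))"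
proof -
  have P: "P = (\<Sum>\<alpha>\<in>keys P. Const (lookup P \<alpha>) * mterm \<alpha> 1)"
    using poly_mapping_sum_single[of P] by (simp add: Const_mult_monom)
  show ?thesis
    by (subst P) (simp add: fibre_def subst.ins_sum subst.ins_mult)
qed

text \<open>Contracting the remaining variables of \<open>P\<close> and \<open>Q\<close> leaves a polynomial in \<open>\<Xi>\<close> and \<open>X\<close>, which is
  known generically by assumption.\<close>

lemma apolar_of_fibre:
  assumes mn: "m \<le> n" and R: "R \<noteq> 0"
    and fib: "\<And>\<Xi> X. eval R (case_sum \<Xi> X) \<noteq> 0 \<Longrightarrow>
      apolar (fibre \<Xi> P) (fibre X Q) = \<gamma> * eval (gram_minor n m) (case_sum \<Xi> X) ^ c"
  shows "apolar P Q = \<gamma> * (\<Prod>i\<in>{n - m + 1..n}. \<Prod>j<c. of_nat (i + j))"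
proof -
  let ?l = "Poly_Mapping.map_key Inl" and ?r = "Poly_Mapping.map_key Inr"
  \<comment> \<open>The polynomial in \<Xi> and X whose values are the pairings of the fibres,
    written out in monomials: the \<open>Inr\<close> parts of P and Q are paired at once, the
    \<open>Inl\<close> parts are left to \<open>contraction\<close>.\<close>
  define S where "S = (\<Sum>\<alpha>\<in>keys P. \<Sum>\<beta>\<in>keys Q.
    Const (lookup P \<alpha> * lookup Q \<beta> * apolar (mterm (?r \<alpha>) 1) (mterm (?r \<beta>) 1)) *
    (subst (\<lambda>i. Var (Inl i)) (mterm (?l \<alpha>) 1) * subst (\<lambda>i. Var (Inr i)) (mterm (?l \<beta>) 1)))"
  have "contraction S = apolar P Q"
    unfolding S_def contraction_sum contraction_Const_mult contraction_doubled_monom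
    by (subst apolar_bilinear) (simp add: apolar_monom_split[of _ "_ :: _ \<Rightarrow>\<^sub>0 nat"] mult_ac)
  moreover have "S = Const \<gamma> * gram_minor n m ^ c"
  proof (rule eval_eqI_generic[of _ UNIV _ R])
    fix z assume z: "eval R z \<noteq> 0"
    define \<Xi> X where "\<Xi> = (\<lambda>i. z (Inl i))" and "X = (\<lambda>i. z (Inr i))"
    have zz: "z = case_sum \<Xi> X" by (auto simp: \<Xi>_def X_def fun_eq_iff split: sum.split)
    have "eval S z = apolar (fibre \<Xi> P) (fibre X Q)"
      unfolding S_def zz fibre_expand[of \<Xi> P] fibre_expand[of X Q] fibre_monom apolar_double_sum
        apolar_Const_mult_left apolar_Const_mult_right
      by (simp add: eval.ins_sum eval.ins_mult eval_subst mult_ac)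
    also have "\<dots> = eval (Const \<gamma> * gram_minor n m ^ c) z"
      using fib[of \<Xi> X] z by (simp add: zz eval.ins_mult eval.ins_power)
    finally show "eval S z = eval (Const \<gamma> * gram_minor n m ^ c) z" .
  qed (use R in auto)
  ultimately show ?thesis by (simp add: contraction_Const_mult contraction_gram_minor_power[OF mn])
qed

section \<open>General linear groups and regular functions\<close>

abbreviation mdet :: "complex mat \<Rightarrow> complex" where "mdet \<equiv> Determinant.det"

lemma GL_carrier_iff: "A \<in> carrier (GL n) \<longleftrightarrow> A \<in> carrier_mat n n \<and> mdet A \<noteq> 0"
proof -
  have "A \<in> Units (ring_mat TYPE(complex) n ()) \<Longrightarrow> A \<in> carrier_mat n n"
    by (simp add: Units_def ring_mat_def)
  then show ?thesis
    unfolding GL_def units_of_def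
    using unit_imp_det_non_zero[of A n "()"] det_non_zero_imp_unit[of A n "()"] by auto
qed

lemma GL_mult [simp]: "A \<otimes>\<^bsub>GL n\<^esub> B = A * B"
  by (simp add: GL_def units_of_def ring_mat_def)

lemma GL_one [simp]: "\<one>\<^bsub>GL n\<^esub> = 1\<^sub>m n"
  by (simp add: GL_def units_of_def ring_mat_def)

lemma group_GL: "group (GL n)"
proof -
  interpret ring "ring_mat TYPE(complex) n ()" by (rule ring_mat)
  show ?thesis unfolding GL_def by (rule units_group)
qed

text \<open>Cramer's rule, in the form that exhibits the entries of the inverse as regular
  functions.\<close>

lemma GL_inv_adj:
  assumes "A \<in> carrier (GL n)"
  shows "inv\<^bsub>GL n\<^esub> A = inverse (mdet A) \<cdot>\<^sub>m adj_mat A"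
proof -
  interpret group "GL n" by (rule group_GL)
  have A: "A \<in> carrier_mat n n" "mdet A \<noteq> 0" using assms by (simp_all add: GL_carrier_iff)
  let ?B = "inverse (mdet A) \<cdot>\<^sub>m adj_mat A"
  have B: "?B \<in> carrier_mat n n" using adj_mat(1)[OF A(1)] by simp
  have BA: "?B * A = 1\<^sub>m n"
  proof -
    have "?B * A = inverse (mdet A) \<cdot>\<^sub>m (adj_mat A * A)"
      by (rule mult_smult_assoc_mat[OF adj_mat(1)[OF A(1)] A(1)])
    also have "\<dots> = 1\<^sub>m n"
      unfolding adj_mat(3)[OF A(1)] using A(2) by (intro eq_matI) auto
    finally show ?thesis .
  qed
  have "mdet ?B * mdet A = 1" using det_mult[OF B A(1)] by (simp add: BA)
  then have "mdet ?B \<noteq> 0" by auto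
  then have "?B \<in> carrier (GL n)" using B by (simp add: GL_carrier_iff)
  then show ?thesis using BA assms by (intro inv_equality) simp_all
qed

lemma GL_inv:
  assumes "A \<in> carrier (GL n)"
  shows "inv\<^bsub>GL n\<^esub> A \<in> carrier (GL n)" "A * inv\<^bsub>GL n\<^esub> A = 1\<^sub>m n" "inv\<^bsub>GL n\<^esub> A * A = 1\<^sub>m n"
    "mdet (inv\<^bsub>GL n\<^esub> A) = inverse (mdet A)"
proof -
  interpret group "GL n" by (rule group_GL)
  show 1: "inv\<^bsub>GL n\<^esub> A \<in> carrier (GL n)" using assms by simp
  show 2: "A * inv\<^bsub>GL n\<^esub> A = 1\<^sub>m n" using r_inv[OF assms] by simp
  show "inv\<^bsub>GL n\<^esub> A * A = 1\<^sub>m n" using l_inv[OF assms] by simp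
  have "mdet A * mdet (inv\<^bsub>GL n\<^esub> A) = 1"
    using det_mult[of A n "inv\<^bsub>GL n\<^esub> A"] 1 assms 2 by (simp add: GL_carrier_iff)
  then show "mdet (inv\<^bsub>GL n\<^esub> A) = inverse (mdet A)" by (metis inverse_unique)
qed

section \<open>Regular functions on matrix groups\<close>

definition reg :: "('g \<Rightarrow> complex) set \<Rightarrow> 'g set \<Rightarrow> ('g \<Rightarrow> complex) \<Rightarrow> bool" where
  "reg C S F \<longleftrightarrow> (\<exists>\<phi>\<in>gen_algebra C. \<forall>x\<in>S. F x = \<phi> x)"

lemma reg_const: "reg C S (\<lambda>_. c)"
  unfolding reg_def by (rule bexI[OF _ gen_algebra.const[of c]]) simp

lemma reg_gen: "\<phi> \<in> C \<Longrightarrow> reg C S \<phi>"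
  unfolding reg_def by (intro bexI[OF _ gen_algebra.gen]) simp_all

lemma reg_add:
  assumes "reg C S F" "reg C S G" shows "reg C S (\<lambda>x. F x + G x)"
proof -
  obtain \<phi> \<psi> where *: "\<phi> \<in> gen_algebra C" "\<psi> \<in> gen_algebra C" "\<forall>x\<in>S. F x = \<phi> x" "\<forall>x\<in>S. G x = \<psi> x"
    using assms by (auto simp: reg_def)
  show ?thesis unfolding reg_def by (rule bexI[OF _ gen_algebra.add[OF *(1,2)]]) (use * in auto)
qed

lemma reg_mult:
  assumes "reg C S F" "reg C S G" shows "reg C S (\<lambda>x. F x * G x)"
proof -
  obtain \<phi> \<psi> where *: "\<phi> \<in> gen_algebra C" "\<psi> \<in> gen_algebra C" "\<forall>x\<in>S. F x = \<phi> x" "\<forall>x\<in>S. G x = \<psi> x"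
    using assms by (auto simp: reg_def)
  show ?thesis unfolding reg_def by (rule bexI[OF _ gen_algebra.mult[OF *(1,2)]]) (use * in auto)
qed

lemma reg_sum: "(\<And>a. a \<in> A \<Longrightarrow> reg C S (F a)) \<Longrightarrow> reg C S (\<lambda>x. \<Sum>a\<in>A. F a x)"
  by (induction A rule: infinite_finite_induct) (simp_all add: reg_const reg_add)

lemma reg_prod: "(\<And>a. a \<in> A \<Longrightarrow> reg C S (F a)) \<Longrightarrow> reg C S (\<lambda>x. \<Prod>a\<in>A. F a x)"
  by (induction A rule: infinite_finite_induct) (simp_all add: reg_const reg_mult)

lemma reg_cong: "(\<And>x. x \<in> S \<Longrightarrow> F x = G x) \<Longrightarrow> reg C S F \<longleftrightarrow> reg C S G"
  by (simp add: reg_def)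

lemma reg_entry: "i < n \<Longrightarrow> j < n \<Longrightarrow> reg (GL_coords n) S (\<lambda>A. A $$ (i, j))"
  by (rule reg_gen) (auto simp: GL_coords_def)

lemma reg_inverse_det: "reg (GL_coords n) S (\<lambda>A. inverse (mdet A))"
  by (rule reg_gen) (auto simp: GL_coords_def)

lemma reg_det_of:
  assumes "\<And>i j. i < k \<Longrightarrow> j < k \<Longrightarrow> reg C S (\<lambda>x. B x $$ (i, j))" "\<And>x. x \<in> S \<Longrightarrow> B x \<in> carrier_mat k k"
  shows "reg C S (\<lambda>x. mdet (B x))"
proof -
  have "reg C S (\<lambda>x. \<Sum>p | p permutes {0..<k}. signof p * (\<Prod>i = 0..<k. B x $$ (i, p i)))"
    by (intro reg_sum reg_mult reg_const reg_prod assms(1)) (auto dest: permutes_in_image)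
  then show ?thesis using assms(2) by (subst reg_cong[OF det_def']) auto
qed

lemma reg_det: "S \<subseteq> carrier (GL n) \<Longrightarrow> reg (GL_coords n) S mdet"
  by (rule reg_det_of[of n _ _ "\<lambda>A. A"]) (auto simp: reg_entry GL_carrier_iff subset_iff)

lemma reg_inv_entry:
  assumes "S \<subseteq> carrier (GL n)" "i < n" "j < n"
  shows "reg (GL_coords n) S (\<lambda>A. (inv\<^bsub>GL n\<^esub> A) $$ (i, j))"
proof -
  have dims: "dim_row A = n" "dim_col A = n" if "A \<in> S" for A
    using that assms(1) by (auto simp: subset_iff GL_carrier_iff)
  have "reg (GL_coords n) S (\<lambda>A. mdet (mat_delete A j i))"
  proof (rule reg_det_of[of "n - 1"])
    fix i' j' assume ij: "i' < n - 1" "j' < n - 1"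
    have "reg (GL_coords n) S (\<lambda>A. A $$ (if i' < j then i' else Suc i', if j' < i then j' else Suc j'))"
      using ij by (intro reg_entry) auto
    then show "reg (GL_coords n) S (\<lambda>A. mat_delete A j i $$ (i', j'))"
      by (rule reg_cong[THEN iffD2, rotated]) (use ij in \<open>auto simp: mat_delete_def dims\<close>)
  next
    fix A assume "A \<in> S"
    then show "mat_delete A j i \<in> carrier_mat (n - 1) (n - 1)"
      using dims[of A] by (intro carrier_matI) simp_all
  qed
  then have r: "reg (GL_coords n) S (\<lambda>A. inverse (mdet A) * ((-1) ^ (j + i) * mdet (mat_delete A j i)))"
    by (rule reg_mult[OF reg_inverse_det reg_mult[OF reg_const]])
  have e: "(inv\<^bsub>GL n\<^esub> A) $$ (i, j) = inverse (mdet A) * ((-1) ^ (j + i) * mdet (mat_delete A j i))"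
    if "A \<in> S" for A
  proof -
    have A: "A \<in> carrier (GL n)" using that assms(1) by blast
    show ?thesis using assms(2,3) dims[OF that] by (simp add: GL_inv_adj[OF A] adj_mat_def cofactor_def)
  qed
  show ?thesis using r by (subst reg_cong[OF e])
qed

text \<open>A pull-back respects sums and products, so generators are all that has to be
  checked.\<close>

lemma reg_comp:
  assumes "reg C' S' F" "\<And>x. x \<in> S \<Longrightarrow> g x \<in> S'" "\<And>\<phi>. \<phi> \<in> C' \<Longrightarrow> reg C S (\<lambda>x. \<phi> (g x))"
  shows "reg C S (\<lambda>x. F (g x))"
proof -
  obtain \<phi> where \<phi>: "\<phi> \<in> gen_algebra C'" "\<And>x. x \<in> S' \<Longrightarrow> F x = \<phi> x" using assms(1) by (auto simp: reg_def)
  from \<phi>(1) have "reg C S (\<lambda>x. \<phi> (g x))"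
    by induction (auto intro: reg_const reg_add reg_mult assms(3))
  then show ?thesis by (rule reg_cong[THEN iffD2, rotated]) (simp add: \<phi>(2) assms(2))
qed

lemma reg_inv:
  assumes "reg (GL_coords n) S F" "S \<subseteq> carrier (GL n)" "\<And>A. A \<in> S \<Longrightarrow> inv\<^bsub>GL n\<^esub> A \<in> S"
  shows "reg (GL_coords n) S (\<lambda>A. F (inv\<^bsub>GL n\<^esub> A))"
proof (rule reg_comp[OF assms(1) assms(3)])
  fix \<phi> assume "\<phi> \<in> GL_coords n"
  then consider i j where "i < n" "j < n" "\<phi> = (\<lambda>A. A $$ (i, j))" | "\<phi> = (\<lambda>A. inverse (mdet A))"
    by (auto simp: GL_coords_def)
  then show "reg (GL_coords n) S (\<lambda>A. \<phi> (inv\<^bsub>GL n\<^esub> A))"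
  proof cases
    case 1
    then show ?thesis using reg_inv_entry[OF assms(2)] by simp
  next
    case 2
    show ?thesis using reg_det[OF assms(2)]
      by (rule reg_cong[THEN iffD2, rotated]) (use assms(2) in \<open>auto simp: 2 GL_inv(4) subset_iff\<close>)
  qed
qed

section \<open>Regular functions on GL as polynomials in the matrix entries\<close>

definition ent :: "nat \<Rightarrow> complex mat \<Rightarrow> nat \<times> nat \<Rightarrow> complex" where
  "ent n A = (\<lambda>(i, j). if i < n \<and> j < n then A $$ (i, j) else 0)"

definition det_poly :: "nat \<Rightarrow> (nat \<times> nat) mpoly" where
  "det_poly n = (\<Sum>p | p permutes {0..<n}. of_int (sign p) * (\<Prod>i=0..<n. Var (i, p i)))"

lemma of_int_eq_Const: "(of_int z :: 'i mpoly) = Const (of_int z)"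
  by (cases z rule: int_diff_cases) (simp add: Const_diff Const_of_nat)

lemma eval_det_poly: "eval (det_poly n) x = mdet (mat n n x)"
proof -
  have "mdet (mat n n x) = (\<Sum>p | p permutes {0..<n}. signof p * (\<Prod>i=0..<n. x (i, p i)))"
    by (subst det_def'[of _ n]) (auto intro!: sum.cong prod.cong dest: permutes_in_image)
  then show ?thesis
    by (simp add: det_poly_def eval.ins_simps of_int_eq_Const)
qed

lemma polys_det_poly: "det_poly n \<in> polys ({..<n} \<times> {..<n})"
  unfolding det_poly_def of_int_eq_Const
  by (intro polys_intros) (auto dest: permutes_in_image)

lemma mat_ent: "A \<in> carrier_mat n n \<Longrightarrow> mat n n (ent n A) = A"
  by (rule eq_matI) (auto simp: ent_def)

lemma ent_mat: "x \<in> cspace ({..<n} \<times> {..<n}) \<Longrightarrow> ent n (mat n n x) = x"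
  by (auto simp: ent_def cspace_def fun_eq_iff)

lemma eval_det_poly_ent: "A \<in> carrier_mat n n \<Longrightarrow> eval (det_poly n) (ent n A) = mdet A"
  by (simp add: eval_det_poly mat_ent)

lemma det_poly_neq_0: "det_poly n \<noteq> 0"
proof
  assume "det_poly n = 0"
  then have "eval (det_poly n) (ent n (1\<^sub>m n)) = 0" by simp
  then show False by (simp add: eval_det_poly_ent)
qed

lemma GL_poly_eqI:
  assumes "P \<in> polys ({..<n} \<times> {..<n})" "Q \<in> polys ({..<n} \<times> {..<n})"
    and "\<And>A. A \<in> carrier (GL n) \<Longrightarrow> eval P (ent n A) = eval Q (ent n A)"
  shows "P = Q"
proof (rule eval_eqI_generic[OF assms(1,2) polys_det_poly det_poly_neq_0])
  fix x assume x: "x \<in> cspace ({..<n} \<times> {..<n})" "eval (det_poly n) x \<noteq> 0"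
  then have "mat n n x \<in> carrier (GL n)" by (simp add: GL_carrier_iff eval_det_poly)
  from assms(3)[OF this] show "eval P x = eval Q x" by (simp add: ent_mat[OF x(1)])
qed

text \<open>The only denominators are powers of the determinant. Once they are cleared, the apolar
  pairing becomes applicable to functions on the group.\<close>

lemma reg_GL_poly:
  assumes "reg (GL_coords n) (carrier (GL n)) F"
  shows "\<exists>p r. p \<in> polys ({..<n} \<times> {..<n}) \<and> (\<forall>A\<in>carrier (GL n). F A * mdet A ^ r = eval p (ent n A))"
proof -
  let ?J = "{..<n} \<times> {..<n}"
  obtain \<phi> where \<phi>: "\<phi> \<in> gen_algebra (GL_coords n)" "\<And>A. A \<in> carrier (GL n) \<Longrightarrow> F A = \<phi> A"
    using assms by (auto simp: reg_def)
  have D: "eval (det_poly n) (ent n A) = mdet A" if "A \<in> carrier (GL n)" for A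
    using that by (simp add: eval_det_poly_ent GL_carrier_iff)
  from \<phi>(1) have "\<exists>p r. p \<in> polys ?J \<and> (\<forall>A\<in>carrier (GL n). \<phi> A * mdet A ^ r = eval p (ent n A))"
  proof induction
    case (const c)
    show ?case by (intro exI[of _ "Const c"] exI[of _ 0]) simp
  next
    case (gen \<phi>)
    then consider i j where "i < n" "j < n" "\<phi> = (\<lambda>A. A $$ (i, j))" | "\<phi> = (\<lambda>A. inverse (mdet A))"
      by (auto simp: GL_coords_def)
    then show ?case
    proof cases
      case 1
      then show ?thesis
        by (intro exI[of _ "Var (i, j)"] exI[of _ 0]) (simp add: polys_Var ent_def)
    next
      case 2
      then show ?thesis
        by (intro exI[of _ 1] exI[of _ 1]) (simp add: GL_carrier_iff)
    qed
  next
    case (add \<phi> \<psi>)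
    then obtain p r p' r' where *: "p \<in> polys ?J" "\<And>A. A\<in>carrier (GL n) \<Longrightarrow> \<phi> A * mdet A ^ r = eval p (ent n A)"
      "p' \<in> polys ?J" "\<And>A. A\<in>carrier (GL n) \<Longrightarrow> \<psi> A * mdet A ^ r' = eval p' (ent n A)" by blast
    have "(\<phi> A + \<psi> A) * mdet A ^ (r + r') = eval (p * det_poly n ^ r' + p' * det_poly n ^ r) (ent n A)"
      if A: "A \<in> carrier (GL n)" for A
    proof -
      have "(\<phi> A + \<psi> A) * mdet A ^ (r + r') = (\<phi> A * mdet A ^ r) * mdet A ^ r' + (\<psi> A * mdet A ^ r') * mdet A ^ r"
        by (simp add: power_add algebra_simps)
      then show ?thesis unfolding *(2)[OF A] *(4)[OF A] by (simp add: eval.ins_simps D[OF A])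
    qed
    then show ?case using *(1,3)
      by (intro exI[of _ "p * det_poly n ^ r' + p' * det_poly n ^ r"] exI[of _ "r + r'"])
        (simp add: polys_intros polys_det_poly)
  next
    case (mult \<phi> \<psi>)
    then obtain p r p' r' where *: "p \<in> polys ?J" "\<And>A. A\<in>carrier (GL n) \<Longrightarrow> \<phi> A * mdet A ^ r = eval p (ent n A)"
      "p' \<in> polys ?J" "\<And>A. A\<in>carrier (GL n) \<Longrightarrow> \<psi> A * mdet A ^ r' = eval p' (ent n A)" by blast
    have "(\<phi> A * \<psi> A) * mdet A ^ (r + r') = eval (p * p') (ent n A)" if A: "A \<in> carrier (GL n)" for A
    proof -
      have "(\<phi> A * \<psi> A) * mdet A ^ (r + r') = (\<phi> A * mdet A ^ r) * (\<psi> A * mdet A ^ r')"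
        by (simp add: power_add algebra_simps)
      then show ?thesis unfolding *(2)[OF A] *(4)[OF A] by (simp add: eval.ins_simps)
    qed
    then show ?case using *(1,3)
      by (intro exI[of _ "p * p'"] exI[of _ "r + r'"]) (simp add: polys_intros)
  qed
  then show ?thesis using \<phi>(2) by simp
qed


section \<open>Averaging over general linear groups\<close>

definition real_coeffs :: "'i mpoly \<Rightarrow> bool" where
  "real_coeffs P \<longleftrightarrow> (\<forall>\<alpha>. lookup P \<alpha> \<in> \<real>)"

lemma real_coeffs_add: "real_coeffs P \<Longrightarrow> real_coeffs Q \<Longrightarrow> real_coeffs (P + Q)"
  by (simp add: real_coeffs_def lookup_add)

lemma real_coeffs_Const: "c \<in> \<real> \<Longrightarrow> real_coeffs (Const c)"
  by (simp add: real_coeffs_def Const_def lookup_single when_def)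

lemma real_coeffs_Var: "real_coeffs (Var i)"
  by (simp add: real_coeffs_def Var_def lookup_single when_def)

lemma real_coeffs_zero: "real_coeffs 0" and real_coeffs_one: "real_coeffs 1"
  using real_coeffs_Const[of 0] real_coeffs_Const[of 1] by simp_all

lemma real_coeffs_sum: "(\<And>a. a \<in> A \<Longrightarrow> real_coeffs (g a)) \<Longrightarrow> real_coeffs (sum g A)"
  by (induction A rule: infinite_finite_induct) (simp_all add: real_coeffs_add real_coeffs_zero)

lemma real_coeffs_mult:
  assumes "real_coeffs P" "real_coeffs Q" shows "real_coeffs (P * Q)"
proof -
  have "P * Q = (\<Sum>\<alpha>\<in>keys P. mterm \<alpha> (lookup P \<alpha>)) * (\<Sum>\<beta>\<in>keys Q. mterm \<beta> (lookup Q \<beta>))"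
    using poly_mapping_sum_single[of P] poly_mapping_sum_single[of Q] by simp
  also have "\<dots> = (\<Sum>\<alpha>\<in>keys P. \<Sum>\<beta>\<in>keys Q. mterm (\<alpha> + \<beta>) (lookup P \<alpha> * lookup Q \<beta>))"
    by (simp add: sum_product mult_single)
  also have "real_coeffs \<dots>"
    using assms by (intro real_coeffs_sum) (simp add: real_coeffs_def lookup_single when_def)
  finally show ?thesis .
qed

lemma real_coeffs_prod: "(\<And>a. a \<in> A \<Longrightarrow> real_coeffs (g a)) \<Longrightarrow> real_coeffs (prod g A)"
  by (induction A rule: infinite_finite_induct) (simp_all add: real_coeffs_mult real_coeffs_one)

lemma real_coeffs_power: "real_coeffs P \<Longrightarrow> real_coeffs (P ^ k)"
  by (induction k) (simp_all add: real_coeffs_mult real_coeffs_one)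

lemma real_coeffs_det_poly: "real_coeffs (det_poly n)"
  unfolding det_poly_def of_int_eq_Const
  by (intro real_coeffs_sum real_coeffs_mult real_coeffs_prod real_coeffs_Const real_coeffs_Var) simp

text \<open>With real coefficients all terms of the self-pairing are positive, whereas a complex
  polynomial may be isotropic, the pairing being bilinear and not Hermitian.\<close>

lemma apolar_self_neq_0:
  assumes "real_coeffs P" "P \<noteq> 0" shows "apolar P P \<noteq> 0"
proof -
  have "0 < Re (mfact \<alpha> * lookup P \<alpha> * lookup P \<alpha>)" if "\<alpha> \<in> keys P" for \<alpha>
  proof -
    have "lookup P \<alpha> \<in> \<real>" using assms(1) by (simp add: real_coeffs_def)
    then obtain c where c: "lookup P \<alpha> = of_real c" by (auto elim: Reals_cases)
    then have "c \<noteq> 0" using that by (auto simp: in_keys_iff)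
    moreover have "mfact \<alpha> = of_real (\<Prod>i\<in>keys \<alpha>. fact (lookup \<alpha> i))" by (simp add: mfact_def)
    moreover have "0 < (\<Prod>i\<in>keys \<alpha>. fact (lookup \<alpha> i) :: real)" by (intro prod_pos) simp
    moreover have "0 < c\<^sup>2" using calculation by simp
    ultimately have "mfact \<alpha> * lookup P \<alpha> * lookup P \<alpha> = of_real ((\<Prod>i\<in>keys \<alpha>. fact (lookup \<alpha> i)) * c\<^sup>2)"
      "0 < (\<Prod>i\<in>keys \<alpha>. fact (lookup \<alpha> i)) * c\<^sup>2"
      by (simp add: c power2_eq_square, intro mult_pos_pos)
    then show ?thesis by (simp only: Re_complex_of_real)
  qed
  moreover have "keys P \<noteq> {}" using assms(2) by simp
  ultimately have "0 < (\<Sum>\<alpha>\<in>keys P. Re (mfact \<alpha> * lookup P \<alpha> * lookup P \<alpha>))"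
    by (intro sum_pos) simp_all
  then have "0 < Re (apolar P P)" by (simp add: apolar_def)
  then show ?thesis by auto
qed

text \<open>The matrix of the map taking A to h A, in the coordinates given by the entries of
  A.\<close>

definition left_mult :: "complex mat \<Rightarrow> nat \<times> nat \<Rightarrow> nat \<times> nat \<Rightarrow> complex" where
  "left_mult h = (\<lambda>(i, j) (k, l). if l = j then h $$ (i, k) else 0)"

lemma left_mult_apply:
  assumes "h \<in> carrier_mat n n" "i < n" "j < n"
  shows "(\<Sum>c\<in>{..<n} \<times> {..<n}. left_mult h (i, j) c * x c) = (h * mat n n x) $$ (i, j)"
proof -
  have "(\<Sum>c\<in>{..<n} \<times> {..<n}. left_mult h (i, j) c * x c) = (\<Sum>k<n. \<Sum>l<n. left_mult h (i, j) (k, l) * x (k, l))"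
    by (simp add: sum.cartesian_product)
  also have "\<dots> = (\<Sum>k<n. h $$ (i, k) * x (k, j))"
    using assms by (intro sum.cong refl) (simp add: left_mult_def if_distrib[of "\<lambda>u. u * _"] cong: if_cong)
  also have "\<dots> = (h * mat n n x) $$ (i, j)"
    using assms by (simp add: scalar_prod_def atLeast0LessThan)
  finally show ?thesis .
qed

lemma eval_lin_left_mult:
  assumes "p \<in> polys ({..<n} \<times> {..<n})" "h \<in> carrier_mat n n" "A \<in> carrier_mat n n"
  shows "eval (lin ({..<n} \<times> {..<n}) (left_mult h) p) (ent n A) = eval p (ent n (h * A))"
  unfolding eval_lin
proof (rule eval_cong[OF assms(1)])
  fix c assume "c \<in> {..<n} \<times> {..<n}"
  then obtain i j where c: "c = (i, j)" "i < n" "j < n" by auto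
  show "(\<Sum>k\<in>{..<n} \<times> {..<n}. left_mult h c k * ent n A k) = ent n (h * A) c"
    unfolding c left_mult_apply[OF assms(2) c(2,3)] using c assms by (simp add: mat_ent) (simp add: ent_def)
qed

text \<open>The transpose of left multiplication by h is left multiplication by the transpose of h,
  under which the determinant is multiplied by det h.\<close>

lemma lin_left_mult_transpose_det_poly:
  assumes "h \<in> carrier_mat n n"
  shows "lin ({..<n} \<times> {..<n}) (\<lambda>i k. left_mult h k i) (det_poly n) = Const (mdet h) * det_poly n"
proof -
  let ?J = "{..<n} \<times> {..<n}"
  have t: "transpose_mat h \<in> carrier_mat n n" using assms by simp
  have "lin ?J (\<lambda>i k. left_mult h k i) (det_poly n) = lin ?J (left_mult (transpose_mat h)) (det_poly n)"
    by (rule lin_cong[OF polys_det_poly]) (use assms in \<open>auto simp: left_mult_def\<close>)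
  also have "\<dots> = Const (mdet h) * det_poly n"
  proof (rule GL_poly_eqI)
    fix A assume "A \<in> carrier (GL n)"
    then have A: "A \<in> carrier_mat n n" by (simp add: GL_carrier_iff)
    show "eval (lin ?J (left_mult (transpose_mat h)) (det_poly n)) (ent n A) = eval (Const (mdet h) * det_poly n) (ent n A)"
      using A assms t
      by (simp add: eval_lin_left_mult[OF polys_det_poly t A] eval.ins_mult eval_det_poly_ent
          det_mult[OF t A] det_transpose[OF assms])
  qed (intro polys_lin polys_mult polys_Const polys_det_poly)+
  finally show ?thesis .
qed

text \<open>Cayley's \<open>\<Omega>\<close>-process: pairing \<open>det\<^sup>R \<tau>(A) u\<^sub>0\<close>, a polynomial in the entries of \<open>A\<close>, with a power of
  the determinant replaces \<open>u\<^sub>0\<close> by a vector of weight \<open>det\<^sup>e\<close>.\<close>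

lemma GL_average:
  fixes e :: int
  assumes \<tau>: "\<And>A. A \<in> carrier (GL a) \<Longrightarrow> \<tau> A \<in> carrier_mat q q"
    and mult: "\<And>A B. A \<in> carrier (GL a) \<Longrightarrow> B \<in> carrier (GL a) \<Longrightarrow> \<tau> (A * B) = \<tau> A * \<tau> B"
    and reg: "\<And>i j. i < q \<Longrightarrow> j < q \<Longrightarrow> reg (GL_coords a) (carrier (GL a)) (\<lambda>A. \<tau> A $$ (i, j))"
    and v: "v \<in> carrier_vec q" and u0: "u0 \<in> carrier_vec q"
    and v\<tau>: "\<And>A w. A \<in> carrier (GL a) \<Longrightarrow> w \<in> carrier_vec q \<Longrightarrow>
      scalar_prod v (\<tau> A *\<^sub>v w) = mdet A powi e * scalar_prod v w"
    and nz: "scalar_prod v u0 \<noteq> 0"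
  obtains u where "u \<in> carrier_vec q" "scalar_prod v u \<noteq> 0"
    "\<And>A. A \<in> carrier (GL a) \<Longrightarrow> \<tau> A *\<^sub>v u = (mdet A powi e) \<cdot>\<^sub>v u"
    "\<And>T c. T \<in> carrier_mat q q \<Longrightarrow> (\<And>A. A \<in> carrier (GL a) \<Longrightarrow> T * \<tau> A = \<tau> A * T) \<Longrightarrow>
      T *\<^sub>v u0 = c \<cdot>\<^sub>v u0 \<Longrightarrow> T *\<^sub>v u = c \<cdot>\<^sub>v u"
proof -
  let ?J = "{..<a} \<times> {..<a}"
  let ?D = "det_poly a"
  interpret GL: group "GL a" by (rule group_GL)
  have sp: "scalar_prod x y = (\<Sum>i<q. x $ i * y $ i)" if "y \<in> carrier_vec q" for x y :: "complex vec"
    using that by (simp add: scalar_prod_def atLeast0LessThan)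
  have mv: "(T *\<^sub>v x) $ i = (\<Sum>j<q. T $$ (i, j) * x $ j)"
    if "T \<in> carrier_mat q q" "x \<in> carrier_vec q" "i < q" for T and x :: "complex vec" and i
    using that by (simp add: scalar_prod_def atLeast0LessThan)
  have "\<exists>p r. p \<in> polys ?J \<and> (\<forall>A\<in>carrier (GL a). (\<tau> A *\<^sub>v u0) $ i * mdet A ^ r = eval p (ent a A))"
    if i: "i < q" for i
  proof (rule reg_GL_poly)
    have "reg (GL_coords a) (carrier (GL a)) (\<lambda>A. \<Sum>j<q. \<tau> A $$ (i, j) * u0 $ j)"
      using i by (intro reg_sum reg_mult reg_const reg) auto
    then show "reg (GL_coords a) (carrier (GL a)) (\<lambda>A. (\<tau> A *\<^sub>v u0) $ i)"
      by (rule reg_cong[THEN iffD2, rotated]) (rule mv[OF \<tau> u0 i])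
  qed
  then obtain p0 r0 where p0: "\<And>i. i < q \<Longrightarrow> p0 i \<in> polys ?J"
    "\<And>i A. i < q \<Longrightarrow> A \<in> carrier (GL a) \<Longrightarrow> (\<tau> A *\<^sub>v u0) $ i * mdet A ^ r0 i = eval (p0 i) (ent a A)"
    by metis
  \<comment> \<open>Large enough to clear the denominators of all coordinates of \<tau>(A) u0 and to
    make R + e, the exponent \<open>k\<close> below, non-negative.\<close>
  define R where "R = nat \<bar>e\<bar> + (\<Sum>i<q. r0 i)"
  have rR: "r0 i \<le> R" if "i < q" for i
    using member_le_sum[of i "{..<q}" r0] that by (simp add: R_def)
  define p where "p i = p0 i * ?D ^ (R - r0 i)" for i
  define k where "k = nat (int R + e)"
  have k: "mdet A ^ R * mdet A powi e = mdet A ^ k" if "A \<in> carrier (GL a)" for A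
  proof -
    have "\<bar>e\<bar> \<le> int R" by (simp add: R_def sum_nonneg)
    then have "int k = int R + e" by (simp add: k_def)
    then have "mdet A powi (int R + e) = mdet A ^ k" by (metis power_int_of_nat)
    then show ?thesis using that by (simp add: power_int_add GL_carrier_iff power_int_of_nat)
  qed
  have pJ: "p i \<in> polys ?J" if "i < q" for i
    unfolding p_def using that p0(1) by (intro polys_intros polys_det_poly)
  have pe: "eval (p i) (ent a A) = mdet A ^ R * (\<tau> A *\<^sub>v u0) $ i" if "i < q" "A \<in> carrier (GL a)" for i A
  proof -
    have "eval (p i) (ent a A) = (\<tau> A *\<^sub>v u0) $ i * (mdet A ^ r0 i * mdet A ^ (R - r0 i))"
      using that by (simp add: p_def eval.ins_simps p0(2)[symmetric] eval_det_poly_ent GL_carrier_iff)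
    also have "mdet A ^ r0 i * mdet A ^ (R - r0 i) = mdet A ^ R"
      using rR[OF that(1)] by (simp add: power_add[symmetric])
    finally show ?thesis by (simp add: mult.commute)
  qed
  define comb where "comb w = (\<Sum>i<q. Const (w i) * p i)" for w
  have combJ: "comb w \<in> polys ?J" for w
    unfolding comb_def using pJ by (intro polys_sum polys_mult polys_Const) auto
  have combe: "eval (comb w) (ent a A) = mdet A ^ R * (\<Sum>i<q. w i * (\<tau> A *\<^sub>v u0) $ i)"
    if "A \<in> carrier (GL a)" for w A
    using that by (simp add: comb_def eval.ins_simps pe sum_distrib_left mult_ac)
  \<comment> \<open>Pairing with det^k plays the part of an integral over the group. On the result h
    acts by det(h)^(k - R), which is det(h)^e.\<close>
  define u where "u = vec q (\<lambda>i. apolar (?D ^ k) (p i))"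
  have u: "u \<in> carrier_vec q" by (simp add: u_def)
  have au: "apolar (?D ^ k) (comb w) = (\<Sum>i<q. w i * u $ i)" for w
    by (simp add: comb_def u_def apolar_sum_right apolar_Const_mult_right)
  have DJ: "?D ^ k \<in> polys ?J" by (intro polys_power polys_det_poly)
  have D0: "apolar (?D ^ k) (?D ^ k) \<noteq> 0"
    by (intro apolar_self_neq_0 real_coeffs_power real_coeffs_det_poly mpoly_power_neq_0 det_poly_neq_0)
  \<comment> \<open>In the direction of v the function to be averaged is itself a multiple of det^k,
    so its average is non-zero because the self-pairing of det^k is.\<close>
  have "comb (\<lambda>i. v $ i) = Const (scalar_prod v u0) * ?D ^ k"
  proof (rule GL_poly_eqI[OF combJ])
    fix A assume A: "A \<in> carrier (GL a)"
    have "(\<Sum>i<q. v $ i * (\<tau> A *\<^sub>v u0) $ i) = mdet A powi e * scalar_prod v u0"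
      using v\<tau>[OF A u0] sp[of "\<tau> A *\<^sub>v u0" v] \<tau>[OF A] u0 by simp
    then show "eval (comb (\<lambda>i. v $ i)) (ent a A) = eval (Const (scalar_prod v u0) * ?D ^ k) (ent a A)"
      using k[OF A] A by (simp add: combe eval.ins_simps eval_det_poly_ent GL_carrier_iff)
  qed (intro polys_mult polys_Const DJ)
  then have "scalar_prod v u = scalar_prod v u0 * apolar (?D ^ k) (?D ^ k)"
    using au[of "\<lambda>i. v $ i"] sp[OF u, of v] by (simp add: apolar_Const_mult_right)
  then have 1: "scalar_prod v u \<noteq> 0" using nz D0 by simp
  have 2: "\<tau> h *\<^sub>v u = (mdet h powi e) \<cdot>\<^sub>v u" if h: "h \<in> carrier (GL a)" for h
  proof (rule eq_vecI)
    have hc: "h \<in> carrier_mat a a" "mdet h \<noteq> 0" using h by (simp_all add: GL_carrier_iff)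
    fix i assume "i < dim_vec ((mdet h powi e) \<cdot>\<^sub>v u)"
    then have i: "i < q" using u by simp
    \<comment> \<open>Left translation: \<tau>(h) applied to \<tau>(A) u0 is \<tau>(h A) u0, and the
      power of det(h) corrects for the factor det^R in \<open>p\<close>. By adjointness the
      translation then moves over to det^k.\<close>
    have c: "comb (\<lambda>j. \<tau> h $$ (i, j)) = Const (inverse (mdet h) ^ R) * lin ?J (left_mult h) (p i)"
    proof (rule GL_poly_eqI[OF combJ])
      fix A assume A: "A \<in> carrier (GL a)"
      then have Ac: "A \<in> carrier_mat a a" by (simp add: GL_carrier_iff)
      have hA: "h * A \<in> carrier (GL a)" using GL.m_closed[OF h A] by simp
      have "\<tau> h *\<^sub>v (\<tau> A *\<^sub>v u0) = \<tau> (h * A) *\<^sub>v u0"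
        unfolding mult[OF h A] by (rule assoc_mult_mat_vec[symmetric, OF \<tau>[OF h] \<tau>[OF A] u0])
      then have "(\<Sum>j<q. \<tau> h $$ (i, j) * (\<tau> A *\<^sub>v u0) $ j) = (\<tau> (h * A) *\<^sub>v u0) $ i"
        using mv[OF \<tau>[OF h] mult_mat_vec_carrier[OF \<tau>[OF A] u0] i] by simp
      then show "eval (comb (\<lambda>j. \<tau> h $$ (i, j))) (ent a A) =
          eval (Const (inverse (mdet h) ^ R) * lin ?J (left_mult h) (p i)) (ent a A)"
        using hc
        by (simp add: combe[OF A] eval.ins_simps eval_lin_left_mult[OF pJ[OF i] hc(1) Ac] pe[OF i hA]
            det_mult[OF hc(1) Ac] power_mult_distrib field_simps)
    qed (intro polys_mult polys_Const polys_lin pJ i)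
    have "apolar (?D ^ k) (lin ?J (left_mult h) (p i)) =
        apolar (lin ?J (\<lambda>i k. left_mult h k i) (?D ^ k)) (p i)"
      by (rule apolar_lin[symmetric, OF _ DJ pJ[OF i]]) simp
    also have "\<dots> = mdet h ^ k * apolar (?D ^ k) (p i)"
      by (simp add: lin_simps lin_left_mult_transpose_det_poly[OF hc(1)] power_mult_distrib
          Const_power[symmetric] apolar_Const_mult_left)
    finally have "(\<tau> h *\<^sub>v u) $ i = inverse (mdet h) ^ R * (mdet h ^ R * mdet h powi e) * u $ i"
      using mv[OF \<tau>[OF h] u i] au[of "\<lambda>j. \<tau> h $$ (i, j)"] i
      by (simp add: c apolar_Const_mult_right k[OF h] u_def mult.assoc)
    also have "\<dots> = mdet h powi e * u $ i" using hc(2) by (simp add: field_simps)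
    finally show "(\<tau> h *\<^sub>v u) $ i = ((mdet h powi e) \<cdot>\<^sub>v u) $ i" using i u by simp
  qed (use \<tau>[OF h] u in simp)
  \<comment> \<open>Operators commuting with the representation pass through the averaging, so
    eigenvector properties obtained from other factors of the group survive it.\<close>
  have 3: "T *\<^sub>v u = c \<cdot>\<^sub>v u"
    if T: "T \<in> carrier_mat q q" and comm: "\<And>A. A \<in> carrier (GL a) \<Longrightarrow> T * \<tau> A = \<tau> A * T"
      and Tu: "T *\<^sub>v u0 = c \<cdot>\<^sub>v u0" for T c
  proof (rule eq_vecI)
    fix i assume "i < dim_vec (c \<cdot>\<^sub>v u)"
    then have i: "i < q" using u by simp
    have "comb (\<lambda>j. T $$ (i, j)) = Const c * p i"
    proof (rule GL_poly_eqI[OF combJ])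
      fix A assume A: "A \<in> carrier (GL a)"
      have "T *\<^sub>v (\<tau> A *\<^sub>v u0) = (T * \<tau> A) *\<^sub>v u0"
        by (rule assoc_mult_mat_vec[symmetric, OF T \<tau>[OF A] u0])
      also have "\<dots> = \<tau> A *\<^sub>v (T *\<^sub>v u0)"
        unfolding comm[OF A] by (rule assoc_mult_mat_vec[OF \<tau>[OF A] T u0])
      also have "\<dots> = c \<cdot>\<^sub>v (\<tau> A *\<^sub>v u0)"
        unfolding Tu by (rule mult_mat_vec[OF \<tau>[OF A] u0])
      finally have "(\<Sum>j<q. T $$ (i, j) * (\<tau> A *\<^sub>v u0) $ j) = c * (\<tau> A *\<^sub>v u0) $ i"
        using mv[OF T mult_mat_vec_carrier[OF \<tau>[OF A] u0] i] i \<tau>[OF A] by simp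
      then show "eval (comb (\<lambda>j. T $$ (i, j))) (ent a A) = eval (Const c * p i) (ent a A)"
        by (simp add: combe[OF A] eval.ins_simps pe[OF i A])
    qed (intro polys_mult polys_Const pJ i)
    then have "(T *\<^sub>v u) $ i = c * u $ i"
      using mv[OF T u i] au[of "\<lambda>j. T $$ (i, j)"] i by (simp add: apolar_Const_mult_right u_def)
    then show "(T *\<^sub>v u) $ i = (c \<cdot>\<^sub>v u) $ i" using i u by simp
  qed (use T u in simp)
  show thesis by (rule that[OF u 1 2 3])
qed


section \<open>Eigenvectors of reductive groups\<close>

lemma subspace_iff: "VectorSpace.subspace class_ring W (module_vec TYPE(complex) q) \<longleftrightarrow>
    W \<subseteq> carrier_vec q \<and> 0\<^sub>v q \<in> W \<and> (\<forall>x\<in>W. \<forall>y\<in>W. x + y \<in> W) \<and> (\<forall>c. \<forall>x\<in>W. c \<cdot>\<^sub>v x \<in> W)"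
proof -
  interpret vec_space "TYPE(complex)" q .
  have m: "Module.module (class_ring :: complex ring) (module_vec TYPE(complex) q)" by (rule module_axioms)
  have vs: "vectorspace (class_ring :: complex ring) (module_vec TYPE(complex) q)" by (rule vectorspace_axioms)
  show ?thesis
    unfolding VectorSpace.subspace_def LinearCombinations.submodule_def
    using m vs by (auto simp: module_vec_simps class_ring_simps)
qed

text \<open>The kernel of the functional v is an invariant hyperplane. An invariant complement
  contains a vector u on which v takes the value 1, and \<tau>(k) u - \<omega>(k) u lies both in the
  complement and in the kernel, hence is 0.\<close>

lemma reductive_eigenvector:
  assumes red: "reductive N K" and rep: "rational_rep (group_on N K) (GL_coords N) q \<tau>"
    and v: "v \<in> carrier_vec q" "v \<noteq> 0\<^sub>v q"
    and v\<tau>: "\<And>k w. k \<in> K \<Longrightarrow> w \<in> carrier_vec q \<Longrightarrow> scalar_prod v (\<tau> k *\<^sub>v w) = \<omega> k * scalar_prod v w"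
  obtains u where "u \<in> carrier_vec q" "scalar_prod v u = 1" "\<And>k. k \<in> K \<Longrightarrow> \<tau> k *\<^sub>v u = \<omega> k \<cdot>\<^sub>v u"
proof -
  have \<tau>: "\<tau> k \<in> carrier_mat q q" if "k \<in> K" for k
    using rep that by (auto simp: rational_rep_def hom_def GL_carrier_iff)
  define W where "W = {w \<in> carrier_vec q. scalar_prod v w = 0}"
  have "invariant_subspace (group_on N K) q \<tau> W"
    unfolding invariant_subspace_def subspace_iff
    using v(1) \<tau> by (auto simp: W_def v\<tau> scalar_prod_add_distrib[OF v(1)] intro!: mult_mat_vec_carrier)
  then obtain W' where W': "invariant_subspace (group_on N K) q \<tau> W'" "W \<inter> W' = {0\<^sub>v q}"
    "\<And>x. x \<in> carrier_vec q \<Longrightarrow> \<exists>w\<in>W. \<exists>w'\<in>W'. x = w + w'"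
    using red rep unfolding reductive_def completely_reducible_def by meson
  have sub: "W' \<subseteq> carrier_vec q" "\<And>x y. x \<in> W' \<Longrightarrow> y \<in> W' \<Longrightarrow> x + y \<in> W'" "\<And>c x. x \<in> W' \<Longrightarrow> c \<cdot>\<^sub>v x \<in> W'"
    and inv: "\<And>k x. k \<in> K \<Longrightarrow> x \<in> W' \<Longrightarrow> \<tau> k *\<^sub>v x \<in> W'"
    using W'(1) unfolding invariant_subspace_def subspace_iff by auto
  obtain i where i: "i < q" "v $ i \<noteq> 0"
    using v by (metis carrier_vecD eq_vecI index_zero_vec(1) index_zero_vec(2))
  have "scalar_prod v (inverse (v $ i) \<cdot>\<^sub>v unit_vec q i) = 1"
    using v(1) i by (simp add: scalar_prod_smult_distrib[OF v(1)])
  then obtain x where x: "x \<in> carrier_vec q" "scalar_prod v x = 1" by (metis smult_carrier_vec unit_vec_carrier)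
  obtain w u where wu: "w \<in> W" "u \<in> W'" "x = w + u" using W'(3)[OF x(1)] by blast
  have u: "u \<in> carrier_vec q" using wu(2) sub(1) by blast
  have vu: "scalar_prod v u = 1"
    using x(2) wu(1) u v(1) by (simp add: wu(3) W_def scalar_prod_add_distrib[OF v(1)])
  have "\<tau> k *\<^sub>v u = \<omega> k \<cdot>\<^sub>v u" if k: "k \<in> K" for k
  proof -
    let ?z = "\<tau> k *\<^sub>v u + (- \<omega> k) \<cdot>\<^sub>v u"
    have tu: "\<tau> k *\<^sub>v u \<in> carrier_vec q" using \<tau>[OF k] u by (rule mult_mat_vec_carrier)
    have "?z \<in> W'" by (intro sub(2) sub(3) inv k wu(2))
    moreover have v0: "scalar_prod v ?z = 0"
      using v\<tau>[OF k u] vu u tu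
      by (simp add: scalar_prod_add_distrib[OF v(1)] scalar_prod_smult_distrib[OF v(1)])
    moreover have "?z \<in> W" using v0 tu u unfolding W_def by simp
    ultimately have "?z \<in> W \<inter> W'" by blast
    then have z: "?z = 0\<^sub>v q" unfolding W'(2) by simp
    show ?thesis
    proof (rule eq_vecI)
      fix j assume "j < dim_vec (\<omega> k \<cdot>\<^sub>v u)"
      then have j: "j < q" using u by simp
      then show "(\<tau> k *\<^sub>v u) $ j = (\<omega> k \<cdot>\<^sub>v u) $ j"
        using arg_cong[OF z, of "\<lambda>y. y $ j"] u tu by simp
    qed (use \<tau>[OF k] u in simp)
  qed
  then show thesis using that[OF u vu] by blast
qed

section \<open>Non-degeneracy of the pairing of semi-invariants\<close>

abbreviation prod_group :: "nat \<Rightarrow> nat \<Rightarrow> nat \<Rightarrow> complex mat set \<Rightarrow> (complex mat \<times> complex mat \<times> complex mat) monoid" where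
  "prod_group a b N K \<equiv> GL a \<times>\<times> (GL b \<times>\<times> group_on N K)"

text \<open>Regularity is asked along each of the three factors separately, because the averaging
  treats one factor at a time.\<close>

definition rational_action ::
  "nat \<Rightarrow> nat \<Rightarrow> nat \<Rightarrow> complex mat set \<Rightarrow>
   (complex mat \<times> complex mat \<times> complex mat \<Rightarrow> ('i \<Rightarrow> complex) \<Rightarrow> 'i \<Rightarrow> complex) \<Rightarrow> 'i set \<Rightarrow> bool" where
  "rational_action a b N K act I \<longleftrightarrow> linear_action (prod_group a b N K) act I \<and> (\<forall>i\<in>I. \<forall>j\<in>I.
     reg (GL_coords a) (carrier (GL a)) (\<lambda>g. act_mat act (g, 1\<^sub>m b, 1\<^sub>m N) i j) \<and>
     reg (GL_coords b) (carrier (GL b)) (\<lambda>h. act_mat act (1\<^sub>m a, h, 1\<^sub>m N) i j) \<and>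
     reg (GL_coords N) K (\<lambda>k. act_mat act (1\<^sub>m a, 1\<^sub>m b, k) i j))"

lemma group_group_on: "subgroup K (GL N) \<Longrightarrow> group (group_on N K)"
  by (rule subgroup.subgroup_is_group[OF _ group_GL])

lemma group_prod_group: "subgroup K (GL N) \<Longrightarrow> group (prod_group a b N K)"
  by (intro DirProd_group group_GL group_group_on)

lemma prod_group_mult: "(g, h, k) \<otimes>\<^bsub>prod_group a b N K\<^esub> (g', h', k') = (g * g', h * h', k * k')"
  by (simp add: mult_DirProd)

lemma prod_group_one: "\<one>\<^bsub>prod_group a b N K\<^esub> = (1\<^sub>m a, 1\<^sub>m b, 1\<^sub>m N)"
  by (simp add: one_DirProd)

lemma prod_group_inv:
  assumes K: "subgroup K (GL N)" and x: "g \<in> carrier (GL a)" "h \<in> carrier (GL b)" "k \<in> K"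
  shows "inv\<^bsub>prod_group a b N K\<^esub> (g, h, k) = (inv\<^bsub>GL a\<^esub> g, inv\<^bsub>GL b\<^esub> h, inv\<^bsub>GL N\<^esub> k)"
  using x group.m_inv_consistent[OF group_GL K x(3)]
  by (simp add: inv_DirProd DirProd_group group_GL group_group_on[OF K])

lemma GL_one_mem: "1\<^sub>m a \<in> carrier (GL a)"
  by (simp add: GL_carrier_iff)

lemma GL_inv_one: "inv\<^bsub>GL a\<^esub> (1\<^sub>m a) = 1\<^sub>m a"
  using monoid.inv_one[OF group.is_monoid[OF group_GL[of a]]] by simp

lemma subgroup_GL_facts:
  assumes "subgroup K (GL N)"
  shows "1\<^sub>m N \<in> K" "K \<subseteq> carrier (GL N)" "k \<in> K \<Longrightarrow> inv\<^bsub>GL N\<^esub> k \<in> K" "k \<in> K \<Longrightarrow> k' \<in> K \<Longrightarrow> k * k' \<in> K"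
  using subgroup.one_closed[OF assms] subgroup.subset[OF assms] subgroup.m_inv_closed[OF assms]
    subgroup.m_closed[OF assms] by simp_all

lemma rational_action_inv:
  assumes rat: "rational_action a b N K act I" and K: "subgroup K (GL N)" and ij: "i \<in> I" "j \<in> I"
  shows "reg (GL_coords a) (carrier (GL a)) (\<lambda>g. act_mat act (inv\<^bsub>prod_group a b N K\<^esub> (g, 1\<^sub>m b, 1\<^sub>m N)) i j)"
    "reg (GL_coords b) (carrier (GL b)) (\<lambda>h. act_mat act (inv\<^bsub>prod_group a b N K\<^esub> (1\<^sub>m a, h, 1\<^sub>m N)) i j)"
    "reg (GL_coords N) K (\<lambda>k. act_mat act (inv\<^bsub>prod_group a b N K\<^esub> (1\<^sub>m a, 1\<^sub>m b, k)) i j)"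
proof -
  note k = subgroup_GL_facts[OF K]
  have r: "reg (GL_coords a) (carrier (GL a)) (\<lambda>g. act_mat act (g, 1\<^sub>m b, 1\<^sub>m N) i j)"
    "reg (GL_coords b) (carrier (GL b)) (\<lambda>h. act_mat act (1\<^sub>m a, h, 1\<^sub>m N) i j)"
    "reg (GL_coords N) K (\<lambda>k. act_mat act (1\<^sub>m a, 1\<^sub>m b, k) i j)"
    using rat ij by (auto simp: rational_action_def)
  show "reg (GL_coords a) (carrier (GL a)) (\<lambda>g. act_mat act (inv\<^bsub>prod_group a b N K\<^esub> (g, 1\<^sub>m b, 1\<^sub>m N)) i j)"
    using reg_inv[OF r(1) subset_refl] GL_inv(1)
    by (subst reg_cong) (simp_all add: prod_group_inv[OF K] GL_one_mem k(1) GL_inv_one)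
  show "reg (GL_coords b) (carrier (GL b)) (\<lambda>h. act_mat act (inv\<^bsub>prod_group a b N K\<^esub> (1\<^sub>m a, h, 1\<^sub>m N)) i j)"
    using reg_inv[OF r(2) subset_refl] GL_inv(1)
    by (subst reg_cong) (simp_all add: prod_group_inv[OF K] GL_one_mem k(1) GL_inv_one)
  show "reg (GL_coords N) K (\<lambda>k. act_mat act (inv\<^bsub>prod_group a b N K\<^esub> (1\<^sub>m a, 1\<^sub>m b, k)) i j)"
    using reg_inv[OF r(3) k(2) k(3)]
    by (subst reg_cong) (simp_all add: prod_group_inv[OF K] GL_one_mem k(1) GL_inv_one)
qed

lemma rational_action_dual:
  assumes "rational_action a b N K act I" "subgroup K (GL N)" "finite I"
  shows "rational_action a b N K (dual_act (prod_group a b N K) act I) I"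
  unfolding rational_action_def
  using rational_action_inv[OF assms(1,2)] linear_action_dual[OF assms(3), of "prod_group a b N K" act] assms(1)
  by (simp add: act_mat_dual[OF assms(3)] rational_action_def)

lemma lookup_Var_mult: "lookup (Var k * Q) \<beta> = (if k \<in> keys \<beta> then lookup Q (\<beta> - unit_exp k) else 0)"
proof (induction Q rule: poly_mapping_single_induct)
  case (single \<alpha> c)
  have "unit_exp k + \<alpha> = \<beta> \<longleftrightarrow> k \<in> keys \<beta> \<and> \<alpha> = \<beta> - unit_exp k"
    using unit_exp_split[of k \<beta>] by (auto simp: keys_add_exp)
  then show ?case by (auto simp: Var_mult_monom lookup_single when_def)
qed (simp add: distrib_left lookup_add)

text \<open>Coefficients after a substitution are polynomials in the entries of its matrix; this
  makes the representation on polynomials of fixed degree rational.\<close>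

lemma reg_lookup_lin:
  assumes "P \<in> polys I" "\<And>i j. i \<in> I \<Longrightarrow> j \<in> I \<Longrightarrow> reg C S (\<lambda>x. A x i j)"
  shows "reg C S (\<lambda>x. lookup (lin I (A x) P) \<beta>)"
  using assms(1)
proof (induction P arbitrary: \<beta> rule: polys_induct)
  case (Const c)
  then show ?case by (simp add: lin_simps reg_const)
next
  case (add A B)
  then show ?case by (simp add: lin_simps lookup_add reg_add)
next
  case (Var i P)
  have "reg C S (\<lambda>x. \<Sum>k\<in>I. A x i k * (if k \<in> keys \<beta> then lookup (lin I (A x) P) (\<beta> - unit_exp k) else 0))"
  proof (intro reg_sum reg_mult assms(2) Var(1))
    fix k
    show "reg C S (\<lambda>x. if k \<in> keys \<beta> then lookup (lin I (A x) P) (\<beta> - unit_exp k) else 0)"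
      by (cases "k \<in> keys \<beta>") (simp_all add: Var(3) reg_const)
  qed
  then show ?case
    by (simp add: lin_simps sum_distrib_right lookup_sum mult.assoc lookup_Var_mult)
qed

lemma finite_exponents: "finite I \<Longrightarrow> finite {\<alpha>. keys \<alpha> \<subseteq> I \<and> mdeg \<alpha> = D}"
proof (induction D)
  case 0
  have "{\<alpha>. keys \<alpha> \<subseteq> I \<and> mdeg \<alpha> = 0} \<subseteq> {0}" by (auto simp: mdeg_eq_0)
  then show ?case by (rule finite_subset) simp
next
  case (Suc D)
  have "{\<alpha>. keys \<alpha> \<subseteq> I \<and> mdeg \<alpha> = Suc D} \<subseteq> (\<Union>i\<in>I. (+) (unit_exp i) ` {\<alpha>. keys \<alpha> \<subseteq> I \<and> mdeg \<alpha> = D})"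
  proof
    fix \<alpha> assume "\<alpha> \<in> {\<alpha>. keys \<alpha> \<subseteq> I \<and> mdeg \<alpha> = Suc D}"
    then have a: "keys \<alpha> \<subseteq> I" "mdeg \<alpha> = Suc D" by auto
    then have "\<alpha> \<noteq> 0" by auto
    then obtain i where i: "i \<in> keys \<alpha>" by (metis all_not_in_conv keys_eq_empty)
    define \<beta> where "\<beta> = \<alpha> - unit_exp i"
    have e: "\<alpha> = unit_exp i + \<beta>" unfolding \<beta>_def by (rule unit_exp_split[OF i])
    have "keys \<beta> \<subseteq> I" "mdeg \<beta> = D" using a by (auto simp: e keys_add_exp mdeg_add)
    then show "\<alpha> \<in> (\<Union>i\<in>I. (+) (unit_exp i) ` {\<alpha>. keys \<alpha> \<subseteq> I \<and> mdeg \<alpha> = D})"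
      using e i a(1) by blast
  qed
  then show ?case by (rule finite_subset) (use Suc in auto)
qed

text \<open>On the polynomials of degree D, w is a linear functional and an eigenvector of the
  transposed action. Complete reducibility yields an eigenvector of K on which the functional does
  not vanish, and this is averaged over the two general linear groups in turn; as the factors
  commute, no stage destroys what the previous ones achieved.\<close>

theorem reductive_pairing:
  assumes K: "subgroup K (GL N)" and red: "reductive N K" and fin: "finite I"
    and rat: "rational_action a b N K act I"
    and w: "w \<noteq> 0" "homogeneous D w"
      "semi_invariant (prod_group a b N K) (dual_act (prod_group a b N K) act I) I (\<lambda>x. inverse (\<theta> x)) w"
    and \<theta>1: "\<And>g. g \<in> carrier (GL a) \<Longrightarrow> \<theta> (g, 1\<^sub>m b, 1\<^sub>m N) = mdet g powi e1"
    and \<theta>2: "\<And>h. h \<in> carrier (GL b) \<Longrightarrow> \<theta> (1\<^sub>m a, h, 1\<^sub>m N) = mdet h powi e2"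
  shows "\<exists>u. semi_invariant (prod_group a b N K) act I \<theta> u \<and> homogeneous D u \<and> apolar w u \<noteq> 0"
proof -
  define G where "G = prod_group a b N K"
  have act: "linear_action G act I" using rat by (simp add: rational_action_def G_def)
  interpret G: group G using act by (simp add: linear_action_def)
  note k = subgroup_GL_facts[OF K]
  have wI: "w \<in> polys I" using w(3) by (rule semi_invariant_polys)
  define S where "S x = act_mat act (inv\<^bsub>G\<^esub> x)" for x
  have \<theta>inv: "inverse (\<theta> (inv\<^bsub>G\<^esub> x)) = \<theta> x" "\<theta> x \<noteq> 0" if "x \<in> carrier G" for x
  proof -
    have "inverse (\<theta> x) * inverse (\<theta> (inv\<^bsub>G\<^esub> x)) = 1"
      using semi_invariant_weight[OF linear_action_dual[OF fin act] fin, of "\<lambda>x. inverse (\<theta> x)" w x] w(1,3) that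
      by (simp add: G_def)
    then show "\<theta> x \<noteq> 0" "inverse (\<theta> (inv\<^bsub>G\<^esub> x)) = \<theta> x" by (auto simp: field_simps)
  qed
  have wS: "lin I (\<lambda>i k. S x k i) w = Const (\<theta> x) * w" if "x \<in> carrier G" for x
    using w(3) that \<theta>inv(1)[OF that] unfolding G_def[symmetric] semi_invariant_dual_iff[OF fin act] by (simp add: S_def)
  have linS: "lin I (S x) (lin I (S y) P) = lin I (S (x \<otimes>\<^bsub>G\<^esub> y)) P"
    if "x \<in> carrier G" "y \<in> carrier G" "P \<in> polys I" for x y P
    unfolding lin_lin[OF that(3)]
    using that by (intro lin_cong) (simp_all add: S_def G.inv_mult_group act_mat_mult[OF act])
  have lin1: "lin I (S \<one>\<^bsub>G\<^esub>) P = P" if "P \<in> polys I" for P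
    using that by (intro lin_id fin) (simp_all add: S_def act_mat_one[OF act])

  \<comment> \<open>The monomials of degree D in the variables \<open>I\<close>, enumerated so that
    polynomials become vectors and the action becomes the matrices \<tau>.\<close>
  define B where "B = {\<alpha>. keys \<alpha> \<subseteq> I \<and> mdeg \<alpha> = D}"
  obtain ms where ms: "distinct ms" "set ms = B"
    using finite_distinct_list[OF finite_exponents[OF fin, of D]] by (auto simp: B_def)
  define q where "q = length ms"
  have msB: "keys (ms ! r) \<subseteq> I" "mdeg (ms ! r) = D" if "r < q" for r
    using nth_mem[of r ms] that ms(2) by (auto simp: q_def B_def)
  let ?m = "\<lambda>r. mterm (ms ! r) 1"
  have mI: "?m r \<in> polys I" "homogeneous D (?m r)" if "r < q" for r
    using msB[OF that] by (auto intro: polys_monom homogeneous_monom)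
  have expand: "(\<Sum>r<q. Const (lookup Q (ms ! r)) * ?m r) = Q" if Q: "Q \<in> polys I" "homogeneous D Q" for Q
  proof -
    have sub: "keys Q \<subseteq> B" using Q by (auto simp: B_def polys_def homogeneous_def in_keys_iff)
    have "(\<Sum>r<q. Const (lookup Q (ms ! r)) * ?m r) = (\<Sum>\<alpha>\<in>B. Const (lookup Q \<alpha>) * mterm \<alpha> 1)"
      unfolding ms(2)[symmetric] q_def using bij_betw_nth[OF ms(1) refl refl]
      by (rule sum.reindex_bij_betw)
    also have "\<dots> = (\<Sum>\<alpha>\<in>keys Q. Const (lookup Q \<alpha>) * mterm \<alpha> 1)"
      using sub ms(2) by (intro sum.mono_neutral_right) (auto simp: in_keys_iff)
    also have "\<dots> = Q" using poly_mapping_sum_single[of Q] by (simp add: Const_mult_monom)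
    finally show ?thesis .
  qed
  define polyv where "polyv u = (\<Sum>r<q. Const (u $ r) * ?m r)" for u :: "complex vec"
  have polyvI: "polyv u \<in> polys I" for u
    unfolding polyv_def using mI(1) by (intro polys_sum polys_mult polys_Const) auto
  have polyvD: "homogeneous D (polyv u)" for u
    unfolding polyv_def using mI(2) by (intro homogeneous_sum homogeneous_Const_mult) auto
  define \<tau> where "\<tau> x = mat q q (\<lambda>(r, s). lookup (lin I (S x) (?m s)) (ms ! r))" for x
  have \<tau>c: "\<tau> x \<in> carrier_mat q q" for x by (simp add: \<tau>_def)
  have \<tau>e: "\<tau> x $$ (r, s) = lookup (lin I (S x) (?m s)) (ms ! r)" if "r < q" "s < q" for x r s
    using that by (simp add: \<tau>_def)
  have polyv_\<tau>: "polyv (\<tau> x *\<^sub>v u) = lin I (S x) (polyv u)" if u: "u \<in> carrier_vec q" for x u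
  proof -
    have "(\<tau> x *\<^sub>v u) $ r = lookup (lin I (S x) (polyv u)) (ms ! r)" if r: "r < q" for r
    proof -
      have "(\<tau> x *\<^sub>v u) $ r = (\<Sum>s<q. \<tau> x $$ (r, s) * u $ s)"
        using r u \<tau>c[of x] by (simp add: scalar_prod_def atLeast0LessThan)
      also have "\<dots> = lookup (lin I (S x) (polyv u)) (ms ! r)"
        using r by (simp add: polyv_def lin_simps lookup_sum \<tau>e mult.commute)
      finally show ?thesis .
    qed
    then have "polyv (\<tau> x *\<^sub>v u) = (\<Sum>r<q. Const (lookup (lin I (S x) (polyv u)) (ms ! r)) * ?m r)"
      by (simp add: polyv_def[of "\<tau> x *\<^sub>v u"])
    also have "\<dots> = lin I (S x) (polyv u)"
      by (intro expand polys_lin homogeneous_lin polyvI polyvD)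
    finally show ?thesis .
  qed
  have \<tau>mult: "\<tau> (x \<otimes>\<^bsub>G\<^esub> y) = \<tau> x * \<tau> y" if xy: "x \<in> carrier G" "y \<in> carrier G" for x y
  proof (rule eq_matI)
    fix r s assume "r < dim_row (\<tau> x * \<tau> y)" "s < dim_col (\<tau> x * \<tau> y)"
    then have rs: "r < q" "s < q" using \<tau>c[of x] \<tau>c[of y] by auto
    have "(\<tau> x * \<tau> y) $$ (r, s) = (\<Sum>t<q. \<tau> x $$ (r, t) * \<tau> y $$ (t, s))"
      using rs \<tau>c[of x] \<tau>c[of y] by (simp add: scalar_prod_def atLeast0LessThan)
    also have "\<dots> = (\<Sum>t<q. lookup (lin I (S y) (?m s)) (ms ! t) * lookup (lin I (S x) (?m t)) (ms ! r))"
      using rs by (intro sum.cong refl) (simp add: \<tau>e)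
    also have "\<dots> = lookup (lin I (S x) (\<Sum>t<q. Const (lookup (lin I (S y) (?m s)) (ms ! t)) * ?m t)) (ms ! r)"
      by (simp add: lin_simps lookup_sum)
    also have "(\<Sum>t<q. Const (lookup (lin I (S y) (?m s)) (ms ! t)) * ?m t) = lin I (S y) (?m s)"
      using mI[OF rs(2)] by (intro expand polys_lin homogeneous_lin)
    finally show "\<tau> (x \<otimes>\<^bsub>G\<^esub> y) $$ (r, s) = (\<tau> x * \<tau> y) $$ (r, s)"
      using rs xy mI(1) by (simp add: \<tau>e linS)
  qed (use \<tau>c in \<open>auto simp: \<tau>_def\<close>)
  have \<tau>1: "\<tau> \<one>\<^bsub>G\<^esub> = 1\<^sub>m q"
  proof (rule eq_matI)
    fix r s assume "r < dim_row (1\<^sub>m q :: complex mat)" "s < dim_col (1\<^sub>m q :: complex mat)"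
    then have rs: "r < q" "s < q" by auto
    then show "\<tau> \<one>\<^bsub>G\<^esub> $$ (r, s) = 1\<^sub>m q $$ (r, s)"
      using nth_eq_iff_index_eq[OF ms(1)] mI(1)
      by (auto simp: \<tau>e lin1 lookup_single when_def q_def)
  qed (use \<tau>c in \<open>auto simp: \<tau>_def\<close>)
  have \<tau>GL: "\<tau> x \<in> carrier (GL q)" if "x \<in> carrier G" for x
  proof -
    have "\<tau> x * \<tau> (inv\<^bsub>G\<^esub> x) = 1\<^sub>m q" using that \<tau>mult[of x "inv\<^bsub>G\<^esub> x"] by (simp add: \<tau>1)
    then have "mdet (\<tau> x) * mdet (\<tau> (inv\<^bsub>G\<^esub> x)) = 1" using det_mult[OF \<tau>c \<tau>c, of x "inv\<^bsub>G\<^esub> x"] by simp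
    then show ?thesis using \<tau>c by (auto simp: GL_carrier_iff)
  qed

  \<comment> \<open>The functional given by pairing with w, in coordinates. It is non-zero because w
    is homogeneous of degree D, so all its coefficients show up.\<close>
  define v where "v = vec q (\<lambda>s. apolar w (?m s))"
  have vc: "v \<in> carrier_vec q" by (simp add: v_def)
  have vp: "scalar_prod v u = apolar w (polyv u)" if "u \<in> carrier_vec q" for u
    using that by (simp add: v_def scalar_prod_def polyv_def apolar_sum_right apolar_Const_mult_right
        atLeast0LessThan mult.commute)
  have v\<tau>: "scalar_prod v (\<tau> x *\<^sub>v u) = \<theta> x * scalar_prod v u" if "x \<in> carrier G" "u \<in> carrier_vec q" for x u
  proof -
    have "scalar_prod v (\<tau> x *\<^sub>v u) = apolar w (lin I (S x) (polyv u))"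
      using that \<tau>c[of x] by (simp add: vp polyv_\<tau> mult_mat_vec_carrier)
    also have "\<dots> = apolar (lin I (\<lambda>i k. S x k i) w) (polyv u)"
      by (rule apolar_lin[OF fin wI polyvI, symmetric])
    finally show ?thesis using that by (simp add: wS apolar_Const_mult_left vp)
  qed
  have v0: "v \<noteq> 0\<^sub>v q"
  proof
    assume v: "v = 0\<^sub>v q"
    obtain \<alpha> where \<alpha>: "lookup w \<alpha> \<noteq> 0" using w(1) by (auto simp: poly_mapping_eq_iff fun_eq_iff)
    then have "\<alpha> \<in> B" using polysD[OF wI \<alpha>] w(2) by (simp add: B_def homogeneous_def)
    then obtain s where s: "s < q" "ms ! s = \<alpha>" using ms(2) by (metis in_set_conv_nth q_def)
    have "v $ s = mfact \<alpha> * lookup w \<alpha>"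
      using s by (simp add: v_def apolar_commute[of w] apolar_monom)
    then show False using \<alpha> s(1) by (simp add: v)
  qed

  have mem: "(g, h, k') \<in> carrier G \<longleftrightarrow> g \<in> carrier (GL a) \<and> h \<in> carrier (GL b) \<and> k' \<in> K" for g h k'
    by (simp add: G_def)
  have mult: "(g, h, k1) \<otimes>\<^bsub>G\<^esub> (g', h', k2) = (g * g', h * h', k1 * k2)" for g h k1 g' h' k2
    by (simp add: G_def prod_group_mult)
  note one = GL_one_mem k(1)
  have cm: "g \<in> carrier_mat c c" if "g \<in> carrier (GL c)" for g c using that by (simp add: GL_carrier_iff)
  have KGL: "k' \<in> carrier (GL N)" if "k' \<in> K" for k' using that k(2) by blast
  have comm: "\<tau> x * \<tau> y = \<tau> y * \<tau> x"
    if "x \<in> carrier G" "y \<in> carrier G" "x \<otimes>\<^bsub>G\<^esub> y = y \<otimes>\<^bsub>G\<^esub> x" for x y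
    using that \<tau>mult by metis
  have regs: "reg (GL_coords a) (carrier (GL a)) (\<lambda>g. lookup (lin I (S (g, 1\<^sub>m b, 1\<^sub>m N)) (?m j)) \<gamma>)"
    "reg (GL_coords b) (carrier (GL b)) (\<lambda>h. lookup (lin I (S (1\<^sub>m a, h, 1\<^sub>m N)) (?m j)) \<gamma>)"
    "reg (GL_coords N) K (\<lambda>k'. lookup (lin I (S (1\<^sub>m a, 1\<^sub>m b, k')) (?m j)) \<gamma>)" if "j < q" for j \<gamma>
    unfolding S_def G_def using mI(1)[OF that] by (intro reg_lookup_lin rational_action_inv[OF rat K]; simp)+
  have rep: "rational_rep (group_on N K) (GL_coords N) q (\<lambda>k'. \<tau> (1\<^sub>m a, 1\<^sub>m b, k'))"
    unfolding rational_rep_def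
  proof (intro conjI allI impI homI)
    fix i j assume "i < q" "j < q"
    then show "\<exists>\<phi>\<in>gen_algebra (GL_coords N). \<forall>g\<in>carrier (group_on N K). \<tau> (1\<^sub>m a, 1\<^sub>m b, g) $$ (i, j) = \<phi> g"
      using regs(3)[of j "ms ! i"] by (simp add: \<tau>e reg_def)
  next
    fix k1 k2 assume "k1 \<in> carrier (group_on N K)" "k2 \<in> carrier (group_on N K)"
    then show "\<tau> (1\<^sub>m a, 1\<^sub>m b, k1 \<otimes>\<^bsub>group_on N K\<^esub> k2) = \<tau> (1\<^sub>m a, 1\<^sub>m b, k1) \<otimes>\<^bsub>GL q\<^esub> \<tau> (1\<^sub>m a, 1\<^sub>m b, k2)"
      using \<tau>mult[of "(1\<^sub>m a, 1\<^sub>m b, k1)" "(1\<^sub>m a, 1\<^sub>m b, k2)"] one by (simp add: mem mult)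
  qed (use \<tau>GL one mem in auto)
  obtain u0 where u0: "u0 \<in> carrier_vec q" "scalar_prod v u0 = 1"
    "\<And>k'. k' \<in> K \<Longrightarrow> \<tau> (1\<^sub>m a, 1\<^sub>m b, k') *\<^sub>v u0 = \<theta> (1\<^sub>m a, 1\<^sub>m b, k') \<cdot>\<^sub>v u0"
    by (rule reductive_eigenvector[OF red rep vc v0, of "\<lambda>k'. \<theta> (1\<^sub>m a, 1\<^sub>m b, k')"])
      (use v\<tau> one mem in auto)
  obtain u1 where u1: "u1 \<in> carrier_vec q" "scalar_prod v u1 \<noteq> 0"
    "\<And>g. g \<in> carrier (GL a) \<Longrightarrow> \<tau> (g, 1\<^sub>m b, 1\<^sub>m N) *\<^sub>v u1 = (mdet g powi e1) \<cdot>\<^sub>v u1"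
    "\<And>T c. T \<in> carrier_mat q q \<Longrightarrow> (\<And>g. g \<in> carrier (GL a) \<Longrightarrow> T * \<tau> (g, 1\<^sub>m b, 1\<^sub>m N) = \<tau> (g, 1\<^sub>m b, 1\<^sub>m N) * T) \<Longrightarrow>
      T *\<^sub>v u0 = c \<cdot>\<^sub>v u0 \<Longrightarrow> T *\<^sub>v u1 = c \<cdot>\<^sub>v u1"
  proof (rule GL_average[of a "\<lambda>g. \<tau> (g, 1\<^sub>m b, 1\<^sub>m N)" q v u0 e1])
    fix g g' assume "g \<in> carrier (GL a)" "g' \<in> carrier (GL a)"
    then show "\<tau> (g * g', 1\<^sub>m b, 1\<^sub>m N) = \<tau> (g, 1\<^sub>m b, 1\<^sub>m N) * \<tau> (g', 1\<^sub>m b, 1\<^sub>m N)"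
      using \<tau>mult[of "(g, 1\<^sub>m b, 1\<^sub>m N)" "(g', 1\<^sub>m b, 1\<^sub>m N)"] one by (simp add: mem mult)
  next
    fix i j assume "i < q" "j < q"
    then show "reg (GL_coords a) (carrier (GL a)) (\<lambda>g. \<tau> (g, 1\<^sub>m b, 1\<^sub>m N) $$ (i, j))"
      using regs(1)[of j "ms ! i"] by (simp add: \<tau>e)
  next
    fix g and u :: "complex vec" assume "g \<in> carrier (GL a)" "u \<in> carrier_vec q"
    then show "scalar_prod v (\<tau> (g, 1\<^sub>m b, 1\<^sub>m N) *\<^sub>v u) = mdet g powi e1 * scalar_prod v u"
      using v\<tau>[of "(g, 1\<^sub>m b, 1\<^sub>m N)" u] one by (simp add: mem \<theta>1)
  qed (use \<tau>c vc u0 in auto)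
  have u1K: "\<tau> (1\<^sub>m a, 1\<^sub>m b, k') *\<^sub>v u1 = \<theta> (1\<^sub>m a, 1\<^sub>m b, k') \<cdot>\<^sub>v u1" if k': "k' \<in> K" for k'
  proof (rule u1(4)[OF \<tau>c _ u0(3)[OF k']])
    fix g assume g: "g \<in> carrier (GL a)"
    show "\<tau> (1\<^sub>m a, 1\<^sub>m b, k') * \<tau> (g, 1\<^sub>m b, 1\<^sub>m N) = \<tau> (g, 1\<^sub>m b, 1\<^sub>m N) * \<tau> (1\<^sub>m a, 1\<^sub>m b, k')"
      using g k' one cm[OF g] cm[OF KGL[OF k']] by (intro comm) (simp_all add: mem mult)
  qed
  obtain u2 where u2: "u2 \<in> carrier_vec q" "scalar_prod v u2 \<noteq> 0"
    "\<And>h. h \<in> carrier (GL b) \<Longrightarrow> \<tau> (1\<^sub>m a, h, 1\<^sub>m N) *\<^sub>v u2 = (mdet h powi e2) \<cdot>\<^sub>v u2"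
    "\<And>T c. T \<in> carrier_mat q q \<Longrightarrow> (\<And>h. h \<in> carrier (GL b) \<Longrightarrow> T * \<tau> (1\<^sub>m a, h, 1\<^sub>m N) = \<tau> (1\<^sub>m a, h, 1\<^sub>m N) * T) \<Longrightarrow>
      T *\<^sub>v u1 = c \<cdot>\<^sub>v u1 \<Longrightarrow> T *\<^sub>v u2 = c \<cdot>\<^sub>v u2"
  proof (rule GL_average[of b "\<lambda>h. \<tau> (1\<^sub>m a, h, 1\<^sub>m N)" q v u1 e2])
    fix g g' assume "g \<in> carrier (GL b)" "g' \<in> carrier (GL b)"
    then show "\<tau> (1\<^sub>m a, g * g', 1\<^sub>m N) = \<tau> (1\<^sub>m a, g, 1\<^sub>m N) * \<tau> (1\<^sub>m a, g', 1\<^sub>m N)"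
      using \<tau>mult[of "(1\<^sub>m a, g, 1\<^sub>m N)" "(1\<^sub>m a, g', 1\<^sub>m N)"] one by (simp add: mem mult)
  next
    fix i j assume "i < q" "j < q"
    then show "reg (GL_coords b) (carrier (GL b)) (\<lambda>h. \<tau> (1\<^sub>m a, h, 1\<^sub>m N) $$ (i, j))"
      using regs(2)[of j "ms ! i"] by (simp add: \<tau>e)
  next
    fix h and u :: "complex vec" assume "h \<in> carrier (GL b)" "u \<in> carrier_vec q"
    then show "scalar_prod v (\<tau> (1\<^sub>m a, h, 1\<^sub>m N) *\<^sub>v u) = mdet h powi e2 * scalar_prod v u"
      using v\<tau>[of "(1\<^sub>m a, h, 1\<^sub>m N)" u] one by (simp add: mem \<theta>2)
  qed (use \<tau>c vc u1 in auto)
  have u2K: "\<tau> (1\<^sub>m a, 1\<^sub>m b, k') *\<^sub>v u2 = \<theta> (1\<^sub>m a, 1\<^sub>m b, k') \<cdot>\<^sub>v u2" if k': "k' \<in> K" for k'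
  proof (rule u2(4)[OF \<tau>c _ u1K[OF k']])
    fix h assume h: "h \<in> carrier (GL b)"
    show "\<tau> (1\<^sub>m a, 1\<^sub>m b, k') * \<tau> (1\<^sub>m a, h, 1\<^sub>m N) = \<tau> (1\<^sub>m a, h, 1\<^sub>m N) * \<tau> (1\<^sub>m a, 1\<^sub>m b, k')"
      using h k' one cm[OF h] cm[OF KGL[OF k']] by (intro comm) (simp_all add: mem mult)
  qed
  have u2A: "\<tau> (g, 1\<^sub>m b, 1\<^sub>m N) *\<^sub>v u2 = (mdet g powi e1) \<cdot>\<^sub>v u2" if g: "g \<in> carrier (GL a)" for g
  proof (rule u2(4)[OF \<tau>c _ u1(3)[OF g]])
    fix h assume h: "h \<in> carrier (GL b)"
    show "\<tau> (g, 1\<^sub>m b, 1\<^sub>m N) * \<tau> (1\<^sub>m a, h, 1\<^sub>m N) = \<tau> (1\<^sub>m a, h, 1\<^sub>m N) * \<tau> (g, 1\<^sub>m b, 1\<^sub>m N)"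
      using g h one cm[OF g] cm[OF h] by (intro comm) (simp_all add: mem mult)
  qed
  \<comment> \<open>An eigenvector of all three factors is one of the group. The eigenvalue must be
    \<open>\<theta> x\<close>, since the pairing with v is non-zero and transforms by
    \<theta>.\<close>
  have u2G: "\<tau> x *\<^sub>v u2 = \<theta> x \<cdot>\<^sub>v u2" if x: "x \<in> carrier G" for x
  proof -
    obtain g h k' where xe: "x = (g, h, k')" by (cases x)
    have m: "g \<in> carrier (GL a)" "h \<in> carrier (GL b)" "k' \<in> K" using x by (simp_all add: xe mem)
    have e1: "\<tau> (g, h, k') = \<tau> (g, 1\<^sub>m b, 1\<^sub>m N) * \<tau> (1\<^sub>m a, h, k')"
      using \<tau>mult[of "(g, 1\<^sub>m b, 1\<^sub>m N)" "(1\<^sub>m a, h, k')"] m one cm[OF m(1)] cm[OF m(2)] cm[OF KGL[OF m(3)]]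
      by (simp add: mem mult)
    have e2: "\<tau> (1\<^sub>m a, h, k') = \<tau> (1\<^sub>m a, h, 1\<^sub>m N) * \<tau> (1\<^sub>m a, 1\<^sub>m b, k')"
      using \<tau>mult[of "(1\<^sub>m a, h, 1\<^sub>m N)" "(1\<^sub>m a, 1\<^sub>m b, k')"] m one cm[OF m(2)] cm[OF KGL[OF m(3)]]
      by (simp add: mem mult)
    have "\<tau> (1\<^sub>m a, h, k') *\<^sub>v u2 = (\<theta> (1\<^sub>m a, 1\<^sub>m b, k') * (mdet h powi e2)) \<cdot>\<^sub>v u2"
      unfolding e2 assoc_mult_mat_vec[OF \<tau>c \<tau>c u2(1)] u2K[OF m(3)] mult_mat_vec[OF \<tau>c u2(1)] u2(3)[OF m(2)]
      by (simp add: smult_smult_assoc)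
    then have "\<exists>c. \<tau> x *\<^sub>v u2 = c \<cdot>\<^sub>v u2"
      unfolding xe e1 assoc_mult_mat_vec[OF \<tau>c \<tau>c u2(1)]
      by (auto simp: mult_mat_vec[OF \<tau>c u2(1)] u2A[OF m(1)] smult_smult_assoc)
    then obtain c where c: "\<tau> x *\<^sub>v u2 = c \<cdot>\<^sub>v u2" by blast
    have "c * scalar_prod v u2 = \<theta> x * scalar_prod v u2"
      using v\<tau>[OF x u2(1)] u2(1) vc by (simp add: c scalar_prod_smult_distrib[OF vc])
    then show ?thesis using u2(2) c by simp
  qed
  have "semi_invariant G act I \<theta> (polyv u2)"
    unfolding semi_invariant_iff[OF act]
  proof (intro conjI ballI polyvI)
    fix x assume x: "x \<in> carrier G"
    have "lin I (S x) (polyv u2) = polyv (\<theta> x \<cdot>\<^sub>v u2)"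
      using polyv_\<tau>[OF u2(1), of x] by (simp add: u2G[OF x])
    also have "\<dots> = Const (\<theta> x) * polyv u2"
      using u2(1) by (simp add: polyv_def sum_distrib_left Const_mult mult.assoc)
    finally show "lin I (act_mat act (inv\<^bsub>G\<^esub> x)) (polyv u2) = Const (\<theta> x) * polyv u2" by (simp add: S_def)
  qed
  then show ?thesis using polyvD u2(1,2) by (auto simp: G_def vp)
qed

text \<open>Biduality: the dual of the dual action has the original matrices on \<open>I\<close>, so
  \<open>reductive_pairing\<close> applies with u in the role of w and with inverted
  weights.\<close>

theorem reductive_pairing_dual:
  assumes K: "subgroup K (GL N)" and red: "reductive N K" and fin: "finite I"
    and rat: "rational_action a b N K act I"
    and u: "u \<noteq> 0" "homogeneous D u" "semi_invariant (prod_group a b N K) act I \<theta> u"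
    and \<theta>1: "\<And>g. g \<in> carrier (GL a) \<Longrightarrow> \<theta> (g, 1\<^sub>m b, 1\<^sub>m N) = mdet g powi e1"
    and \<theta>2: "\<And>h. h \<in> carrier (GL b) \<Longrightarrow> \<theta> (1\<^sub>m a, h, 1\<^sub>m N) = mdet h powi e2"
  shows "\<exists>w. semi_invariant (prod_group a b N K) (dual_act (prod_group a b N K) act I) I (\<lambda>x. inverse (\<theta> x)) w
    \<and> homogeneous D w \<and> apolar w u \<noteq> 0"
proof -
  let ?G = "prod_group a b N K"
  let ?d = "dual_act ?G act I"
  have act: "linear_action ?G act I" using rat by (simp add: rational_action_def)
  interpret G: group ?G using act by (simp add: linear_action_def)
  have uI: "u \<in> polys I" using u(3) by (rule semi_invariant_polys)
  have "lin I (\<lambda>i k. act_mat ?d g k i) u = Const (\<theta> g) * u" if "g \<in> carrier ?G" for g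
  proof -
    have "lin I (\<lambda>i k. act_mat ?d g k i) u = lin I (act_mat act (inv\<^bsub>?G\<^esub> g)) u"
      by (rule lin_cong[OF uI]) (simp add: act_mat_dual[OF fin])
    also have "\<dots> = Const (\<theta> g) * u"
      by (rule bspec[OF conjunct2[OF u(3)[unfolded semi_invariant_iff[OF act]]] that])
    finally show ?thesis .
  qed
  then have "semi_invariant ?G (dual_act ?G ?d I) I (\<lambda>x. inverse (inverse (\<theta> x))) u"
    unfolding semi_invariant_dual_iff[OF fin linear_action_dual[OF fin act]] using uI by simp
  from reductive_pairing[OF K red fin rational_action_dual[OF rat K fin] u(1,2) this, of "- e1" "- e2"]
  show ?thesis by (auto simp: \<theta>1 \<theta>2 power_int_minus apolar_commute[of u])
qed

section \<open>The actions on \<open>V\<close> and \<open>F\<close>\<close>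

lemma linear_actionI:
  assumes G: "group \<G>"
    and closed: "\<And>g x. g \<in> carrier \<G> \<Longrightarrow> x \<in> cspace I \<Longrightarrow> act g x \<in> cspace I"
    and lin: "\<And>g x i. g \<in> carrier \<G> \<Longrightarrow> x \<in> cspace I \<Longrightarrow> i \<in> I \<Longrightarrow> act g x i = (\<Sum>k\<in>I. act_mat act g i k * x k)"
    and one: "\<And>x. x \<in> cspace I \<Longrightarrow> act \<one>\<^bsub>\<G>\<^esub> x = x"
    and mult: "\<And>g h x. g \<in> carrier \<G> \<Longrightarrow> h \<in> carrier \<G> \<Longrightarrow> x \<in> cspace I \<Longrightarrow> act (g \<otimes>\<^bsub>\<G>\<^esub> h) x = act g (act h x)"
  shows "linear_action \<G> act I"
proof -
  have e: "(\<lambda>j. if j = k then 1 else 0) \<in> cspace I" if "k \<in> I" for k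
    using that by (auto simp: cspace_def)
  have "act_mat act \<one>\<^bsub>\<G>\<^esub> i k = (if k = i then 1 else 0)" if "i \<in> I" "k \<in> I" for i k
    using one[OF e[OF that(2)]] by (simp add: act_mat_def)
  moreover have "act_mat act (g \<otimes>\<^bsub>\<G>\<^esub> h) i k = (\<Sum>j\<in>I. act_mat act g i j * act_mat act h j k)"
    if "g \<in> carrier \<G>" "h \<in> carrier \<G>" "i \<in> I" "k \<in> I" for g h i k
    using lin[OF that(1) closed[OF that(2) e[OF that(4)]] that(3)] mult[OF that(1,2) e[OF that(4)]]
    by (simp add: act_mat_def)
  ultimately show ?thesis using G closed lin by (simp add: linear_action_def)
qed

lemma GL_transpose: "g \<in> carrier (GL a) \<Longrightarrow> transpose_mat g \<in> carrier (GL a)"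
  using det_transpose[of g a] by (simp add: GL_carrier_iff)

lemma GL_inv_inv: "g \<in> carrier (GL a) \<Longrightarrow> inv\<^bsub>GL a\<^esub> (inv\<^bsub>GL a\<^esub> g) = g"
  by (rule group.inv_inv[OF group_GL])

lemma GL_inv_mult: "g \<in> carrier (GL a) \<Longrightarrow> h \<in> carrier (GL a) \<Longrightarrow> inv\<^bsub>GL a\<^esub> (g * h) = inv\<^bsub>GL a\<^esub> h * inv\<^bsub>GL a\<^esub> g"
  using group.inv_mult_group[OF group_GL, of g a h] by simp

lemma GL_inv_transpose:
  assumes "g \<in> carrier (GL a)"
  shows "inv\<^bsub>GL a\<^esub> (transpose_mat g) = transpose_mat (inv\<^bsub>GL a\<^esub> g)"
proof -
  have c: "g \<in> carrier_mat a a" "inv\<^bsub>GL a\<^esub> g \<in> carrier_mat a a"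
    using assms GL_inv(1)[OF assms] by (simp_all add: GL_carrier_iff)
  have "transpose_mat (inv\<^bsub>GL a\<^esub> g) * transpose_mat g = 1\<^sub>m a"
    using transpose_mult[OF c] GL_inv(2)[OF assms] by simp
  then show ?thesis
    using GL_transpose[OF assms] GL_transpose[OF GL_inv(1)[OF assms]]
    by (intro group.inv_equality[OF group_GL]) simp_all
qed

lemma GL_carrier_mat: "g \<in> carrier (GL a) \<Longrightarrow> g \<in> carrier_mat a a"
  by (simp add: GL_carrier_iff)

lemma triple_entry:
  assumes "A \<in> carrier_mat m m" "X \<in> carrier_mat m n" "B \<in> carrier_mat n n" "i < m" "j < n"
  shows "(A * X * B) $$ (i, j) = (\<Sum>i'<m. \<Sum>j'<n. A $$ (i, i') * X $$ (i', j') * (B $$ (j', j) :: complex))"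
  using assms by (simp add: scalar_prod_def atLeast0LessThan sum_distrib_left mult.assoc)

lemma sum_V_index:
  "(\<Sum>c\<in>V_index m n p. F c) = (\<Sum>i<m. \<Sum>j<n. F (Inl (i, j))) + (\<Sum>s<p. F (Inr s))"
proof -
  have "(\<Sum>c\<in>V_index m n p. F c) = (\<Sum>c\<in>Inl ` ({..<m} \<times> {..<n}). F c) + (\<Sum>c\<in>Inr ` {..<p}. F c)"
    unfolding V_index_def by (rule sum.union_disjoint) auto
  also have "(\<Sum>c\<in>Inl ` ({..<m} \<times> {..<n}). F c) = (\<Sum>i<m. \<Sum>j<n. F (Inl (i, j)))"
    by (subst sum.reindex) (simp_all add: sum.cartesian_product)
  also have "(\<Sum>c\<in>Inr ` {..<p}. F c) = (\<Sum>s<p. F (Inr s))"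
    by (subst sum.reindex) simp_all
  finally show ?thesis .
qed

lemma finite_V_index: "finite (V_index m n p)"
  by (simp add: V_index_def)

lemma V_point_cspace: "V_point m n p X y \<in> cspace (V_index m n p)"
  by (auto simp: cspace_def V_point_def V_index_def split: sum.split)

lemma mat_V_point: "X \<in> carrier_mat m n \<Longrightarrow> mat m n (\<lambda>(i, j). V_point m n p X y (Inl (i, j))) = X"
  by (rule eq_matI) (auto simp: V_point_def)

lemma vec_V_point: "y \<in> carrier_vec p \<Longrightarrow> vec p (\<lambda>k. V_point m n p X y (Inr k)) = y"
  by (rule eq_vecI) (auto simp: V_point_def)

lemma V_point_eta: "x \<in> cspace (V_index m n p) \<Longrightarrow>
    V_point m n p (mat m n (\<lambda>(i, j). x (Inl (i, j)))) (vec p (\<lambda>k. x (Inr k))) = x"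
  by (auto simp: fun_eq_iff V_point_def V_index_def cspace_def split: sum.split)

locale gl_rep =
  fixes m n N p :: nat and K :: "complex mat set" and \<rho> :: "complex mat \<times> complex mat \<Rightarrow> complex mat"
  assumes mn: "m \<le> n" and K: "subgroup K (GL N)"
    and rho: "rational_rep (GL n \<times>\<times> group_on N K) (GL_prod_coords n N) p \<rho>"
begin

abbreviation "actV \<equiv> act_V m n p \<rho>"
abbreviation "actF \<equiv> act_F m n p \<rho>"
abbreviation "VI \<equiv> V_index m n p"
abbreviation "block h1 h2 \<equiv> four_block_mat h1 (0\<^sub>m m (n - m)) (0\<^sub>m (n - m) m) h2"

lemmas Kf = subgroup_GL_facts[OF K]

lemma rho_GL: "h \<in> carrier (GL n) \<Longrightarrow> k \<in> K \<Longrightarrow> \<rho> (h, k) \<in> carrier (GL p)"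
  using rho by (auto simp: rational_rep_def hom_def)

lemma rho_mat: "h \<in> carrier (GL n) \<Longrightarrow> k \<in> K \<Longrightarrow> \<rho> (h, k) \<in> carrier_mat p p"
  using rho_GL GL_carrier_mat by blast

lemma rho_mult:
  assumes "h \<in> carrier (GL n)" "k \<in> K" "h' \<in> carrier (GL n)" "k' \<in> K"
  shows "\<rho> (h * h', k * k') = \<rho> (h, k) * \<rho> (h', k')"
proof -
  have "\<rho> ((h, k) \<otimes>\<^bsub>GL n \<times>\<times> group_on N K\<^esub> (h', k')) = \<rho> (h, k) \<otimes>\<^bsub>GL p\<^esub> \<rho> (h', k')"
    using rho assms unfolding rational_rep_def by (intro hom_mult[of \<rho> "GL n \<times>\<times> group_on N K"]) auto
  then show ?thesis by (simp add: mult_DirProd)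
qed

lemma rho_one: "\<rho> (1\<^sub>m n, 1\<^sub>m N) = 1\<^sub>m p"
proof -
  have "\<rho> \<one>\<^bsub>GL n \<times>\<times> group_on N K\<^esub> = \<one>\<^bsub>GL p\<^esub>"
    using rho unfolding rational_rep_def
    by (intro hom_one DirProd_group group_GL group_group_on[OF K]) auto
  then show ?thesis by (simp add: one_DirProd)
qed

lemma rho_inv_apply:
  assumes "h \<in> carrier (GL n)" "k \<in> K" "y \<in> carrier_vec p"
  shows "\<rho> (inv\<^bsub>GL n\<^esub> h, inv\<^bsub>GL N\<^esub> k) *\<^sub>v (\<rho> (h, k) *\<^sub>v y) = y"
proof -
  have kG: "k \<in> carrier (GL N)" using assms(2) Kf(2) by blast
  have "\<rho> (inv\<^bsub>GL n\<^esub> h, inv\<^bsub>GL N\<^esub> k) *\<^sub>v (\<rho> (h, k) *\<^sub>v y) = (\<rho> (inv\<^bsub>GL n\<^esub> h, inv\<^bsub>GL N\<^esub> k) * \<rho> (h, k)) *\<^sub>v y"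
    using assms by (intro assoc_mult_mat_vec[of _ p p _ p, symmetric] rho_mat GL_inv Kf)
  also have "\<dots> = y"
    using assms kG by (simp add: rho_mult[symmetric] GL_inv Kf rho_one)
  finally show ?thesis .
qed

lemma rho_reg_comp:
  assumes "\<And>x. x \<in> S \<Longrightarrow> A x \<in> carrier (GL n) \<and> B x \<in> K"
    and "\<And>i j. i < n \<Longrightarrow> j < n \<Longrightarrow> reg C S (\<lambda>x. A x $$ (i, j))" "reg C S (\<lambda>x. inverse (mdet (A x)))"
    and "\<And>i j. i < N \<Longrightarrow> j < N \<Longrightarrow> reg C S (\<lambda>x. B x $$ (i, j))" "reg C S (\<lambda>x. inverse (mdet (B x)))"
    and "i < p" "j < p"
  shows "reg C S (\<lambda>x. \<rho> (A x, B x) $$ (i, j))"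
proof (rule reg_comp[of "GL_prod_coords n N" "carrier (GL n) \<times> K" "\<lambda>z. \<rho> z $$ (i, j)" S "\<lambda>x. (A x, B x)"])
  show "reg (GL_prod_coords n N) (carrier (GL n) \<times> K) (\<lambda>z. \<rho> z $$ (i, j))"
    using rho assms(6,7) by (simp add: rational_rep_def reg_def)
next
  fix \<phi> assume "\<phi> \<in> GL_prod_coords n N"
  then show "reg C S (\<lambda>x. \<phi> (A x, B x))"
    unfolding GL_prod_coords_def GL_coords_def using assms(2-5) by (auto simp: o_def)
qed (use assms(1) in auto)

lemma actV_eq: "actV (g, h, k) x = V_point m n p
    (inv\<^bsub>GL m\<^esub> (transpose_mat g) * mat m n (\<lambda>(i, j). x (Inl (i, j))) * inv\<^bsub>GL n\<^esub> h)
    (\<rho> (h, k) *\<^sub>v vec p (\<lambda>k. x (Inr k)))"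
  by (simp add: act_V_def)

lemma actV_Inl:
  assumes "g \<in> carrier (GL m)" "h \<in> carrier (GL n)" "i < m" "j < n"
  shows "actV (g, h, k) x (Inl (i, j)) =
    (\<Sum>i'<m. \<Sum>j'<n. (inv\<^bsub>GL m\<^esub> (transpose_mat g)) $$ (i, i') * x (Inl (i', j')) * (inv\<^bsub>GL n\<^esub> h) $$ (j', j))"
proof -
  let ?X = "mat m n (\<lambda>(i, j). x (Inl (i, j)))"
  let ?A = "inv\<^bsub>GL m\<^esub> (transpose_mat g)" and ?B = "inv\<^bsub>GL n\<^esub> h"
  have "actV (g, h, k) x (Inl (i, j)) = (?A * ?X * ?B) $$ (i, j)"
    using assms(3,4) by (simp add: actV_eq V_point_def del: index_mult_mat(1))
  also have "\<dots> = (\<Sum>i'<m. \<Sum>j'<n. ?A $$ (i, i') * ?X $$ (i', j') * ?B $$ (j', j))"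
    using assms by (intro triple_entry GL_carrier_mat GL_inv GL_transpose) auto
  finally show ?thesis by simp
qed

lemma actV_Inr:
  assumes "h \<in> carrier (GL n)" "k \<in> K" "r < p"
  shows "actV (g, h, k) x (Inr r) = (\<Sum>s<p. \<rho> (h, k) $$ (r, s) * x (Inr s))"
  using assms rho_mat[OF assms(1,2)]
  by (simp add: actV_eq V_point_def scalar_prod_def atLeast0LessThan)

lemma act_mat_V:
  assumes x: "g \<in> carrier (GL m)" "h \<in> carrier (GL n)" "k \<in> K"
  shows "i < m \<Longrightarrow> j < n \<Longrightarrow> i' < m \<Longrightarrow> j' < n \<Longrightarrow> act_mat actV (g, h, k) (Inl (i, j)) (Inl (i', j')) =
      (inv\<^bsub>GL m\<^esub> (transpose_mat g)) $$ (i, i') * (inv\<^bsub>GL n\<^esub> h) $$ (j', j)"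
    "i < m \<Longrightarrow> j < n \<Longrightarrow> act_mat actV (g, h, k) (Inl (i, j)) (Inr s) = 0"
    "r < p \<Longrightarrow> act_mat actV (g, h, k) (Inr r) (Inl c) = 0"
    "r < p \<Longrightarrow> s < p \<Longrightarrow> act_mat actV (g, h, k) (Inr r) (Inr s) = \<rho> (h, k) $$ (r, s)"
proof -
  assume ij: "i < m" "j < n" "i' < m" "j' < n"
  let ?A = "inv\<^bsub>GL m\<^esub> (transpose_mat g)" and ?B = "inv\<^bsub>GL n\<^esub> h"
  have "(\<Sum>b<n. ?A $$ (i, a) * (if Inl (a, b) = (Inl (i', j') :: vcoord) then 1 else 0) * ?B $$ (b, j)) =
      (if a = i' then ?A $$ (i, i') * ?B $$ (j', j) else 0)" for a
  proof -
    have "(\<Sum>b<n. ?A $$ (i, a) * (if Inl (a, b) = (Inl (i', j') :: vcoord) then 1 else 0) * ?B $$ (b, j)) =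
        (\<Sum>b<n. if b = j' then (if a = i' then ?A $$ (i, i') * ?B $$ (j', j) else 0) else 0)"
      by (rule sum.cong) auto
    then show ?thesis using ij by simp
  qed
  then show "act_mat actV (g, h, k) (Inl (i, j)) (Inl (i', j')) = ?A $$ (i, i') * ?B $$ (j', j)"
    using ij by (simp only: act_mat_def actV_Inl[OF x(1,2) ij(1,2)]) simp
next
  assume "i < m" "j < n"
  then show "act_mat actV (g, h, k) (Inl (i, j)) (Inr s) = 0"
    by (simp add: act_mat_def actV_Inl[OF x(1,2)])
next
  assume "r < p"
  then show "act_mat actV (g, h, k) (Inr r) (Inl c) = 0"
    by (simp add: act_mat_def actV_Inr[OF x(2,3)])
next
  assume rs: "r < p" "s < p"
  have "(\<Sum>s'<p. \<rho> (h, k) $$ (r, s') * (if Inr s' = (Inr s :: vcoord) then 1 else 0)) =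
      (\<Sum>s'<p. if s' = s then \<rho> (h, k) $$ (r, s) else 0)"
    by (rule sum.cong) auto
  then show "act_mat actV (g, h, k) (Inr r) (Inr s) = \<rho> (h, k) $$ (r, s)"
    using rs by (simp add: act_mat_def actV_Inr[OF x(2,3)])
qed

lemma linear_action_V: "linear_action (prod_group m n N K) actV VI"
proof (rule linear_actionI)
  show "group (prod_group m n N K)" by (rule group_prod_group[OF K])
next
  fix x y assume "x \<in> carrier (prod_group m n N K)"
  show "actV x y \<in> cspace VI" by (cases x) (simp only: actV_eq V_point_cspace)
next
  fix x y c assume x: "x \<in> carrier (prod_group m n N K)" and y: "y \<in> cspace VI" and c: "c \<in> VI"
  obtain g h k where xe: "x = (g, h, k)" by (cases x)
  have gh: "g \<in> carrier (GL m)" "h \<in> carrier (GL n)" "k \<in> K" using x by (simp_all add: xe)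
  show "actV x y c = (\<Sum>c'\<in>VI. act_mat actV x c c' * y c')"
  proof (cases c)
    case (Inl a)
    then obtain i j where ij: "c = Inl (i, j)" "i < m" "j < n" using c by (auto simp: V_index_def)
    show ?thesis
      using ij by (simp add: xe sum_V_index act_mat_V[OF gh] actV_Inl[OF gh(1,2)] mult_ac)
  next
    case (Inr r)
    then have r: "r < p" using c by (auto simp: V_index_def)
    then show ?thesis
      by (simp add: xe Inr sum_V_index act_mat_V[OF gh] actV_Inr[OF gh(2,3)])
  qed
next
  fix x assume x: "x \<in> cspace VI"
  show "actV \<one>\<^bsub>prod_group m n N K\<^esub> x = x"
    by (simp add: one_DirProd actV_eq rho_one GL_inv_one V_point_eta[OF x])
next
  fix x y and z :: "vcoord \<Rightarrow> complex" assume "x \<in> carrier (prod_group m n N K)" "y \<in> carrier (prod_group m n N K)"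
  moreover obtain g h k g' h' k' where xy: "x = (g, h, k)" "y = (g', h', k')" by (cases x, cases y)
  ultimately have gh: "g \<in> carrier (GL m)" "h \<in> carrier (GL n)" "k \<in> K"
    "g' \<in> carrier (GL m)" "h' \<in> carrier (GL n)" "k' \<in> K" by simp_all
  let ?X = "mat m n (\<lambda>(i, j). z (Inl (i, j)))" and ?y = "vec p (\<lambda>k. z (Inr k))"
  let ?A = "inv\<^bsub>GL m\<^esub> (transpose_mat g)" and ?A' = "inv\<^bsub>GL m\<^esub> (transpose_mat g')"
  let ?B = "inv\<^bsub>GL n\<^esub> h" and ?B' = "inv\<^bsub>GL n\<^esub> h'"
  have c: "?A \<in> carrier_mat m m" "?A' \<in> carrier_mat m m" "?B \<in> carrier_mat n n" "?B' \<in> carrier_mat n n"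
    "?X \<in> carrier_mat m n"
    using gh by (auto intro!: GL_carrier_mat GL_inv GL_transpose)
  have A: "inv\<^bsub>GL m\<^esub> (transpose_mat (g * g')) = ?A * ?A'"
    using gh by (simp add: transpose_mult[OF GL_carrier_mat GL_carrier_mat] GL_inv_mult GL_transpose)
  have B: "inv\<^bsub>GL n\<^esub> (h * h') = ?B' * ?B" using gh by (simp add: GL_inv_mult)
  have X: "?A * ?A' * ?X * (?B' * ?B) = ?A * (?A' * ?X * ?B') * ?B"
  proof -
    have 1: "?A * ?A' * ?X = ?A * (?A' * ?X)" using c by (intro assoc_mult_mat) auto
    have 2: "?A * (?A' * ?X) * (?B' * ?B) = (?A * (?A' * ?X) * ?B') * ?B"
      using c by (intro assoc_mult_mat[symmetric]) (auto intro: mult_carrier_mat)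
    have 3: "?A * (?A' * ?X) * ?B' = ?A * (?A' * ?X * ?B')"
      using c by (intro assoc_mult_mat) (auto intro: mult_carrier_mat)
    show ?thesis unfolding 1 2 3 ..
  qed
  have XB: "?A' * ?X * ?B' \<in> carrier_mat m n" using c by (auto intro: mult_carrier_mat)
  have R: "\<rho> (h * h', k * k') *\<^sub>v ?y = \<rho> (h, k) *\<^sub>v (\<rho> (h', k') *\<^sub>v ?y)"
    unfolding rho_mult[OF gh(2,3,5,6)]
    using gh by (intro assoc_mult_mat_vec[of _ p p _ p] rho_mat) auto
  have Ry: "\<rho> (h', k') *\<^sub>v ?y \<in> carrier_vec p" using gh by (intro mult_mat_vec_carrier[of _ p p] rho_mat) auto
  show "actV (x \<otimes>\<^bsub>prod_group m n N K\<^esub> y) z = actV x (actV y z)"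
    unfolding xy prod_group_mult actV_eq A B X R mat_V_point[OF XB] vec_V_point[OF Ry] ..
qed

lemma rational_action_V: "rational_action m n N K actV VI"
  unfolding rational_action_def
proof (intro conjI ballI linear_action_V)
  fix c c' assume c: "c \<in> VI" "c' \<in> VI"
  note one = GL_one_mem Kf(1)
  let ?S = "carrier (GL m)"
  show "reg (GL_coords m) ?S (\<lambda>g. act_mat actV (g, 1\<^sub>m n, 1\<^sub>m N) c c')"
  proof -
    have "reg (GL_coords m) ?S (\<lambda>g. (inv\<^bsub>GL m\<^esub> (transpose_mat g)) $$ (i, i'))" if i: "i < m" "i' < m" for i i'
    proof -
      have "reg (GL_coords m) ?S (\<lambda>g. (inv\<^bsub>GL m\<^esub> g) $$ (i', i))" using i by (intro reg_inv_entry) auto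
      then show ?thesis
      proof (rule reg_cong[THEN iffD2, rotated])
        fix g assume g: "g \<in> ?S"
        show "(inv\<^bsub>GL m\<^esub> (transpose_mat g)) $$ (i, i') = (inv\<^bsub>GL m\<^esub> g) $$ (i', i)"
          using i GL_carrier_mat[OF GL_inv(1)[OF g]] by (simp add: GL_inv_transpose[OF g])
      qed
    qed
    then have "reg (GL_coords m) ?S (\<lambda>g. (inv\<^bsub>GL m\<^esub> (transpose_mat g)) $$ (i, i') * (inv\<^bsub>GL n\<^esub> (1\<^sub>m n)) $$ (j', j))"
      if "i < m" "i' < m" for i i' j j' using that by (intro reg_mult reg_const)
    then show ?thesis
      using c one by (auto simp: V_index_def act_mat_V reg_const cong: reg_cong)
  qed
  let ?S = "carrier (GL n)"
  show "reg (GL_coords n) ?S (\<lambda>h. act_mat actV (1\<^sub>m m, h, 1\<^sub>m N) c c')"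
  proof -
    have "reg (GL_coords n) ?S (\<lambda>h. (inv\<^bsub>GL m\<^esub> (transpose_mat (1\<^sub>m m))) $$ (i, i') * (inv\<^bsub>GL n\<^esub> h) $$ (j', j))"
      if "j < n" "j' < n" for i i' j j' using that by (intro reg_mult reg_const reg_inv_entry) auto
    moreover have "reg (GL_coords n) ?S (\<lambda>h. \<rho> (h, 1\<^sub>m N) $$ (r, s))" if "r < p" "s < p" for r s
      using that one by (intro rho_reg_comp) (auto intro: reg_entry reg_inverse_det reg_const)
    ultimately show ?thesis
      using c one by (auto simp: V_index_def act_mat_V reg_const cong: reg_cong)
  qed
  show "reg (GL_coords N) K (\<lambda>k. act_mat actV (1\<^sub>m m, 1\<^sub>m n, k) c c')"
  proof -
    have "reg (GL_coords N) K (\<lambda>k. \<rho> (1\<^sub>m n, k) $$ (r, s))" if "r < p" "s < p" for r s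
      using that one by (intro rho_reg_comp) (auto intro: reg_entry reg_inverse_det reg_const)
    then show ?thesis
      using c one by (auto simp: V_index_def act_mat_V reg_const cong: reg_cong)
  qed
qed

section \<open>The block-diagonal subgroup and its action on F\<close>

lemma block_GL:
  assumes "h1 \<in> carrier (GL m)" "h2 \<in> carrier (GL (n - m))"
  shows "block h1 h2 \<in> carrier (GL n)" "mdet (block h1 h2) = mdet h1 * mdet h2"
proof -
  have c: "h1 \<in> carrier_mat m m" "h2 \<in> carrier_mat (n - m) (n - m)" using assms by (auto intro: GL_carrier_mat)
  show d: "mdet (block h1 h2) = mdet h1 * mdet h2"
    using c by (intro det_four_block_mat_upper_right_zero[of _ m _ "n - m"]) auto
  show "block h1 h2 \<in> carrier (GL n)"
    using four_block_carrier_mat[OF c, of "0\<^sub>m m (n - m)" "0\<^sub>m (n - m) m"] mn assms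
    by (auto simp: GL_carrier_iff d)
qed

lemma block_mult:
  assumes "h1 \<in> carrier (GL m)" "h2 \<in> carrier (GL (n - m))" "h1' \<in> carrier (GL m)" "h2' \<in> carrier (GL (n - m))"
  shows "block (h1 * h1') (h2 * h2') = block h1 h2 * block h1' h2'"
proof -
  have c: "h1 \<in> carrier_mat m m" "h2 \<in> carrier_mat (n - m) (n - m)"
    "h1' \<in> carrier_mat m m" "h2' \<in> carrier_mat (n - m) (n - m)" using assms by (auto intro: GL_carrier_mat)
  have z: "0\<^sub>m m (n - m) \<in> carrier_mat m (n - m)" "0\<^sub>m (n - m) m \<in> carrier_mat (n - m) m" by auto
  have "block h1 h2 * block h1' h2' = four_block_mat (h1 * h1' + 0\<^sub>m m (n - m) * 0\<^sub>m (n - m) m)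
      (h1 * 0\<^sub>m m (n - m) + 0\<^sub>m m (n - m) * h2') (0\<^sub>m (n - m) m * h1' + h2 * 0\<^sub>m (n - m) m)
      (0\<^sub>m (n - m) m * 0\<^sub>m m (n - m) + h2 * h2')"
    by (rule mult_four_block_mat[OF c(1) z c(2) c(3) z c(4)])
  also have "\<dots> = block (h1 * h1') (h2 * h2')"
    using c by (simp add: right_mult_zero_mat[of _ m m] right_mult_zero_mat[of _ "n - m" "n - m"]
        left_mult_zero_mat[of _ _ m] left_mult_zero_mat[of _ _ "n - m"])
  finally show ?thesis by simp
qed

lemma block_one: "block (1\<^sub>m m) (1\<^sub>m (n - m)) = 1\<^sub>m n"
  using mn by simp

lemma block_inv:
  assumes "h1 \<in> carrier (GL m)" "h2 \<in> carrier (GL (n - m))"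
  shows "inv\<^bsub>GL n\<^esub> (block h1 h2) = block (inv\<^bsub>GL m\<^esub> h1) (inv\<^bsub>GL (n - m)\<^esub> h2)"
proof -
  have "block (inv\<^bsub>GL m\<^esub> h1) (inv\<^bsub>GL (n - m)\<^esub> h2) * block h1 h2 = 1\<^sub>m n"
    using assms by (simp only: block_mult[symmetric] GL_inv block_one)
  then show ?thesis
    using block_GL(1)[OF assms] block_GL(1)[OF GL_inv(1)[OF assms(1)] GL_inv(1)[OF assms(2)]]
    by (intro group.inv_equality[OF group_GL]) simp_all
qed

lemma actF_eq: "actF (h1, h2, k) y = (\<lambda>r. if r < p then (\<rho> (block h1 h2, k) *\<^sub>v vec p y) $ r else 0)"
  by (simp add: act_F_def fun_eq_iff)

lemma actF_sum:
  assumes "h1 \<in> carrier (GL m)" "h2 \<in> carrier (GL (n - m))" "k \<in> K" "r < p"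
  shows "actF (h1, h2, k) y r = (\<Sum>s<p. \<rho> (block h1 h2, k) $$ (r, s) * y s)"
  using assms rho_mat[OF block_GL(1)[OF assms(1,2)] assms(3)]
  by (simp add: actF_eq scalar_prod_def atLeast0LessThan)

lemma act_mat_F:
  assumes "h1 \<in> carrier (GL m)" "h2 \<in> carrier (GL (n - m))" "k \<in> K" "r < p" "s < p"
  shows "act_mat actF (h1, h2, k) r s = \<rho> (block h1 h2, k) $$ (r, s)"
proof -
  have "(\<Sum>s'<p. \<rho> (block h1 h2, k) $$ (r, s') * (if s' = s then 1 else 0)) =
      (\<Sum>s'<p. if s' = s then \<rho> (block h1 h2, k) $$ (r, s) else 0)"
    by (rule sum.cong) auto
  then show ?thesis using assms by (simp add: act_mat_def actF_sum)
qed

lemma linear_action_F: "linear_action (prod_group m (n - m) N K) actF {..<p}"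
proof (rule linear_actionI)
  show "group (prod_group m (n - m) N K)" by (rule group_prod_group[OF K])
next
  fix x y assume "x \<in> carrier (prod_group m (n - m) N K)"
  show "actF x y \<in> cspace {..<p}" by (cases x) (simp add: actF_eq cspace_def)
next
  fix x y r assume "x \<in> carrier (prod_group m (n - m) N K)" "r \<in> {..<p}"
  then show "actF x y r = (\<Sum>s\<in>{..<p}. act_mat actF x r s * y s)"
    by (cases x) (simp add: actF_sum act_mat_F)
next
  fix x assume x: "x \<in> cspace {..<p}"
  show "actF \<one>\<^bsub>prod_group m (n - m) N K\<^esub> x = x"
    unfolding prod_group_one actF_eq block_one rho_one using x by (auto simp: cspace_def)
next
  fix x y z assume "x \<in> carrier (prod_group m (n - m) N K)" "y \<in> carrier (prod_group m (n - m) N K)"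
  moreover obtain g h k g' h' k' where xy: "x = (g, h, k)" "y = (g', h', k')" by (cases x, cases y)
  ultimately have gh: "g \<in> carrier (GL m)" "h \<in> carrier (GL (n - m))" "k \<in> K"
    "g' \<in> carrier (GL m)" "h' \<in> carrier (GL (n - m))" "k' \<in> K" by simp_all
  note b = block_GL(1)[OF gh(1,2)] block_GL(1)[OF gh(4,5)]
  have Ry: "\<rho> (block g' h', k') *\<^sub>v vec p z \<in> carrier_vec p"
    using gh b by (intro mult_mat_vec_carrier[of _ p p] rho_mat) auto
  have e: "vec p (\<lambda>r. if r < p then (\<rho> (block g' h', k') *\<^sub>v vec p z) $ r else 0) = \<rho> (block g' h', k') *\<^sub>v vec p z"
    by (rule eq_vecI) (use carrier_vecD[OF Ry] in \<open>simp_all del: index_mult_mat_vec dim_mult_mat_vec\<close>)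
  have R: "\<rho> (block (g * g') (h * h'), k * k') *\<^sub>v vec p z = \<rho> (block g h, k) *\<^sub>v (\<rho> (block g' h', k') *\<^sub>v vec p z)"
    unfolding block_mult[OF gh(1,2,4,5)] rho_mult[OF b(1) gh(3) b(2) gh(6)]
    using gh b by (intro assoc_mult_mat_vec[of _ p p _ p] rho_mat) auto
  show "actF (x \<otimes>\<^bsub>prod_group m (n - m) N K\<^esub> y) z = actF x (actF y z)"
    unfolding xy prod_group_mult actF_eq e R ..
qed

lemma rational_action_F: "rational_action m (n - m) N K actF {..<p}"
  unfolding rational_action_def
proof (intro conjI ballI linear_action_F)
  fix r s assume rs: "r \<in> {..<p}" "s \<in> {..<p}"
  note one = GL_one_mem Kf(1)
  have b1: "reg (GL_coords m) (carrier (GL m)) (\<lambda>g. block g (1\<^sub>m (n - m)) $$ (i, j))" if "i < n" "j < n" for i j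
  proof -
    have "reg (GL_coords m) (carrier (GL m)) (\<lambda>g. if i < m then if j < m then g $$ (i, j) else 0
        else if j < m then 0 else 1\<^sub>m (n - m) $$ (i - m, j - m))"
      by (cases "i < m"; cases "j < m") (simp_all add: reg_entry reg_const)
    then show ?thesis
      by (rule reg_cong[THEN iffD2, rotated]) (use that mn in \<open>auto simp: GL_carrier_iff\<close>)
  qed
  have b2: "reg (GL_coords (n - m)) (carrier (GL (n - m))) (\<lambda>h. block (1\<^sub>m m) h $$ (i, j))" if "i < n" "j < n" for i j
  proof -
    have "reg (GL_coords (n - m)) (carrier (GL (n - m))) (\<lambda>h. if i < m then if j < m then 1\<^sub>m m $$ (i, j) else 0
        else if j < m then 0 else h $$ (i - m, j - m))"
      using that by (cases "i < m"; cases "j < m") (simp_all add: reg_entry reg_const)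
    then show ?thesis
      by (rule reg_cong[THEN iffD2, rotated]) (use that mn in \<open>auto simp: GL_carrier_iff\<close>)
  qed
  have d1: "reg (GL_coords m) (carrier (GL m)) (\<lambda>g. inverse (mdet (block g (1\<^sub>m (n - m)))))"
    using reg_inverse_det[of m "carrier (GL m)"]
    by (rule reg_cong[THEN iffD2, rotated]) (simp add: block_GL(2) one)
  have d2: "reg (GL_coords (n - m)) (carrier (GL (n - m))) (\<lambda>h. inverse (mdet (block (1\<^sub>m m) h)))"
    using reg_inverse_det[of "n - m" "carrier (GL (n - m))"]
    by (rule reg_cong[THEN iffD2, rotated]) (simp add: block_GL(2) one)
  have "reg (GL_coords m) (carrier (GL m)) (\<lambda>g. \<rho> (block g (1\<^sub>m (n - m)), 1\<^sub>m N) $$ (r, s))"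
    using rs one by (intro rho_reg_comp b1 d1) (auto intro: reg_const block_GL)
  then show "reg (GL_coords m) (carrier (GL m)) (\<lambda>g. act_mat actF (g, 1\<^sub>m (n - m), 1\<^sub>m N) r s)"
    by (rule reg_cong[THEN iffD2, rotated]) (use rs one in \<open>simp add: act_mat_F\<close>)
  have "reg (GL_coords (n - m)) (carrier (GL (n - m))) (\<lambda>h. \<rho> (block (1\<^sub>m m) h, 1\<^sub>m N) $$ (r, s))"
    using rs one by (intro rho_reg_comp b2 d2) (auto intro: reg_const block_GL)
  then show "reg (GL_coords (n - m)) (carrier (GL (n - m))) (\<lambda>h. act_mat actF (1\<^sub>m m, h, 1\<^sub>m N) r s)"
    by (rule reg_cong[THEN iffD2, rotated]) (use rs one in \<open>simp add: act_mat_F\<close>)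
  have "reg (GL_coords N) K (\<lambda>k. \<rho> (1\<^sub>m n, k) $$ (r, s))"
    using rs one by (intro rho_reg_comp) (auto intro: reg_entry reg_inverse_det reg_const)
  then show "reg (GL_coords N) K (\<lambda>k. act_mat actF (1\<^sub>m m, 1\<^sub>m (n - m), k) r s)"
    by (rule reg_cong[THEN iffD2, rotated]) (use rs one in \<open>simp add: act_mat_F mn\<close>)
qed

end

section \<open>The slice\<close>

lemma sum_lessThan_split: "(\<Sum>k<a + b. F k) = (\<Sum>k<a. F k) + (\<Sum>k<b. F (a + k :: nat) :: 'x::comm_monoid_add)"
  by (induction b) (simp_all add: add.assoc)

context gl_rep
begin

abbreviation "J \<equiv> mat m n (\<lambda>(i, j). if i = j then 1 else 0) :: complex mat"
abbreviation "G \<equiv> prod_group m n N K"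
abbreviation "H \<equiv> prod_group m (n - m) N K"

lemma J_mult_entry:
  assumes "h \<in> carrier_mat n n" "i < m" "j < n" shows "(J * h) $$ (i, j) = h $$ (i, j)"
proof -
  have "(J * h) $$ (i, j) = (\<Sum>k<n. (if i = k then 1 else 0) * h $$ (k, j))"
    using assms by (simp add: scalar_prod_def atLeast0LessThan)
  also have "\<dots> = (\<Sum>k<n. if k = i then h $$ (i, j) else 0)"
    by (rule sum.cong) auto
  finally show ?thesis using assms mn by simp
qed

lemma mult_J_entry:
  assumes "A \<in> carrier_mat m m" "i < m" "j < n" shows "(A * J) $$ (i, j) = (if j < m then A $$ (i, j) else 0)"
proof -
  have "(A * J) $$ (i, j) = (\<Sum>k<m. A $$ (i, k) * (if k = j then 1 else 0))"
    using assms by (simp add: scalar_prod_def atLeast0LessThan)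
  also have "\<dots> = (\<Sum>k<m. if k = j then A $$ (i, j) else 0)"
    by (rule sum.cong) auto
  finally show ?thesis using assms by simp
qed

text \<open>The reason why block-diagonal matrices stabilize the base point: on the right of
  \<open>J\<close> they act through their first block, which can be undone from the left.\<close>

lemma J_block:
  assumes "h1 \<in> carrier_mat m m" "h2 \<in> carrier_mat (n - m) (n - m)"
  shows "J * block h1 h2 = h1 * J"
proof (rule eq_matI)
  have b: "block h1 h2 \<in> carrier_mat n n" using four_block_carrier_mat[OF assms] mn by simp
  fix i j assume "i < dim_row (h1 * J)" "j < dim_col (h1 * J)"
  then have ij: "i < m" "j < n" using assms by auto
  show "(J * block h1 h2) $$ (i, j) = (h1 * J) $$ (i, j)"
    unfolding J_mult_entry[OF b ij] mult_J_entry[OF assms(1) ij] using ij assms mn by auto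
qed (use assms mn in auto)

section \<open>Semi-invariants in matrix form and their restriction to the slice\<close>

lemma semi_invariant_V:
  assumes Q: "semi_invariant G actV VI \<theta> Q"
    and x: "g \<in> carrier (GL m)" "h \<in> carrier (GL n)" "k \<in> K" and Z: "Z \<in> carrier_mat m n" and y: "y \<in> carrier_vec p"
  shows "eval Q (V_point m n p (transpose_mat g * Z * h) (\<rho> (inv\<^bsub>GL n\<^esub> h, inv\<^bsub>GL N\<^esub> k) *\<^sub>v y)) =
    \<theta> (g, h, k) * eval Q (V_point m n p Z y)"
proof -
  have "eval Q (actV (inv\<^bsub>G\<^esub> (g, h, k)) (V_point m n p Z y)) = \<theta> (g, h, k) * eval Q (V_point m n p Z y)"
    using Q x V_point_cspace[of m n p Z y] unfolding semi_invariant_def by auto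
  then show ?thesis
    unfolding prod_group_inv[OF K x] actV_eq mat_V_point[OF Z] vec_V_point[OF y]
      GL_inv_transpose[OF GL_inv(1)[OF x(1)]] GL_inv_inv[OF x(1)] GL_inv_inv[OF x(2)] .
qed

text \<open>Compare with \<open>semi_invariant_V\<close>: the same triple takes X to g^t X h there
  and \<Xi> to g^(-1) \<Xi> (h^(-1))^t here, so \<Xi> X^t is conjugated, while the two matrices on F
  are inverse transposes of each other.\<close>

lemma dual_semi_invariant_V:
  assumes P: "semi_invariant G (dual_act G actV VI) VI \<tau> P"
    and x: "g \<in> carrier (GL m)" "h \<in> carrier (GL n)" "k \<in> K" and Z: "Z \<in> carrier_mat m n" and y: "y \<in> carrier_vec p"
  shows "eval P (V_point m n p (inv\<^bsub>GL m\<^esub> g * Z * transpose_mat (inv\<^bsub>GL n\<^esub> h)) (transpose_mat (\<rho> (h, k)) *\<^sub>v y)) =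
    \<tau> (g, h, k) * eval P (V_point m n p Z y)"
proof -
  let ?x = "(g, h, k)" and ?z = "V_point m n p Z y"
  let ?A = "inv\<^bsub>GL m\<^esub> g" and ?B = "inv\<^bsub>GL n\<^esub> h"
  have c: "?A \<in> carrier_mat m m" "transpose_mat ?B \<in> carrier_mat n n" "?B \<in> carrier_mat n n"
    using x by (auto intro!: GL_carrier_mat GL_inv GL_transpose)
  have r: "\<rho> (h, k) \<in> carrier_mat p p" by (rule rho_mat[OF x(2,3)])
  have PI: "P \<in> polys VI" using P by (rule semi_invariant_polys)
  have "lin VI (\<lambda>c c'. act_mat actV ?x c' c) P = Const (\<tau> ?x) * P"
    using P x unfolding semi_invariant_dual_iff[OF finite_V_index linear_action_V] by auto
  from arg_cong[OF this, of "\<lambda>Q. eval Q ?z"]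
  have 1: "eval P (\<lambda>c. \<Sum>c'\<in>VI. act_mat actV ?x c' c * ?z c') = \<tau> ?x * eval P ?z"
    unfolding eval_lin eval.ins_mult eval.ins_Const .
  have 2: "(\<Sum>c'\<in>VI. act_mat actV ?x c' c * ?z c') =
      V_point m n p (?A * Z * transpose_mat ?B) (transpose_mat (\<rho> (h, k)) *\<^sub>v y) c" if c': "c \<in> VI" for c
  proof (cases c)
    case (Inl a)
    then obtain i j where ij: "c = Inl (i, j)" "i < m" "j < n" using c' by (auto simp: V_index_def)
    have "(\<Sum>c'\<in>VI. act_mat actV ?x c' c * ?z c') =
        (\<Sum>i'<m. \<Sum>j'<n. ?A $$ (i, i') * Z $$ (i', j') * transpose_mat ?B $$ (j', j))"
      using ij c by (simp add: sum_V_index act_mat_V[OF x] GL_inv_transpose[OF x(1)] V_point_def mult_ac)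
    also have "\<dots> = (?A * Z * transpose_mat ?B) $$ (i, j)"
      by (rule triple_entry[symmetric, OF c(1) Z c(2) ij(2,3)])
    finally show ?thesis using ij by (simp add: V_point_def del: index_mult_mat(1))
  next
    case (Inr s)
    then have s: "s < p" using c' by (auto simp: V_index_def)
    then show ?thesis
      using r y by (simp add: Inr sum_V_index act_mat_V[OF x] V_point_def scalar_prod_def atLeast0LessThan)
  qed
  have "eval P (\<lambda>c. \<Sum>c'\<in>VI. act_mat actV ?x c' c * ?z c') =
      eval P (V_point m n p (?A * Z * transpose_mat ?B) (transpose_mat (\<rho> (h, k)) *\<^sub>v y))"
    by (rule eval_cong[OF PI]) (rule 2)
  then show ?thesis using 1 by simp
qed

lemma eval_fibre_V:
  assumes "Q \<in> polys VI"
  shows "eval (fibre Z Q) y = eval Q (V_point m n p (mat m n Z) (vec p y))"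
  unfolding eval_fibre
  by (rule eval_cong[OF assms]) (auto simp: V_index_def V_point_def)

lemma polys_fibre: "Q \<in> polys VI \<Longrightarrow> fibre Z Q \<in> polys {..<p}"
  unfolding fibre_def by (rule polys_subst) (auto simp: V_index_def polys_Var)

lemma slice_eq_fibre: "slice Q = fibre (\<lambda>(i, j). if i = j then 1 else 0) Q"
proof -
  have "(\<lambda>c :: vcoord. case c of Inl (i, j) \<Rightarrow> if i = j then 1 else 0 | Inr k \<Rightarrow> (Var k :: nat mpoly)) =
      case_sum (\<lambda>a. Const (case a of (i, j) \<Rightarrow> if i = j then 1 else 0)) Var"
    by (auto simp: fun_eq_iff split: sum.split)
  then show ?thesis by (simp add: slice_def fibre_def)
qed

lemma polys_slice: "Q \<in> polys VI \<Longrightarrow> slice Q \<in> polys {..<p}"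
  unfolding slice_eq_fibre by (rule polys_fibre)

lemma eval_slice: "Q \<in> polys VI \<Longrightarrow> eval (slice Q) y = eval Q (V_point m n p J (vec p y))"
  unfolding slice_eq_fibre by (rule eval_fibre_V)

text \<open>The triple on the right is the element of G over (h1, h2, k) that fixes the base point;
  its first component has determinant 1 / det h1.\<close>

definition slice_weight ::
  "(complex mat \<times> complex mat \<times> complex mat \<Rightarrow> complex) \<Rightarrow> complex mat \<times> complex mat \<times> complex mat \<Rightarrow> complex" where
  "slice_weight \<theta> = (\<lambda>(h1, h2, k). \<theta> (transpose_mat (inv\<^bsub>GL m\<^esub> h1), block h1 h2, k))"

lemma semi_invariant_slice:
  assumes Q: "semi_invariant G actV VI \<theta> Q"
  shows "semi_invariant H actF {..<p} (slice_weight \<theta>) (slice Q)"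
  unfolding semi_invariant_def
proof (intro conjI ballI)
  have QI: "Q \<in> polys VI" using Q by (rule semi_invariant_polys)
  then show "slice Q \<in> polys {..<p}" by (rule polys_slice)
  fix x y assume "x \<in> carrier H"
  moreover obtain h1 h2 k where xe: "x = (h1, h2, k)" by (cases x)
  ultimately have x: "h1 \<in> carrier (GL m)" "h2 \<in> carrier (GL (n - m))" "k \<in> K" by simp_all
  have c: "h1 \<in> carrier_mat m m" "h2 \<in> carrier_mat (n - m) (n - m)" "inv\<^bsub>GL m\<^esub> h1 \<in> carrier_mat m m"
    using x by (auto intro!: GL_carrier_mat GL_inv)
  note b = block_GL(1)[OF x(1,2)]
  have bc: "block h1 h2 \<in> carrier_mat n n" using b by (rule GL_carrier_mat)
  have g: "transpose_mat (inv\<^bsub>GL m\<^esub> h1) \<in> carrier (GL m)" by (intro GL_transpose GL_inv x)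
  have Jb: "transpose_mat (transpose_mat (inv\<^bsub>GL m\<^esub> h1)) * J * block h1 h2 = J"
  proof -
    have "inv\<^bsub>GL m\<^esub> h1 * J * block h1 h2 = inv\<^bsub>GL m\<^esub> h1 * (h1 * J)"
      using c bc by (subst assoc_mult_mat[of _ m m _ n _ n]) (auto simp: J_block)
    also have "\<dots> = inv\<^bsub>GL m\<^esub> h1 * h1 * J"
      using c by (intro assoc_mult_mat[symmetric]) auto
    also have "\<dots> = J" by (simp add: GL_inv[OF x(1)])
    finally show ?thesis by simp
  qed
  let ?r = "\<rho> (inv\<^bsub>GL n\<^esub> (block h1 h2), inv\<^bsub>GL N\<^esub> k) *\<^sub>v vec p y"
  have "?r \<in> carrier_vec p"
    by (intro mult_mat_vec_carrier[of _ p p] rho_mat GL_inv b Kf x) simp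
  then have v: "vec p (\<lambda>r. if r < p then ?r $ r else 0) = ?r"
    by (intro eq_vecI) (simp_all del: index_mult_mat_vec dim_mult_mat_vec)
  have "eval (slice Q) (actF (inv\<^bsub>H\<^esub> x) y) = eval Q (V_point m n p J ?r)"
    unfolding xe prod_group_inv[OF K x] actF_eq eval_slice[OF QI] block_inv[OF x(1,2), symmetric] v ..
  also have "\<dots> = slice_weight \<theta> x * eval Q (V_point m n p J (vec p y))"
    using semi_invariant_V[OF Q g b x(3), of J "vec p y"] unfolding Jb by (simp add: xe slice_weight_def)
  finally show "eval (slice Q) (actF (inv\<^bsub>H\<^esub> x) y) = slice_weight \<theta> x * eval (slice Q) y"
    by (simp add: eval_slice[OF QI])
qed

lemma vec_transpose_apply:
  assumes "A \<in> carrier_mat p p"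
  shows "vec p (\<lambda>r. \<Sum>s<p. A $$ (s, r) * y s) = transpose_mat A *\<^sub>v vec p y"
    "vec p (\<lambda>r. \<Sum>s<p. A $$ (r, s) * y s) = A *\<^sub>v vec p y"
  by (rule eq_vecI; use assms in \<open>simp add: scalar_prod_def atLeast0LessThan\<close>)+

text \<open>The same base point serves on the dual side, because transposes and inverses of
  block-diagonal matrices are again block-diagonal.\<close>

lemma dual_semi_invariant_slice:
  assumes P: "semi_invariant G (dual_act G actV VI) VI \<tau> P"
  shows "semi_invariant H (dual_act H actF {..<p}) {..<p} (slice_weight \<tau>) (slice P)"
  unfolding semi_invariant_dual_iff[OF finite_lessThan linear_action_F]
proof (intro conjI ballI)
  have PI: "P \<in> polys VI" using P by (rule semi_invariant_polys)
  then show sI: "slice P \<in> polys {..<p}" by (rule polys_slice)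
  fix x assume "x \<in> carrier H"
  moreover obtain h1 h2 k where xe: "x = (h1, h2, k)" by (cases x)
  ultimately have x: "h1 \<in> carrier (GL m)" "h2 \<in> carrier (GL (n - m))" "k \<in> K" by simp_all
  have c: "h1 \<in> carrier_mat m m" "h2 \<in> carrier_mat (n - m) (n - m)" "inv\<^bsub>GL m\<^esub> h1 \<in> carrier_mat m m"
    "inv\<^bsub>GL (n - m)\<^esub> h2 \<in> carrier_mat (n - m) (n - m)"
    using x by (auto intro!: GL_carrier_mat GL_inv)
  note b = block_GL(1)[OF x(1,2)]
  have g: "transpose_mat (inv\<^bsub>GL m\<^esub> h1) \<in> carrier (GL m)" by (intro GL_transpose GL_inv x)
  have Jb: "inv\<^bsub>GL m\<^esub> (transpose_mat (inv\<^bsub>GL m\<^esub> h1)) * J * transpose_mat (inv\<^bsub>GL n\<^esub> (block h1 h2)) = J"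
  proof -
    have t: "transpose_mat (inv\<^bsub>GL n\<^esub> (block h1 h2)) =
        block (transpose_mat (inv\<^bsub>GL m\<^esub> h1)) (transpose_mat (inv\<^bsub>GL (n - m)\<^esub> h2))"
      unfolding block_inv[OF x(1,2)] using c by (subst transpose_four_block_mat[of _ m m _ "n - m" _ "n - m"]) auto
    have bc: "block (transpose_mat (inv\<^bsub>GL m\<^esub> h1)) (transpose_mat (inv\<^bsub>GL (n - m)\<^esub> h2)) \<in> carrier_mat n n"
      using four_block_carrier_mat[of "transpose_mat (inv\<^bsub>GL m\<^esub> h1)" m m "transpose_mat (inv\<^bsub>GL (n - m)\<^esub> h2)" "n - m" "n - m"] c mn
      by simp
    have i: "inv\<^bsub>GL m\<^esub> (transpose_mat (inv\<^bsub>GL m\<^esub> h1)) = transpose_mat h1"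
      by (simp add: GL_inv_transpose GL_inv GL_inv_inv x)
    have "transpose_mat h1 * J * block (transpose_mat (inv\<^bsub>GL m\<^esub> h1)) (transpose_mat (inv\<^bsub>GL (n - m)\<^esub> h2)) =
        transpose_mat h1 * (transpose_mat (inv\<^bsub>GL m\<^esub> h1) * J)"
      using c bc by (subst assoc_mult_mat[of _ m m _ n _ n]) (auto simp: J_block)
    also have "\<dots> = transpose_mat h1 * transpose_mat (inv\<^bsub>GL m\<^esub> h1) * J"
      using c by (intro assoc_mult_mat[symmetric]) auto
    also have "transpose_mat h1 * transpose_mat (inv\<^bsub>GL m\<^esub> h1) = 1\<^sub>m m"
      using transpose_mult[OF c(3) c(1)] by (simp add: GL_inv[OF x(1)])
    finally show ?thesis unfolding t i by simp
  qed
  note r = rho_mat[OF b x(3)]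
  show "lin {..<p} (\<lambda>i k. act_mat actF x k i) (slice P) = Const (slice_weight \<tau> x) * slice P"
  proof (rule eval_eqI[of _ "{..<p}"])
    fix y :: "nat \<Rightarrow> complex"
    have "lin {..<p} (\<lambda>i s. act_mat actF x s i) (slice P) = lin {..<p} (\<lambda>i s. \<rho> (block h1 h2, k) $$ (s, i)) (slice P)"
      by (rule lin_cong[OF sI]) (simp add: xe act_mat_F[OF x])
    then have "eval (lin {..<p} (\<lambda>i k. act_mat actF x k i) (slice P)) y =
        eval P (V_point m n p J (transpose_mat (\<rho> (block h1 h2, k)) *\<^sub>v vec p y))"
      by (simp add: eval_lin eval_slice[OF PI] vec_transpose_apply(1)[OF r])
    also have "\<dots> = slice_weight \<tau> x * eval P (V_point m n p J (vec p y))"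
      using dual_semi_invariant_V[OF P g b x(3), of J "vec p y"] unfolding Jb by (simp add: xe slice_weight_def)
    finally show "eval (lin {..<p} (\<lambda>i k. act_mat actF x k i) (slice P)) y = eval (Const (slice_weight \<tau> x) * slice P) y"
      by (simp add: eval.ins_mult eval_slice[OF PI])
  qed (intro polys_lin polys_mult polys_Const sI)+
qed

text \<open>The \<open>G\<close>-translates of the slice are dense: they contain every point with invertible left block.\<close>

lemma slice_eq_0:
  assumes Q: "semi_invariant G actV VI \<theta> Q" and s: "slice Q = 0"
  shows "Q = 0"
proof -
  have QI: "Q \<in> polys VI" using Q by (rule semi_invariant_polys)
  define R where "R = subst (\<lambda>c. Var (Inl c) :: vcoord mpoly) (det_poly m)"
  have Re: "eval R x = mdet (mat m m (\<lambda>(i, j). x (Inl (i, j))))" for x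
  proof -
    have "(\<lambda>(i, j). x (Inl (i, j))) = (\<lambda>c. x (Inl c))" by auto
    then show ?thesis by (simp add: R_def eval_subst eval_det_poly)
  qed
  have RI: "R \<in> polys VI" unfolding R_def
    by (rule polys_subst[OF polys_det_poly]) (use mn in \<open>auto simp: V_index_def intro!: polys_Var\<close>)
  have "mat m m (\<lambda>(i, j). V_point m n p J (0\<^sub>v p) (Inl (i, j))) = 1\<^sub>m m"
    by (rule eq_matI) (use mn in \<open>auto simp: V_point_def\<close>)
  then have "eval R (V_point m n p J (0\<^sub>v p)) = 1" by (simp add: Re)
  then have R0: "R \<noteq> 0" by auto
  show ?thesis
  proof (rule eval_eqI_generic[OF QI polys_zero RI R0])
    fix x assume x: "x \<in> cspace VI" "eval R x \<noteq> 0"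
    let ?X = "mat m n (\<lambda>(i, j). x (Inl (i, j)))" and ?y = "vec p (\<lambda>k. x (Inr k))"
    let ?A = "mat m m (\<lambda>(i, j). x (Inl (i, j)))" and ?B = "mat m (n - m) (\<lambda>(i, j). x (Inl (i, j + m)))"
    \<comment> \<open>Completes X to an invertible matrix with first m rows X, so that
      \<open>J * h\<close> is X; its determinant is that of the left block.\<close>
    define h where "h = four_block_mat ?A ?B (0\<^sub>m (n - m) m) (1\<^sub>m (n - m))"
    have hc: "h \<in> carrier_mat n n"
      using four_block_carrier_mat[of ?A m m "1\<^sub>m (n - m)" "n - m" "n - m"] mn by (simp add: h_def)
    have "mdet h = mdet ?A * mdet (1\<^sub>m (n - m))"
      unfolding h_def by (rule det_four_block_mat_lower_left_zero[of _ m _ "n - m"]) auto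
    then have h: "h \<in> carrier (GL n)" using hc x(2) by (simp add: GL_carrier_iff Re)
    have Jh: "J * h = ?X"
    proof (rule eq_matI)
      fix i j assume "i < dim_row ?X" "j < dim_col ?X"
      then have ij: "i < m" "j < n" by auto
      show "(J * h) $$ (i, j) = ?X $$ (i, j)"
        unfolding J_mult_entry[OF hc ij] using ij mn by (simp add: h_def)
    qed (use hc in auto)
    let ?y' = "\<rho> (h, 1\<^sub>m N) *\<^sub>v ?y"
    have y': "?y' \<in> carrier_vec p" using h Kf by (intro mult_mat_vec_carrier[of _ p p] rho_mat) auto
    have "eval Q (V_point m n p (transpose_mat (1\<^sub>m m) * J * h)
        (\<rho> (inv\<^bsub>GL n\<^esub> h, inv\<^bsub>GL N\<^esub> (1\<^sub>m N)) *\<^sub>v ?y')) = \<theta> (1\<^sub>m m, h, 1\<^sub>m N) * eval Q (V_point m n p J ?y')"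
      by (rule semi_invariant_V[OF Q GL_one_mem h Kf(1) _ y']) simp
    moreover have "transpose_mat (1\<^sub>m m) * J * h = ?X" using Jh by simp
    moreover have "\<rho> (inv\<^bsub>GL n\<^esub> h, inv\<^bsub>GL N\<^esub> (1\<^sub>m N)) *\<^sub>v ?y' = ?y" by (rule rho_inv_apply[OF h Kf(1)]) simp
    moreover have "V_point m n p ?X ?y = x" by (rule V_point_eta[OF x(1)])
    moreover have "eval Q (V_point m n p J ?y') = eval (slice Q) (\<lambda>r. ?y' $ r)"
    proof -
      have "vec p (\<lambda>r. ?y' $ r) = ?y'"
        using carrier_vecD[OF y'] by (intro eq_vecI) (simp_all del: index_mult_mat_vec dim_mult_mat_vec)
      then show ?thesis by (simp add: eval_slice[OF QI])
    qed
    ultimately show "eval Q x = eval 0 x" using s by simp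
  qed
qed

text \<open>The first m rows of h must be those of X. The remaining rows are chosen orthogonal to
  the rows of \<Xi>, so that \<Xi> h^t is T followed by zero columns, which is T J.\<close>

lemma generic_pair:
  fixes \<Xi> X :: "nat \<times> nat \<Rightarrow> complex"
  assumes C0: "mdet (mat m m \<Xi>) \<noteq> 0" and T0: "mdet (mat m m (\<lambda>(i, j). \<Sum>k<n. \<Xi> (i, k) * X (j, k))) \<noteq> 0"
  obtains h T where "h \<in> carrier (GL n)" "T \<in> carrier (GL m)" "T = mat m m (\<lambda>(i, j). \<Sum>k<n. \<Xi> (i, k) * X (j, k))"
    "J * h = mat m n X" "T * J * transpose_mat (inv\<^bsub>GL n\<^esub> h) = mat m n \<Xi>"
proof -
  define q where "q = n - m"
  have nq: "n = m + q" using mn by (simp add: q_def)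
  define A B C D where "A = mat m m X" and "B = mat m q (\<lambda>(i, j). X (i, m + j))"
    and "C = mat m m \<Xi>" and "D = mat m q (\<lambda>(i, j). \<Xi> (i, m + j))"
  have ABCD [simp]: "A \<in> carrier_mat m m" "B \<in> carrier_mat m q" "C \<in> carrier_mat m m" "D \<in> carrier_mat m q"
    by (simp_all add: A_def B_def C_def D_def)
  define T where "T = mat m m (\<lambda>(i, j). \<Sum>k<n. \<Xi> (i, k) * X (j, k))"
  have Tc: "T \<in> carrier_mat m m" by (simp add: T_def)
  have T: "T = C * transpose_mat A + D * transpose_mat B"
    by (rule eq_matI)
      (auto simp: T_def A_def B_def C_def D_def scalar_prod_def atLeast0LessThan nq sum_lessThan_split)
  have CG: "C \<in> carrier (GL m)" using C0 by (simp add: GL_carrier_iff C_def)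
  let ?C' = "inv\<^bsub>GL m\<^esub> C"
  have C': "?C' \<in> carrier_mat m m" by (rule GL_carrier_mat[OF GL_inv(1)[OF CG]])
  have CD: "?C' * D \<in> carrier_mat m q" using C' by (rule mult_carrier_mat) simp
  \<comment> \<open>The solution of C E^t + D = 0, which expresses the orthogonality to \<Xi> of the
    rows (E, 1); this is where the left block of \<Xi> has to be invertible.\<close>
  define E where "E = transpose_mat (- (?C' * D))"
  have Ec: "E \<in> carrier_mat q m" using CD by (simp add: E_def)
  have CE: "C * transpose_mat E + D = 0\<^sub>m m q"
  proof -
    have "C * transpose_mat E = - (C * (?C' * D))"
      using carrier_matD[OF ABCD(3)] carrier_matD[OF C'] by (simp add: E_def)
    also have "C * (?C' * D) = C * ?C' * D" by (rule assoc_mult_mat[OF ABCD(3) C' ABCD(4), symmetric])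
    also have "\<dots> = D" by (simp add: GL_inv[OF CG] left_mult_one_mat[OF ABCD(4)])
    finally show ?thesis by (simp add: uminus_l_inv_mat[OF ABCD(4)])
  qed
  have tc: "transpose_mat A \<in> carrier_mat m m" "transpose_mat B \<in> carrier_mat q m" "transpose_mat C \<in> carrier_mat m m"
    "transpose_mat D \<in> carrier_mat q m" "transpose_mat E \<in> carrier_mat m q"
    using ABCD Ec by (simp_all only: transpose_carrier_mat)
  define h where "h = four_block_mat A B E (1\<^sub>m q)"
  have hc: "h \<in> carrier_mat n n"
    using four_block_carrier_mat[of A m m "1\<^sub>m q" q q] by (simp add: h_def nq)
  have ht: "transpose_mat h = four_block_mat (transpose_mat A) (transpose_mat E) (transpose_mat B) (1\<^sub>m q)"
    unfolding h_def using Ec by (subst transpose_four_block_mat[of _ m m _ q _ q]) simp_all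
  have d: "mdet h \<noteq> 0"
  proof -
    \<comment> \<open>Multiplying h by this matrix gives a block triangular one with diagonal blocks
      T^t and 1; as T is invertible, so is h.\<close>
    let ?Y = "four_block_mat (transpose_mat C) (0\<^sub>m m q) (transpose_mat D) (1\<^sub>m q)"
    have Yc: "?Y \<in> carrier_mat n n"
      using four_block_carrier_mat[of "transpose_mat C" m m "1\<^sub>m q" q q] by (simp add: nq)
    have 1: "A * transpose_mat C + B * transpose_mat D = transpose_mat T"
      unfolding T transpose_add[OF mult_carrier_mat[OF ABCD(3) tc(1)] mult_carrier_mat[OF ABCD(4) tc(2)]]
        transpose_mult[OF ABCD(3) tc(1)] transpose_mult[OF ABCD(4) tc(2)] by simp
    have 2: "E * transpose_mat C + 1\<^sub>m q * transpose_mat D = 0\<^sub>m q m"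
    proof -
      have "transpose_mat (C * transpose_mat E + D) = E * transpose_mat C + transpose_mat D"
        unfolding transpose_add[OF mult_carrier_mat[OF ABCD(3) tc(5)] ABCD(4)] transpose_mult[OF ABCD(3) tc(5)] by simp
      then show ?thesis by (simp add: CE left_mult_one_mat[OF tc(4)])
    qed
    have "h * ?Y = four_block_mat (transpose_mat T) (A * 0\<^sub>m m q + B * 1\<^sub>m q) (0\<^sub>m q m) (E * 0\<^sub>m m q + 1\<^sub>m q * 1\<^sub>m q)"
      unfolding h_def 1[symmetric] 2[symmetric]
      by (rule mult_four_block_mat[OF ABCD(1,2) Ec one_carrier_mat tc(3) zero_carrier_mat tc(4) one_carrier_mat])
    moreover have "E * 0\<^sub>m m q + 1\<^sub>m q * 1\<^sub>m q = 1\<^sub>m q" by (simp add: right_mult_zero_mat[OF Ec])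
    moreover have "A * 0\<^sub>m m q + B * 1\<^sub>m q = B" by (simp add: right_mult_zero_mat[OF ABCD(1)] right_mult_one_mat[OF ABCD(2)])
    ultimately have hY: "h * ?Y = four_block_mat (transpose_mat T) B (0\<^sub>m q m) (1\<^sub>m q)" by simp
    have "mdet h * mdet ?Y = mdet (h * ?Y)" using det_mult[OF hc Yc] by simp
    also have "\<dots> = mdet (transpose_mat T) * mdet (1\<^sub>m q)"
      unfolding hY using Tc by (intro det_four_block_mat_lower_left_zero[of _ m _ q]) auto
    also have "\<dots> \<noteq> 0" using T0 det_transpose[OF Tc] by (simp add: T_def)
    finally show ?thesis by auto
  qed
  have h: "h \<in> carrier (GL n)" using hc d by (simp add: GL_carrier_iff)
  have TG: "T \<in> carrier (GL m)" using Tc T0 by (simp add: GL_carrier_iff T_def)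
  have Jh: "J * h = mat m n X"
  proof (rule eq_matI)
    fix i j assume "i < dim_row (mat m n X)" "j < dim_col (mat m n X)"
    then have ij: "i < m" "j < n" by auto
    show "(J * h) $$ (i, j) = mat m n X $$ (i, j)"
      unfolding J_mult_entry[OF hc ij] using ij by (auto simp: h_def A_def B_def nq)
  qed (use hc in auto)
  have X: "mat m n \<Xi> * transpose_mat h = T * J"
  proof -
    \<comment> \<open>Empty lower blocks turn matrices with m rows into four-block matrices, so that
      the block product formula applies.\<close>
    let ?z = "0\<^sub>m 0 m" and ?z' = "0\<^sub>m 0 q :: complex mat"
    have x1: "mat m n \<Xi> = four_block_mat C D ?z ?z'"
      by (rule eq_matI) (auto simp: C_def D_def nq)
    have j1: "T * J = four_block_mat T (0\<^sub>m m q) ?z ?z'"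
    proof (rule eq_matI)
      fix i j assume "i < dim_row (four_block_mat T (0\<^sub>m m q) ?z ?z')" "j < dim_col (four_block_mat T (0\<^sub>m m q) ?z ?z')"
      then have ij: "i < m" "j < n" using Tc by (auto simp: nq)
      show "(T * J) $$ (i, j) = four_block_mat T (0\<^sub>m m q) ?z ?z' $$ (i, j)"
        unfolding mult_J_entry[OF Tc ij] using ij Tc by (auto simp: nq)
    qed (use Tc in \<open>auto simp: nq\<close>)
    have "mat m n \<Xi> * transpose_mat h = four_block_mat (C * transpose_mat A + D * transpose_mat B)
        (C * transpose_mat E + D * 1\<^sub>m q) (?z * transpose_mat A + ?z' * transpose_mat B) (?z * transpose_mat E + ?z' * 1\<^sub>m q)"
      unfolding x1 ht 
        by (rule mult_four_block_mat[OF ABCD(3,4) zero_carrier_mat zero_carrier_mat tc(1) tc(5) tc(2) one_carrier_mat])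
    also have "\<dots> = four_block_mat T (0\<^sub>m m q) ?z ?z'"
    proof (rule cong_four_block_mat)
      show "?z * transpose_mat A + ?z' * transpose_mat B = ?z" by (rule eq_matI) (use ABCD[THEN carrier_matD(1)] in auto)
      show "?z * transpose_mat E + ?z' * 1\<^sub>m q = ?z'" by (rule eq_matI) (use carrier_matD[OF Ec] in auto)
    qed (simp_all add: T CE right_mult_one_mat[OF ABCD(4)])
    finally show ?thesis unfolding j1 .
  qed
  have "T * J * transpose_mat (inv\<^bsub>GL n\<^esub> h) = mat m n \<Xi>"
  proof -
    have hi: "inv\<^bsub>GL n\<^esub> h \<in> carrier_mat n n" by (rule GL_carrier_mat[OF GL_inv(1)[OF h]])
    have "T * J * transpose_mat (inv\<^bsub>GL n\<^esub> h) = mat m n \<Xi> * (transpose_mat h * transpose_mat (inv\<^bsub>GL n\<^esub> h))"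
      unfolding X[symmetric] using hc hi by (intro assoc_mult_mat) auto
    also have "transpose_mat h * transpose_mat (inv\<^bsub>GL n\<^esub> h) = 1\<^sub>m n"
      using transpose_mult[OF hi hc] by (simp add: GL_inv[OF h])
    finally show ?thesis by simp
  qed
  then show thesis using that[OF h TG T_def Jh] by blast
qed

text \<open>Q is moved by (1, h, 1) and P by (T^(-1), h, 1). The substitutions on F are given by
  \<rho>(h, 1) and its transpose, so adjointness cancels them and only the weights remain.\<close>

lemma apolar_fibre:
  assumes P: "semi_invariant G (dual_act G actV VI) VI \<tau> P" and Q: "semi_invariant G actV VI \<theta> Q"
    and h: "h \<in> carrier (GL n)" and T: "T \<in> carrier (GL m)"
    and Jh: "J * h = mat m n X" and TJ: "T * J * transpose_mat (inv\<^bsub>GL n\<^esub> h) = mat m n \<Xi>"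
  shows "apolar (fibre \<Xi> P) (fibre X Q) =
    \<theta> (1\<^sub>m m, h, 1\<^sub>m N) * \<tau> (inv\<^bsub>GL m\<^esub> T, h, 1\<^sub>m N) * apolar (slice P) (slice Q)"
proof -
  have PI: "P \<in> polys VI" and QI: "Q \<in> polys VI" using P Q by (auto intro: semi_invariant_polys)
  note r = rho_mat[OF h Kf(1)]
  define M where "M r s = \<rho> (h, 1\<^sub>m N) $$ (r, s)" for r s
  have fX: "fibre X Q = Const (\<theta> (1\<^sub>m m, h, 1\<^sub>m N)) * lin {..<p} M (slice Q)"
  proof (rule eval_eqI[of _ "{..<p}"])
    fix y :: "nat \<Rightarrow> complex"
    let ?y' = "\<rho> (h, 1\<^sub>m N) *\<^sub>v vec p y"
    have y': "?y' \<in> carrier_vec p" by (rule mult_mat_vec_carrier[OF r]) simp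
    have "eval Q (V_point m n p (transpose_mat (1\<^sub>m m) * J * h)
        (\<rho> (inv\<^bsub>GL n\<^esub> h, inv\<^bsub>GL N\<^esub> (1\<^sub>m N)) *\<^sub>v ?y')) = \<theta> (1\<^sub>m m, h, 1\<^sub>m N) * eval Q (V_point m n p J ?y')"
      by (rule semi_invariant_V[OF Q GL_one_mem h Kf(1) _ y']) simp
    moreover have "transpose_mat (1\<^sub>m m) * J * h = mat m n X" using Jh by simp
    moreover have "\<rho> (inv\<^bsub>GL n\<^esub> h, inv\<^bsub>GL N\<^esub> (1\<^sub>m N)) *\<^sub>v ?y' = vec p y" by (rule rho_inv_apply[OF h Kf(1)]) simp
    ultimately show "eval (fibre X Q) y = eval (Const (\<theta> (1\<^sub>m m, h, 1\<^sub>m N)) * lin {..<p} M (slice Q)) y"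
      by (simp add: eval_fibre_V[OF QI] eval.ins_mult eval_lin eval_slice[OF QI] M_def vec_transpose_apply(2)[OF r])
  qed (intro polys_fibre polys_mult polys_Const polys_lin polys_slice QI)+
  have fXi: "lin {..<p} (\<lambda>r s. M s r) (fibre \<Xi> P) = Const (\<tau> (inv\<^bsub>GL m\<^esub> T, h, 1\<^sub>m N)) * slice P"
  proof (rule eval_eqI[of _ "{..<p}"])
    fix y :: "nat \<Rightarrow> complex"
    have "eval P (V_point m n p (inv\<^bsub>GL m\<^esub> (inv\<^bsub>GL m\<^esub> T) * J * transpose_mat (inv\<^bsub>GL n\<^esub> h))
        (transpose_mat (\<rho> (h, 1\<^sub>m N)) *\<^sub>v vec p y)) = \<tau> (inv\<^bsub>GL m\<^esub> T, h, 1\<^sub>m N) * eval P (V_point m n p J (vec p y))"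
      by (rule dual_semi_invariant_V[OF P GL_inv(1)[OF T] h Kf(1)]) simp_all
    then show "eval (lin {..<p} (\<lambda>r s. M s r) (fibre \<Xi> P)) y = eval (Const (\<tau> (inv\<^bsub>GL m\<^esub> T, h, 1\<^sub>m N)) * slice P) y"
      by (simp add: GL_inv_inv[OF T] TJ eval_lin eval_fibre_V[OF PI] eval.ins_mult eval_slice[OF PI] M_def
          vec_transpose_apply(1)[OF r])
  qed (intro polys_fibre polys_mult polys_Const polys_lin polys_slice PI)+
  have "apolar (fibre \<Xi> P) (lin {..<p} M (slice Q)) = apolar (lin {..<p} (\<lambda>r s. M s r) (fibre \<Xi> P)) (slice Q)"
    by (rule apolar_lin[symmetric]) (simp_all add: polys_fibre PI polys_slice QI)
  then show ?thesis
    unfolding fX apolar_Const_mult_right fXi apolar_Const_mult_left by (simp add: mult.assoc)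
qed

text \<open>In the product of the two weights from \<open>apolar_fibre\<close> the powers of det h
  cancel, and det(T)^a is left. Since T = \<Xi> X^t, this is a power of
  \<open>gram_minor n m\<close>, as \<open>apolar_of_fibre\<close> requires.\<close>

theorem apolar_slice:
  assumes P: "semi_invariant G (dual_act G actV VI) VI \<tau> P" and Q: "semi_invariant G actV VI \<theta> Q"
    and \<theta>: "\<And>h. h \<in> carrier (GL n) \<Longrightarrow> \<theta> (1\<^sub>m m, h, 1\<^sub>m N) = mdet h ^ b"
    and \<tau>: "\<And>g h. g \<in> carrier (GL m) \<Longrightarrow> h \<in> carrier (GL n) \<Longrightarrow>
      \<tau> (g, h, 1\<^sub>m N) = inverse (mdet g ^ a * mdet h ^ b)"
  shows "apolar P Q = apolar (slice P) (slice Q) * (\<Prod>i\<in>{n - m + 1..n}. \<Prod>j<a. of_nat (i + j))"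
proof -
  define L where "L = subst (\<lambda>c. Var (Inl c) :: ((nat \<times> nat) + (nat \<times> nat)) mpoly) (det_poly m)"
  have Le: "eval L (case_sum \<Xi> X) = mdet (mat m m \<Xi>)" for \<Xi> X
    by (simp add: L_def eval_subst eval_det_poly)
  have Ge: "eval (gram_minor n m) (case_sum \<Xi> X) = mdet (mat m m (\<lambda>(i, j). \<Sum>k<n. \<Xi> (i, k) * X (j, k)))" for \<Xi> X
  proof -
    have "mdet (mat m m (\<lambda>(i, j). \<Sum>k<n. \<Xi> (i, k) * X (j, k))) =
        (\<Sum>p | p permutes {0..<m}. signof p * (\<Prod>i=0..<m. \<Sum>k<n. \<Xi> (i, k) * X (p i, k)))"
      by (subst det_def'[of _ m]) (auto intro!: sum.cong prod.cong dest: permutes_in_image)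
    then show ?thesis
      by (simp add: gram_minor_def gram_def eval.ins_simps of_int_eq_Const atLeast0LessThan)
  qed
  \<comment> \<open>The conditions of \<open>generic_pair\<close>: invertibility of the left block
    of \<Xi> and of \<Xi> X^t. Both determinants are 1 when \<Xi> and X are
    \<open>J\<close>.\<close>
  let ?R = "L * gram_minor n m"
  have R0: "?R \<noteq> 0"
  proof
    assume z: "?R = 0"
    let ?d = "\<lambda>(i, j). if i = j then 1 else 0 :: complex"
    have 1: "mat m m ?d = 1\<^sub>m m" by (rule eq_matI) auto
    have "mat m m (\<lambda>(i, j). \<Sum>k<n. ?d (i, k) * ?d (j, k)) = 1\<^sub>m m"
    proof (rule eq_matI)
      fix i j assume "i < dim_row (1\<^sub>m m :: complex mat)" "j < dim_col (1\<^sub>m m :: complex mat)"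
      then have ij: "i < m" "j < m" by auto
      have "(\<Sum>k<n. ?d (i, k) * ?d (j, k)) = (\<Sum>k<n. if k = i then (if i = j then 1 else 0) else 0)"
        by (rule sum.cong) auto
      then show "mat m m (\<lambda>(i, j). \<Sum>k<n. ?d (i, k) * ?d (j, k)) $$ (i, j) = 1\<^sub>m m $$ (i, j)"
        using ij mn by simp
    qed auto
    then have "eval ?R (case_sum ?d ?d) = 1" unfolding eval.ins_mult Le Ge 1 by simp
    then show False using z by simp
  qed
  show ?thesis
  proof (rule apolar_of_fibre[OF mn R0])
    fix \<Xi> X assume "eval ?R (case_sum \<Xi> X) \<noteq> 0"
    then have ne: "mdet (mat m m \<Xi>) \<noteq> 0" "mdet (mat m m (\<lambda>(i, j). \<Sum>k<n. \<Xi> (i, k) * X (j, k))) \<noteq> 0"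
      by (simp_all add: eval.ins_mult Le Ge)
    obtain h T where hT: "h \<in> carrier (GL n)" "T \<in> carrier (GL m)"
      "T = mat m m (\<lambda>(i, j). \<Sum>k<n. \<Xi> (i, k) * X (j, k))"
      "J * h = mat m n X" "T * J * transpose_mat (inv\<^bsub>GL n\<^esub> h) = mat m n \<Xi>"
      by (rule generic_pair[OF ne])
    have nz: "mdet h \<noteq> 0" "mdet T \<noteq> 0" using hT(1,2) by (simp_all add: GL_carrier_iff)
    have "\<theta> (1\<^sub>m m, h, 1\<^sub>m N) * \<tau> (inv\<^bsub>GL m\<^esub> T, h, 1\<^sub>m N) = mdet T ^ a"
      using nz by (simp add: \<theta>[OF hT(1)] \<tau>[OF GL_inv(1)[OF hT(2)] hT(1)] GL_inv(4)[OF hT(2)] power_inverse field_simps)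
    then show "apolar (fibre \<Xi> P) (fibre X Q) = apolar (slice P) (slice Q) * eval (gram_minor n m) (case_sum \<Xi> X) ^ a"
      using apolar_fibre[OF P Q hT(1,2,4,5)] by (simp add: Ge hT(3))
  qed
qed

end

section \<open>Decomposition of the \<open>b\<close>-function\<close>

lemma slice_simps: "slice (P * Q) = slice P * slice Q" "slice (P - Q) = slice P - slice Q"
  "slice (Const c) = Const c" "slice (P ^ k) = slice P ^ k" "slice (\<Prod>a\<in>A. F a) = (\<Prod>a\<in>A. slice (F a))" "slice 0 = 0"
  by (simp_all add: slice_def subst.ins_simps)

lemma rational_character_one:
  assumes "rational_character N K \<omega>" "1\<^sub>m N \<in> K"
  shows "\<omega> (1\<^sub>m N) = 1"
proof -
  have "\<omega> (1\<^sub>m N * 1\<^sub>m N) = \<omega> (1\<^sub>m N) * \<omega> (1\<^sub>m N)" "\<omega> (1\<^sub>m N) \<noteq> 0"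
    using assms unfolding rational_character_def by blast+
  then show ?thesis by simp
qed

lemma prod_weight_G:
  fixes l :: nat
  shows "(\<Prod>j<l. weight_G (d j) (e j) (\<omega> j) (g, h, k) ^ r j) =
    mdet g ^ (\<Sum>j<l. r j * d j) * mdet h ^ (\<Sum>j<l. r j * e j) * (\<Prod>j<l. \<omega> j k ^ r j)"
  by (induction l) (simp_all add: weight_G_def power_mult_distrib power_add power_mult[symmetric] mult_ac)

text \<open>The exponent of det h1 may be negative, hence integral powers and the condition on h1;
  stated in the form that the averaging over GL expects.\<close>

lemma prod_weight_H:
  fixes l :: nat
  assumes "mdet h1 \<noteq> 0"
  shows "(\<Prod>j<l. weight_H (d j) (e j) (\<omega> j) (h1, h2, k) ^ r j) =
    mdet h1 powi (\<Sum>j<l. (int (e j) - int (d j)) * int (r j)) * mdet h2 powi int (\<Sum>j<l. r j * e j) * (\<Prod>j<l. \<omega> j k ^ r j)"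
proof (induction l)
  case (Suc l)
  have "weight_H (d l) (e l) (\<omega> l) (h1, h2, k) ^ r l =
      mdet h1 powi ((int (e l) - int (d l)) * int (r l)) * mdet h2 ^ (r l * e l) * \<omega> l k ^ r l"
    by (simp only: weight_H_def prod.case power_mult_distrib power_mult[symmetric] power_int_mult power_int_of_nat
        mult.commute[of "e l"])
  then show ?case using assms Suc by (simp add: power_int_add power_add mult_ac del: of_nat_sum of_nat_add of_nat_mult)
qed simp

locale slice_tuple = gl_rep +
  fixes l :: nat and f :: "nat \<Rightarrow> vcoord mpoly" and d e :: "nat \<Rightarrow> nat" and \<omega> :: "nat \<Rightarrow> complex mat \<Rightarrow> complex"
  assumes red: "reductive N K"
    and char_one: "j < l \<Longrightarrow> \<omega> j (1\<^sub>m N) = 1"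
    and nonzero: "j < l \<Longrightarrow> f j \<noteq> 0"
    and semi: "j < l \<Longrightarrow> semi_invariant G actV VI (weight_G (d j) (e j) (\<omega> j)) (f j)"
    and mf: "multiplicity_free H actF {..<p} (\<lambda>x. \<Prod>j<l. weight_H (d j) (e j) (\<omega> j) x)"
begin

abbreviation "wG j \<equiv> weight_G (d j) (e j) (\<omega> j)"
abbreviation "wH j \<equiv> weight_H (d j) (e j) (\<omega> j)"

lemma prod_char_one: "(\<Prod>j<l. \<omega> j (1\<^sub>m N) ^ r j) = 1"
  by (rule prod.neutral) (simp add: char_one)

text \<open>The origin of the exponent e - d: det h1 enters with -d through the first factor of G
  and with e through the block-diagonal matrix.\<close>

lemma slice_weight_wG: "x \<in> carrier H \<Longrightarrow> slice_weight (wG j) x = wH j x"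
proof -
  assume "x \<in> carrier H"
  moreover obtain h1 h2 k where xe: "x = (h1, h2, k)" by (cases x)
  ultimately have x: "h1 \<in> carrier (GL m)" "h2 \<in> carrier (GL (n - m))" by simp_all
  have nz: "mdet h1 \<noteq> 0" using x(1) by (simp add: GL_carrier_iff)
  have t: "mdet (transpose_mat (inv\<^bsub>GL m\<^esub> h1)) = inverse (mdet h1)"
    using det_transpose[OF GL_carrier_mat[OF GL_inv(1)[OF x(1)]]] GL_inv(4)[OF x(1)] by simp
  show ?thesis
    unfolding xe slice_weight_def weight_G_def weight_H_def
    using nz by (simp add: t block_GL(2)[OF x] power_int_diff power_mult_distrib power_inverse field_simps)
qed

lemma semi_slice:
  assumes "semi_invariant G actV VI (\<lambda>x. \<Prod>j<l. wG j x ^ r j) Q"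
  shows "semi_invariant H actF {..<p} (\<lambda>x. \<Prod>j<l. wH j x ^ r j) (slice Q)"
proof -
  have wt: "slice_weight (\<lambda>x. \<Prod>j<l. wG j x ^ r j) x = (\<Prod>j<l. wH j x ^ r j)" if "x \<in> carrier H" for x
    using slice_weight_wG[OF that] by (simp add: slice_weight_def case_prod_unfold)
  show ?thesis
    by (rule semi_invariant_cong[THEN iffD1, OF _ semi_invariant_slice[OF assms]]) (rule wt)
qed

lemma slice_nonzero: "j < l \<Longrightarrow> slice (f j) \<noteq> 0"
  using slice_eq_0[OF semi] nonzero by blast

lemma slice_semi: "j < l \<Longrightarrow> semi_invariant H actF {..<p} (wH j) (slice (f j))"
  by (rule semi_invariant_cong[THEN iffD1, OF _ semi_invariant_slice[OF semi]]) (rule slice_weight_wG)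

lemma multiplicity_free_V: "multiplicity_free G actV VI (\<lambda>x. \<Prod>j<l. wG j x)"
  unfolding multiplicity_free_def
proof
  fix k
  let ?a = "\<Prod>j<l. f j ^ k"
  have a: "semi_invariant G actV VI (\<lambda>x. \<Prod>j<l. wG j x ^ k) ?a"
    using semi by (intro semi_invariant_prod semi_invariant_power) auto
  have nz: "?a \<noteq> 0" using nonzero by (intro mpoly_prod_neq_0 mpoly_power_neq_0) auto
  have m: "multiplicity H actF {..<p} (\<lambda>x. \<Prod>j<l. wH j x ^ k) = 1"
    using mf by (simp add: multiplicity_free_def prod_power_distrib)
  have "multiplicity G actV VI (\<lambda>x. \<Prod>j<l. wG j x ^ k) = 1"
  proof (rule multiplicity_1I[OF a nz])
    fix b assume b: "semi_invariant G actV VI (\<lambda>x. \<Prod>j<l. wG j x ^ k) b"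
    have "slice ?a \<noteq> 0" using slice_eq_0[OF a] nz by blast
    then obtain c where c: "slice b = Const c * slice ?a"
      by (rule multiplicity_1_proportional[OF m semi_slice[OF a] _ semi_slice[OF b]])
    have "semi_invariant G actV VI (\<lambda>x. \<Prod>j<l. wG j x ^ k) (b - Const c * ?a)"
      by (intro semi_invariant_diff semi_invariant_Const_mult a b)
    moreover have "slice (b - Const c * ?a) = 0"
      using c by (simp only: slice_simps(1-3) diff_self)
    ultimately have "b - Const c * ?a = 0" by (rule slice_eq_0)
    then show "\<exists>c. b = Const c * ?a" by auto
  qed
  then show "multiplicity G actV VI (\<lambda>x. (\<Prod>j<l. wG j x) ^ k) = 1" by (simp add: prod_power_distrib)
qed

sublocale V: semi_inv_tuple G actV VI l wG f
proof
  have wt: "(\<Prod>j<l. wG j (g, 1\<^sub>m n, 1\<^sub>m N) ^ r j) = mdet g powi int (\<Sum>j<l. r j * d j)"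
    "(\<Prod>j<l. wG j (1\<^sub>m m, h, 1\<^sub>m N) ^ r j) = mdet h powi int (\<Sum>j<l. r j * e j)" for g h r
    by (simp_all add: prod_weight_G prod_char_one del: of_nat_sum)
  show "\<exists>u. semi_invariant G actV VI (\<lambda>x. \<Prod>j<l. wG j x ^ r j) u \<and> homogeneous D u \<and> apolar w u \<noteq> 0"
    if "w \<noteq> 0" "homogeneous D w" "semi_invariant G (dual_act G actV VI) VI (\<lambda>x. inverse (\<Prod>j<l. wG j x ^ r j)) w" for w D r
    by (rule reductive_pairing[OF K red finite_V_index rational_action_V that wt])
  show "\<exists>w. semi_invariant G (dual_act G actV VI) VI (\<lambda>x. inverse (\<Prod>j<l. wG j x ^ r j)) w \<and> homogeneous D w \<and> apolar w u \<noteq> 0"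
    if "u \<noteq> 0" "homogeneous D u" "semi_invariant G actV VI (\<lambda>x. \<Prod>j<l. wG j x ^ r j) u" for u D r
    by (rule reductive_pairing_dual[OF K red finite_V_index rational_action_V that wt])
qed (fact finite_V_index linear_action_V semi nonzero multiplicity_free_V)+

sublocale F: semi_inv_tuple H actF "{..<p}" l wH "\<lambda>j. slice (f j)"
proof
  have wt: "h1 \<in> carrier (GL m) \<Longrightarrow> (\<Prod>j<l. wH j (h1, 1\<^sub>m (n - m), 1\<^sub>m N) ^ r j) = mdet h1 powi (\<Sum>j<l. (int (e j) - int (d j)) * int (r j))"
    "(\<Prod>j<l. wH j (1\<^sub>m m, h2, 1\<^sub>m N) ^ r j) = mdet h2 powi int (\<Sum>j<l. r j * e j)" for h1 h2 r
    by (simp_all add: prod_weight_H GL_carrier_iff prod_char_one del: of_nat_sum)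
  show "\<exists>u. semi_invariant H actF {..<p} (\<lambda>x. \<Prod>j<l. wH j x ^ r j) u \<and> homogeneous D u \<and> apolar w u \<noteq> 0"
    if "w \<noteq> 0" "homogeneous D w" "semi_invariant H (dual_act H actF {..<p}) {..<p} (\<lambda>x. inverse (\<Prod>j<l. wH j x ^ r j)) w" for w D r
    by (rule reductive_pairing[OF K red finite_lessThan rational_action_F that wt])
  show "\<exists>w. semi_invariant H (dual_act H actF {..<p}) {..<p} (\<lambda>x. inverse (\<Prod>j<l. wH j x ^ r j)) w \<and> homogeneous D w \<and> apolar w u \<noteq> 0"
    if "u \<noteq> 0" "homogeneous D u" "semi_invariant H actF {..<p} (\<lambda>x. \<Prod>j<l. wH j x ^ r j) u" for u D r
    by (rule reductive_pairing_dual[OF K red finite_lessThan rational_action_F that wt])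
qed (fact finite_lessThan linear_action_F slice_semi slice_nonzero mf)+

lemma apolar_slice_prod:
  assumes "semi_invariant G (dual_act G actV VI) VI (\<lambda>x. inverse (\<Prod>j<l. wG j x ^ r j)) P"
    and "semi_invariant G actV VI (\<lambda>x. \<Prod>j<l. wG j x ^ r j) Q"
  shows "apolar P Q = apolar (slice P) (slice Q) * (\<Prod>i\<in>{n - m + 1..n}. \<Prod>j<\<Sum>k<l. r k * d k. of_nat (i + j))"
proof (rule apolar_slice[OF assms])
  show "(\<Prod>j<l. wG j (1\<^sub>m m, h, 1\<^sub>m N) ^ r j) = mdet h ^ (\<Sum>j<l. r j * e j)" for h
    by (simp add: prod_weight_G prod_char_one)
  show "inverse (\<Prod>j<l. wG j (g, h, 1\<^sub>m N) ^ r j) =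
      inverse (mdet g ^ (\<Sum>k<l. r k * d k) * mdet h ^ (\<Sum>j<l. r j * e j))" for g h
    by (simp add: prod_weight_G prod_char_one)
qed

text \<open>The slice of w cannot vanish, because the non-zero pairing of w with \<open>f j\<close>
  is a multiple of the pairing of their slices. Thus slices of duals are duals up to
  constants.\<close>

lemma dual_slice:
  assumes j: "j < l" and w: "w \<noteq> 0" "semi_invariant G (dual_act G actV VI) VI (\<lambda>x. inverse (wG j x)) w"
  shows "slice w \<noteq> 0" "semi_invariant H (dual_act H actF {..<p}) {..<p} (\<lambda>x. inverse (wH j x)) (slice w)"
proof -
  let ?r = "\<lambda>a. if a = j then 1 else 0 :: nat"
  have "apolar w (f j) = apolar (slice w) (slice (f j)) * (\<Prod>i\<in>{n - m + 1..n}. \<Prod>j<\<Sum>k<l. ?r k * d k. of_nat (i + j))"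
    by (rule apolar_slice_prod; simp only: V.prod_power_unit[OF j] w semi[OF j])
  then show "slice w \<noteq> 0" using V.dual_pairing_single_neq_0[OF j w] by auto
  have wt: "slice_weight (\<lambda>x. inverse (wG j x)) x = inverse (wH j x)" if "x \<in> carrier H" for x
    using slice_weight_wG[OF that, of j] by (simp add: slice_weight_def case_prod_unfold)
  show "semi_invariant H (dual_act H actF {..<p}) {..<p} (\<lambda>x. inverse (wH j x)) (slice w)"
    by (rule semi_invariant_cong[THEN iffD1, OF _ dual_semi_invariant_slice[OF w(2)]]) (rule wt)
qed

lemma eval_bracket:
  "eval (bracket l \<mu> d (n - m) n) (\<lambda>j. of_nat (r j)) =
    (\<Prod>i\<in>{n - m + 1..n}. \<Prod>j<\<Sum>k<l. \<mu> k * d k. of_nat (i + (j + (\<Sum>k<l. r k * d k))))"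
  unfolding bracket_def
  by (simp add: eval.ins_simps algebra_simps)

text \<open>Since no pairing of products of powers vanishes, dividing the value at r + \<mu> by that
  at r is legitimate on V and on F. The constants \<open>C r\<close> relating the two choices of
  duals are multiplicative in r, so only \<open>C \<mu>\<close> survives, and natural r determine
  the polynomials.\<close>

theorem b_function_slice:
  assumes b: "is_b_function G actV VI l wG f \<mu> b"
    and b': "is_b_function H actF {..<p} l wH (\<lambda>j. slice (f j)) \<mu> b'"
  shows "\<exists>c. c \<noteq> 0 \<and> b = Const c * bracket l \<mu> d (n - m) n * b'"
proof -
  obtain fs where fs: "\<And>j. j < l \<Longrightarrow> dual_semi_invariant G actV VI (wG j) (f j) (fs j)"
    and be: "b_equation l (\<Prod>j<l. fs j ^ \<mu> j) f \<mu> b"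
    using b unfolding V.is_b_function_iff by blast
  obtain fs' where fs': "\<And>j. j < l \<Longrightarrow> dual_semi_invariant H actF {..<p} (wH j) (slice (f j)) (fs' j)"
    and be': "b_equation l (\<Prod>j<l. fs' j ^ \<mu> j) (\<lambda>j. slice (f j)) \<mu> b'"
    using b' unfolding F.is_b_function_iff by blast
  have s: "semi_invariant G (dual_act G actV VI) VI (\<lambda>x. inverse (wG j x)) (fs j)" "fs j \<noteq> 0"
    "semi_invariant H (dual_act H actF {..<p}) {..<p} (\<lambda>x. inverse (wH j x)) (fs' j)" "fs' j \<noteq> 0" if "j < l" for j
    using fs[OF that] fs'[OF that] by (auto simp: dual_semi_invariant_def)
  have "\<forall>j. \<exists>c. j < l \<longrightarrow> c \<noteq> 0 \<and> slice (fs j) = Const c * fs' j"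
  proof (intro allI)
    fix j show "\<exists>c. j < l \<longrightarrow> c \<noteq> 0 \<and> slice (fs j) = Const c * fs' j"
    proof (cases "j < l")
      case True
      obtain c where "c \<noteq> 0" "slice (fs j) = Const c * fs' j"
        by (rule F.dual_proportional[OF True s(4,3)[OF True] dual_slice[OF True s(2,1)[OF True]]])
      then show ?thesis by blast
    qed simp
  qed
  from choice[OF this] obtain c where c: "\<And>j. j < l \<Longrightarrow> c j \<noteq> 0" "\<And>j. j < l \<Longrightarrow> slice (fs j) = Const (c j) * fs' j"
    by blast
  \<comment> \<open>The duals chosen on V restrict to those chosen on F up to the factors
    \<open>c j\<close>; \<open>C r\<close> collects them for the exponents r, while \<open>U\<close>
    is the factor produced by the matrix variables.\<close>
  define C where "C r = (\<Prod>j<l. c j ^ r j)" for r :: "nat \<Rightarrow> nat"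
  define U where "U a = (\<Prod>i\<in>{n - m + 1..n}. \<Prod>j<a. of_nat (i + j) :: complex)" for a :: nat
  define \<gamma> where "\<gamma> r = apolar (\<Prod>j<l. fs' j ^ r j) (\<Prod>j<l. slice (f j) ^ r j)" for r
  define D where "D r = (\<Sum>k<l. r k * d k)" for r
  have C0: "C r \<noteq> 0" for r using c(1) by (simp add: C_def)
  \<comment> \<open>The index i starts at n - m + 1, which is positive, so no factor i + j is
    0.\<close>
  have U0: "U a \<noteq> 0" for a by (auto simp: U_def simp del: of_nat_add)
  have \<gamma>0: "\<gamma> r \<noteq> 0" for r
    unfolding \<gamma>_def using s
    by (intro F.dual_pairing_neq_0 F.dual_prod_power mpoly_prod_neq_0 mpoly_power_neq_0) auto
  have main: "apolar (\<Prod>j<l. fs j ^ r j) (\<Prod>j<l. f j ^ r j) = C r * \<gamma> r * U (D r)" for r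
  proof -
    have "slice (\<Prod>j<l. fs j ^ r j) = (\<Prod>j<l. Const (c j ^ r j) * fs' j ^ r j)"
      unfolding slice_simps by (rule prod.cong) (simp_all add: c(2) power_mult_distrib Const_power)
    also have "\<dots> = Const (C r) * (\<Prod>j<l. fs' j ^ r j)"
      by (simp add: prod.distrib C_def Const_prod)
    finally have sl: "slice (\<Prod>j<l. fs j ^ r j) = Const (C r) * (\<Prod>j<l. fs' j ^ r j)" .
    have "apolar (\<Prod>j<l. fs j ^ r j) (\<Prod>j<l. f j ^ r j) =
        apolar (slice (\<Prod>j<l. fs j ^ r j)) (slice (\<Prod>j<l. f j ^ r j)) * U (D r)"
      unfolding U_def D_def using s by (intro apolar_slice_prod V.dual_prod_power V.semi_prod_power)
    then show ?thesis unfolding sl apolar_Const_mult_left unfolding slice_simps \<gamma>_def by (simp only: mult_ac)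
  qed
  have DD: "D (\<lambda>j. r j + \<mu> j) = D r + D \<mu>" for r by (simp add: D_def algebra_simps sum.distrib)
  have CC: "C (\<lambda>j. r j + \<mu> j) = C r * C \<mu>" for r by (simp add: C_def power_add prod.distrib)
  \<comment> \<open>The last t of the a + t factors are shifted by a; for a = \<open>D r\<close> and
    t = \<open>D \<mu>\<close> they make up the value of the bracket at r.\<close>
  have UU: "U (a + t) = U a * (\<Prod>i\<in>{n - m + 1..n}. \<Prod>j<t. of_nat (i + (j + a)))" for a t
  proof -
    have "(\<Prod>j<a + t. of_nat (i + j) :: complex) = (\<Prod>j<a. of_nat (i + j)) * (\<Prod>j<t. of_nat (i + (j + a)))" for i :: nat
      by (induction t) (simp_all add: add_ac)
    then show ?thesis by (simp add: U_def prod.distrib)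
  qed
  have ev: "eval b (\<lambda>j. of_nat (r j)) = eval (Const (C \<mu>) * bracket l \<mu> d (n - m) n * b') (\<lambda>j. of_nat (r j))" for r
  proof -
    let ?B = "eval (bracket l \<mu> d (n - m) n) (\<lambda>j. of_nat (r j))"
    have "C r * C \<mu> * \<gamma> (\<lambda>j. r j + \<mu> j) * (U (D r) * ?B) = eval b (\<lambda>j. of_nat (r j)) * (C r * \<gamma> r * U (D r))"
      using b_equation_apolar[OF be, of r] unfolding main DD CC UU eval_bracket D_def[symmetric] .
    moreover have "\<gamma> (\<lambda>j. r j + \<mu> j) = eval b' (\<lambda>j. of_nat (r j)) * \<gamma> r"
      using b_equation_apolar[OF be', of r] unfolding \<gamma>_def .
    ultimately have "(C \<mu> * ?B * eval b' (\<lambda>j. of_nat (r j))) * (C r * \<gamma> r * U (D r)) =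
        eval b (\<lambda>j. of_nat (r j)) * (C r * \<gamma> r * U (D r))" by (simp add: mult_ac)
    then show ?thesis using C0 \<gamma>0 U0 by (simp add: eval.ins_mult)
  qed
  have z: "eval (b - Const (C \<mu>) * bracket l \<mu> d (n - m) n * b') s = 0" for s
    by (rule eval_of_nat_vanishing) (simp add: eval.ins_diff ev)
  have "b = Const (C \<mu>) * bracket l \<mu> d (n - m) n * b'"
  proof (rule eval_eqI[of _ UNIV])
    show "eval b s = eval (Const (C \<mu>) * bracket l \<mu> d (n - m) n * b') s" for s
      using z[of s] by (simp add: eval.ins_diff)
  qed (simp_all add: polys_UNIV)
  then show ?thesis using C0 by blast
qed

end

theorem theorem2p19:
  fixes m n N p l :: nat
    and K :: "complex mat set"
    and \<rho> :: "complex mat \<times> complex mat \<Rightarrow> complex mat"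
    and f :: "nat \<Rightarrow> vcoord mpoly"
    and d e :: "nat \<Rightarrow> nat"
    and \<sigma>' :: "nat \<Rightarrow> complex mat \<Rightarrow> complex"
  assumes "1 \<le> m" and "m \<le> n"
    and "linear_algebraic_group N K" and "zariski_connected N K" and "reductive N K"
    and "rational_rep (GL n \<times>\<times> group_on N K) (GL_prod_coords n N) p \<rho>"
    and "\<And>i. i < l \<Longrightarrow> rational_character N K (\<sigma>' i)"
    and "\<And>i. i < l \<Longrightarrow> f i \<noteq> 0"
    and "\<And>i. i < l \<Longrightarrow> semi_invariant (group_G m n N K) (act_V m n p \<rho>) (V_index m n p)
                          (weight_G (d i) (e i) (\<sigma>' i)) (f i)"
    and "multiplicity_free (group_H m n N K) (act_F m n p \<rho>) {..<p}
           (\<lambda>h. \<Prod>i<l. weight_H (d i) (e i) (\<sigma>' i) h)"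
  shows "multiplicity_free (group_G m n N K) (act_V m n p \<rho>) (V_index m n p)
           (\<lambda>g. \<Prod>i<l. weight_G (d i) (e i) (\<sigma>' i) g) \<and>
         (\<forall>\<mu> :: nat \<Rightarrow> nat.
           let is_b = is_b_function (group_G m n N K) (act_V m n p \<rho>) (V_index m n p) l
                        (\<lambda>i. weight_G (d i) (e i) (\<sigma>' i)) f \<mu>;
               is_b_v = is_b_function (group_H m n N K) (act_F m n p \<rho>) {..<p} l
                        (\<lambda>i. weight_H (d i) (e i) (\<sigma>' i)) (\<lambda>i. slice (f i)) \<mu>
           in (\<exists>b. is_b b) \<and> (\<exists>b'. is_b_v b') \<and>
              (\<forall>b b'. is_b b \<and> is_b_v b' \<longrightarrow>
                 (\<exists>c. c \<noteq> 0 \<and> b = Const c * bracket l \<mu> d (n - m) n * b')))"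
proof -
  have K: "subgroup K (GL N)" using assms(3) by (simp add: linear_algebraic_group_def)
  interpret gl_rep m n N p K \<rho> by (rule gl_rep.intro) (fact assms K)+
  interpret slice_tuple m n N p K \<rho> l f d e \<sigma>'
  proof
    show "\<sigma>' j (1\<^sub>m N) = 1" if "j < l" for j
      by (rule rational_character_one[OF assms(7)[OF that] Kf(1)])
  qed (fact assms[unfolded group_G_def group_H_def])+
  show ?thesis
    unfolding group_G_def group_H_def Let_def
    using multiplicity_free_V V.ex_b_function F.ex_b_function b_function_slice by blast
qed

end
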